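(* Let $(P,Q)$ be an irreducible pair in $W$ and let $m,n\in\mathbb{N}$, $m,n>1$, $\gcd(m,n)=1$, with $v_{1,1}(P)/v_{1,1}(Q)=m/n$. Then there exist $\nu\in\mathbb{N}$, an automorphism $\psi$ of $W$, and for $0\le j\le\nu$ integers $l_j\in\mathbb{N}$, elements $P_j,Q_j\in W^{(l_j)}$ and $(\rho_j,\sigma_j)\in\mathfrak V$, and for $1\le j\le\nu$ automorphisms $\varphi_j$ of $W^{(l_j)}$, such that $P_0=\psi(P)$, $Q_0=\psi(Q)$, $l_0=1$, $(1,0)>(\rho_0,\sigma_0)$, $v_{1,1}(P_0)=v_{1,1}(P)$, $v_{1,1}(Q_0)=v_{1,1}(Q)$, and for $j\ge1$: $l_j=\mathrm{lcm}(l_{j-1},\rho_{j-1})$, $P_j=\varphi_j(P_{j-1})$, $Q_j=\varphi_j(Q_{j-1})$ (with $W^{(l_{j-1})}\subseteq W^{(l_j)}$); and moreover: (1) $[Q_j,P_j]=1$ for all $j$; (2) $v_{1,-1}(\mathrm{en}_{\rho_j,\sigma_j}(P_j))<0$ and $v_{1,-1}(\mathrm{en}_{\rho_j,\sigma_j}(Q_j))<0$ for all $j$; (3) $(\rho_j,\sigma_j)\in\mathrm{Val}(P_j)\cap\mathrm{Val}(Q_j)$ for all $j$; (4) $v_{\rho_j,\sigma_j}(P_j)>0$ and $v_{\rho_j,\sigma_j}(Q_j)>0$ for all $j$; (5) $v_{\rho_j,\sigma_j}(P_j)/v_{\rho_j,\sigma_j}(Q_j)=m/n$ for all $j$; (6)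 $\mathrm{en}_{\rho_j,\sigma_j}(P_j)=\frac mn\mathrm{en}_{\rho_j,\sigma_j}(Q_j)$ for all $j$; (7) $(\rho_{j-1},\sigma_{j-1})>(\rho_j,\sigma_j)$ for $1\le j\le\nu$; (8) $v_{\rho_{j-1},\sigma_{j-1}}(P_j)=v_{\rho_{j-1},\sigma_{j-1}}(P_{j-1})$ and $v_{\rho_{j-1},\sigma_{j-1}}(Q_j)=v_{\rho_{j-1},\sigma_{j-1}}(Q_{j-1})$ for $1\le j\le\nu$; (9) $\ell_{\rho'',\sigma''}(P_j)=\ell_{\rho'',\sigma''}(P_{j-1})$ and $\ell_{\rho'',\sigma''}(Q_j)=\ell_{\rho'',\sigma''}(Q_{j-1})$ for $1\le j\le\nu$ and all $(\rho'',\sigma'')\in\mathfrak V$ with $(\rho_{j-1},\sigma_{j-1})<(\rho'',\sigma'')<(-1,1)$; (10) $\mathrm{en}_{\rho_j,\sigma_j}(P_j)=\mathrm{st}_{\rho_{j-1},\sigma_{j-1}}(P_j)$ for $1\le j\le\nu$; (11) for each $1\le j\le\nu$ there is a $(\rho_{j-1},\sigma_{j-1})$-homogeneous $F_{j-1}\in W^{(l_{j-1})}$, not a monomial, with $v_{\rho_{j-1},\sigma_{j-1}}(F_{j-1})=\rho_{j-1}+\sigma_{j-1}$ and $[P_{j-1},F_{j-1}]_{\rho_{j-1},\sigma_{j-1}}=\ell_{\rho_{j-1},\sigma_{j-1}}(P_{j-1})$; furthermore, if $\mathrm{en}_{\rho_{j-1},\sigma_{j-1}}(F_{j-1})=(1,1)$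 then $\mathrm{st}_{\rho_{j-1},\sigma_{j-1}}(P_j)=\mathrm{en}_{\rho_{j-1},\sigma_{j-1}}(P_{j-1})$; (12) $[Q_j,P_j]_{\rho_j,\sigma_j}=0$ for $0\le j\le\nu-1$; (13) $[Q_\nu,P_\nu]_{\rho_\nu,\sigma_\nu}=1$.
   Context: $K$ is an algebraically closed field of characteristic zero. For $l\in\mathbb{N}$, $W^{(l)}$ is the associative $K$-algebra with $K$-basis $\{X^{i/l}Y^j:i\in\mathbb{Z},j\in\mathbb{N}_0\}$, powers of $X$ multiplying as Laurent monomials and $[Y,X^\alpha]=\alpha X^{\alpha-1}$ ($\alpha\in\frac1l\mathbb{Z}$); $W^{(l)}\subseteq W^{(h)}$ when $l\mid h$, and the Weyl algebra $W$ ($[Y,X]=1$, basis $X^iY^j$, $i,j\ge0$) lies in $W^{(1)}$. $\Psi^{(l)}(X^{i/l}Y^j)=x^{i/l}y^j\in K[x^{\pm1/l},y]$ ($K$-linear); $\mathrm{Supp}(P)$ = exponents of $\Psi^{(l)}(P)$ with nonzero coefficient. $\mathfrak V=\{(\rho,\sigma)\in\mathbb{Z}^2:\gcd(\rho,\sigma)=1,\rho+\sigma>0\}$, $v_{\rho,\sigma}(a,b)=\rho a+\sigma b$ (also for $(\rho,\sigma)=(1,1),(1,-1)$). For $P\ne0$, $v_{\rho,\sigma}(P)=\max_{\mathrm{Supp}(P)}v_{\rho,\sigma}$, $\ell_{\rho,\sigma}(P)$ = sum of terms of $\Psi^{(l)}(P)$ of degree $v_{\rho,\sigma}(P)$; homogeneous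 = equal to its leading term. $\mathrm{st}_{\rho,\sigma}(P)$: among points $(a,b)\in\mathrm{Supp}(\ell_{\rho,\sigma}(P))$ maximizing $a-b$, the one with largest $a$; $\mathrm{en}_{\rho,\sigma}(P)$: among those maximizing $b-a$, the one with largest $b$. $\mathrm{Val}(P)=\{(\rho,\sigma)\in\mathfrak V:\#\mathrm{Supp}(\ell_{\rho,\sigma}(P))>1\}$. Order: on $\overline{\mathfrak V}=\mathfrak V\cup\{(1,-1),(-1,1)\}$, $(1,-1)<(\rho,\sigma)<(-1,1)$ for $(\rho,\sigma)\in\mathfrak V$, and for $(\rho_1,\sigma_1),(\rho,\sigma)\in\mathfrak V$, $(\rho_1,\sigma_1)\le(\rho,\sigma)$ iff $\rho_1\sigma-\sigma_1\rho\ge0$. $[P,Q]_{\rho,\sigma}:=0$ if $[P,Q]=0$ or $v_{\rho,\sigma}([P,Q])<v_{\rho,\sigma}(P)+v_{\rho,\sigma}(Q)-(\rho+\sigma)$, else $\ell_{\rho,\sigma}([P,Q])$. Irreducible pair: $(P,Q)=(\psi(X),\psi(Y))$ for an endomorphism $\psi$ of $W$ with $v_{1,1}(\psi(X)),v_{1,1}(\psi(Y))\ge2$ and no automorphisms $\phi_1,\phi_2$ of $W$ with $v_{1,1}(\phi_1\psi\phi_2(X))+v_{1,1}(\phi_1\psi\phi_2(Y))<v_{1,1}(\psi(X))+v_{1,1}(\psi(Y))$. *)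

theory Defs
  imports "HOL-Computational_Algebra.Polynomial"
begin

definition alg_closed :: "'k::field itself \<Rightarrow> bool" where
  "alg_closed _ \<longleftrightarrow> (\<forall>p::'k poly. degree p > 0 \<longrightarrow> (\<exists>x. poly p x = 0))"

text \<open>An element is given by its coefficient function: the coefficient of
  X^a Y^b, where a is a rational exponent and b a natural number.
  W^(l) consists of finitely supported coefficient functions whose
  X-exponents lie in (1/l)Z; the Weyl algebra W consists of those with
  X-exponents in N_0.  In this way W^(l) is contained in W^(h) for l dvd h,
  and W is contained in W^(1), as in the paper.\<close>

type_synonym 'k wel = "rat \<times> nat \<Rightarrow> 'k"

definition wsupp :: "'k::zero wel \<Rightarrow> (rat \<times> nat) set" where
  "wsupp P = {x. P x \<noteq> 0}"

definition Wl :: "nat \<Rightarrow> 'k::zero wel set" where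
  "Wl l = {P. finite (wsupp P) \<and> (\<forall>x\<in>wsupp P. of_nat l * fst x \<in> \<int>)}"

definition Weyl :: "'k::zero wel set" where
  "Weyl = {P. finite (wsupp P) \<and> (\<forall>x\<in>wsupp P. fst x \<in> \<int> \<and> fst x \<ge> 0)}"

definition wzero :: "'k::zero wel" where
  "wzero = (\<lambda>_. 0)"

definition wone :: "'k::{zero,one} wel" where
  "wone = (\<lambda>x. if x = (0, 0) then 1 else 0)"

definition wX :: "'k::{zero,one} wel" where
  "wX = (\<lambda>x. if x = (1, 0) then 1 else 0)"

definition wY :: "'k::{zero,one} wel" where
  "wY = (\<lambda>x. if x = (0, 1) then 1 else 0)"

definition wadd :: "'k::plus wel \<Rightarrow> 'k wel \<Rightarrow> 'k wel" where
  "wadd P Q = (\<lambda>x. P x + Q x)"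

definition wsub :: "'k::minus wel \<Rightarrow> 'k wel \<Rightarrow> 'k wel" where
  "wsub P Q = (\<lambda>x. P x - Q x)"

definition wsmul :: "'k::times \<Rightarrow> 'k wel \<Rightarrow> 'k wel" where
  "wsmul c P = (\<lambda>x. c * P x)"

text \<open>Multiplication: (X^a Y^j)(X^b Y^k) = sum over t \<le> j of
  (j choose t) b(b-1)...(b-t+1) X^(a+b-t) Y^(j-t+k); this is exactly the
  product determined by [Y, X^b] = b X^(b-1) (Y acts as d/dX).\<close>

definition wmul :: "'k::field_char_0 wel \<Rightarrow> 'k wel \<Rightarrow> 'k wel" where
  "wmul P Q = (\<lambda>(c, d). \<Sum>(x, y, t) \<in> {(x, y, t). x \<in> wsupp P \<and> y \<in> wsupp Q \<and> t \<le> snd x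
        \<and> fst x + fst y - of_nat t = c \<and> snd x - t + snd y = d}.
      P x * Q y * of_nat (snd x choose t) * (\<Prod>i<t. of_rat (fst y) - of_nat i))"

definition wcomm :: "'k::field_char_0 wel \<Rightarrow> 'k wel \<Rightarrow> 'k wel" where
  "wcomm P Q = wsub (wmul P Q) (wmul Q P)"

definition alg_endo :: "'k::field_char_0 wel set \<Rightarrow> ('k wel \<Rightarrow> 'k wel) \<Rightarrow> bool" where
  "alg_endo C \<psi> \<longleftrightarrow>
     (\<forall>P\<in>C. \<psi> P \<in> C)
   \<and> (\<forall>P\<in>C. \<forall>Q\<in>C. \<psi> (wadd P Q) = wadd (\<psi> P) (\<psi> Q))
   \<and> (\<forall>c. \<forall>P\<in>C. \<psi> (wsmul c P) = wsmul c (\<psi> P))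
   \<and> (\<forall>P\<in>C. \<forall>Q\<in>C. \<psi> (wmul P Q) = wmul (\<psi> P) (\<psi> Q))
   \<and> \<psi> wone = wone"

definition alg_auto :: "'k::field_char_0 wel set \<Rightarrow> ('k wel \<Rightarrow> 'k wel) \<Rightarrow> bool" where
  "alg_auto C \<psi> \<longleftrightarrow> alg_endo C \<psi> \<and> bij_betw \<psi> C C"

definition Vset :: "(int \<times> int) set" where
  "Vset = {(\<rho>, \<sigma>). gcd \<rho> \<sigma> = 1 \<and> \<rho> + \<sigma> > 0}"

definition vpt :: "int \<Rightarrow> int \<Rightarrow> rat \<times> nat \<Rightarrow> rat" where
  "vpt \<rho> \<sigma> x = of_int \<rho> * fst x + of_int \<sigma> * of_nat (snd x)"

definition vdeg :: "int \<Rightarrow> int \<Rightarrow> 'k::zero wel \<Rightarrow> rat" where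
  "vdeg \<rho> \<sigma> P = Max (vpt \<rho> \<sigma> ` wsupp P)"

definition lead :: "int \<Rightarrow> int \<Rightarrow> 'k::zero wel \<Rightarrow> 'k wel" where
  "lead \<rho> \<sigma> P = (\<lambda>x. if vpt \<rho> \<sigma> x = vdeg \<rho> \<sigma> P then P x else 0)"

definition homogeneous :: "int \<Rightarrow> int \<Rightarrow> 'k::zero wel \<Rightarrow> bool" where
  "homogeneous \<rho> \<sigma> P \<longleftrightarrow> lead \<rho> \<sigma> P = P"

definition st :: "int \<Rightarrow> int \<Rightarrow> 'k::zero wel \<Rightarrow> rat \<times> nat" where
  "st \<rho> \<sigma> P = (let S = wsupp (lead \<rho> \<sigma> P);
      M = {x\<in>S. \<forall>y\<in>S. fst y - of_nat (snd y) \<le> fst x - of_nat (snd x)}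
    in THE x. x \<in> M \<and> (\<forall>y\<in>M. fst y \<le> fst x))"

definition en :: "int \<Rightarrow> int \<Rightarrow> 'k::zero wel \<Rightarrow> rat \<times> nat" where
  "en \<rho> \<sigma> P = (let S = wsupp (lead \<rho> \<sigma> P);
      M = {x\<in>S. \<forall>y\<in>S. of_nat (snd y) - fst y \<le> of_nat (snd x) - fst x}
    in THE x. x \<in> M \<and> (\<forall>y\<in>M. snd y \<le> snd x))"

definition Val :: "'k::zero wel \<Rightarrow> (int \<times> int) set" where
  "Val P = {(\<rho>, \<sigma>) \<in> Vset. card (wsupp (lead \<rho> \<sigma> P)) > 1}"

text \<open>Order on Vbar = Vset \<union> {(1,-1), (-1,1)}.\<close>

definition vle :: "int \<times> int \<Rightarrow> int \<times> int \<Rightarrow> bool" where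
  "vle a b \<longleftrightarrow> a = (1, -1) \<or> b = (-1, 1)
     \<or> (a \<in> Vset \<and> b \<in> Vset \<and> fst a * snd b - snd a * fst b \<ge> 0)"

definition vlt :: "int \<times> int \<Rightarrow> int \<times> int \<Rightarrow> bool" where
  "vlt a b \<longleftrightarrow> vle a b \<and> a \<noteq> b"

definition wcomm_rs :: "int \<Rightarrow> int \<Rightarrow> 'k::field_char_0 wel \<Rightarrow> 'k wel \<Rightarrow> 'k wel" where
  "wcomm_rs \<rho> \<sigma> P Q =
     (if wcomm P Q = wzero
         \<or> vdeg \<rho> \<sigma> (wcomm P Q) < vdeg \<rho> \<sigma> P + vdeg \<rho> \<sigma> Q - of_int (\<rho> + \<sigma>)
      then wzero else lead \<rho> \<sigma> (wcomm P Q))"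

definition irreducible_pair :: "'k::field_char_0 wel \<Rightarrow> 'k wel \<Rightarrow> bool" where
  "irreducible_pair P Q \<longleftrightarrow> (\<exists>\<psi>. alg_endo Weyl \<psi> \<and> P = \<psi> wX \<and> Q = \<psi> wY
     \<and> vdeg 1 1 P \<ge> 2 \<and> vdeg 1 1 Q \<ge> 2
     \<and> \<not> (\<exists>\<phi>1 \<phi>2. alg_auto Weyl \<phi>1 \<and> alg_auto Weyl \<phi>2
            \<and> vdeg 1 1 (\<phi>1 (\<psi> (\<phi>2 wX))) + vdeg 1 1 (\<phi>1 (\<psi> (\<phi>2 wY)))
              < vdeg 1 1 (\<psi> wX) + vdeg 1 1 (\<psi> wY)))"

end

theory Submission
  imports Defs
begin

text \<open>
  A direction \<open>(\<rho>, \<sigma>)\<close> with \<open>\<rho> > 0\<close> is recorded by its slope \<open>s = \<sigma> / \<rho>\<close> and the weight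
  \<open>a + s j\<close> of \<open>X^a Y^j\<close>.  A leading form of weight \<open>d\<close> is then \<open>x^d p(y x^(-s))\<close> for a univariate
  polynomial \<open>p\<close>; leading forms multiply like these polynomials, and the bracket of the forms
  given by \<open>p\<close> and \<open>q\<close> of weights \<open>d\<close> and \<open>e\<close> is given by \<open>e p' q - d p q'\<close>.

  If \<open>[Q, P] = 1\<close> and \<open>p\<close> is not constant, replacing \<open>G\<close> by \<open>G^n - c P^m\<close> as long as the leading
  forms of \<open>P\<close> and \<open>G\<close> commute, starting from \<open>G = Q\<close>, strictly reduces the gap between the
  expected and the actual weight of \<open>[P, G]\<close>, and ends with a solution \<open>f\<close> of
  \<open>(1 + s) p' f - d p f' = p\<close>.  This equation forces every root of \<open>p\<close> to be a simple root of \<open>f\<close>,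
  makes \<open>p\<close> a power of a linear polynomial if \<open>degree f = 1\<close>, and gives
  \<open>(1 + s) degree p = d degree f\<close> otherwise.  Hence \<open>p\<close> has a root \<open>\<alpha>\<close> of multiplicity \<open>\<mu>\<close> with
  \<open>(1 + s) \<mu> > d\<close>, and after \<open>Y \<mapsto> Y + \<alpha> X^s\<close> the lower end of the edge is a corner \<open>(a, \<mu>)\<close> with
  \<open>a < \<mu>\<close>.  Below it there is a further edge, because otherwise \<open>P\<close> and \<open>Q\<close> would both have weight
  \<open>0\<close> for the slope \<open>-a / \<mu>\<close>, which \<open>[Q, P] = 1\<close> forbids.  The process stops: \<open>\<mu>\<close> decreases unless
  \<open>p\<close> has a single root, and in that case the exponent lattice is unchanged while \<open>s\<close> runs
  downwards through that lattice and stays above \<open>-a / \<mu>\<close>.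

  Irreducibility is used only to find the first edge: it excludes that the leading form of \<open>P\<close>
  for \<open>(1, 1)\<close> is a pure power of \<open>X\<close>, since then a substitution \<open>Y \<mapsto> Y + \<alpha> X^k\<close> would lower both degrees.
\<close>

section \<open>The algebra of differential operators with rational exponents\<close>

text \<open>Only \<open>[Q, P] = 1\<close> is given, and it says little about the leading polynomial
  \<open>p\<close> of an edge, since the leading forms of \<open>P\<close> and \<open>Q\<close>
  usually commute. The descent gains information because \<open>[P, G^n - c P^m] = [P, G^n]\<close>:
  subtracting the power of \<open>P\<close> lowers the weight of \<open>G^n\<close> and leaves the
  bracket unchanged. Meanwhile the leading polynomial of \<open>[P, G]\<close> stays, up to powers
  and constants, a power of \<open>p\<close>; at the start it is a constant, the zeroth power. Once
  the leading forms no longer commute, let \<open>g\<close> be the leading polynomial of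
  \<open>G\<close> and \<open>b\<close> the bracket of \<open>p\<close> and \<open>g\<close>. The
  relation between \<open>b\<close> and \<open>p\<close> then gives both the divisibility of
  \<open>g p\<close> by \<open>b\<close> and the logarithmic derivative of \<open>b\<close>, and the
  quotient is \<open>f\<close>. The other constraint is arithmetic: \<open>F\<close> has to lie in
  \<open>W^(l)\<close> before the exponents are refined, so \<open>f\<close> is cut down to one
  residue class of exponents. Integrality also forces the slope of an edge whose polynomial has a
  single nonzero root into (1/l)Z.\<close>

text \<open>The union of all \<open>W^(l)\<close>, made a ring; \<open>cf\<close> is the coefficient function.\<close>

typedef (overloaded) 'k wa = "{P :: 'k::field_char_0 wel. finite (wsupp P)}"
  morphisms cf Wa
  by (rule exI[of _ "\<lambda>_. 0"]) (simp add: wsupp_def)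

setup_lifting type_definition_wa

abbreviation supp :: "'k::field_char_0 wa \<Rightarrow> (rat \<times> nat) set" where
  "supp P \<equiv> wsupp (cf P)"

lemma finite_supp [simp]: "finite (supp P)"
  using cf[of P] by simp

lemma in_supp: "x \<in> supp P \<longleftrightarrow> cf P x \<noteq> 0"
  by (simp add: wsupp_def)

lemma wa_eqI: "(\<And>x. cf P x = cf Q x) \<Longrightarrow> P = Q"
  by (simp add: cf_inject[symmetric] fun_eq_iff)

instantiation wa :: (field_char_0) ab_group_add
begin

lift_definition zero_wa :: "'a wa" is "\<lambda>_. 0"
  by (simp add: wsupp_def)

lift_definition plus_wa :: "'a wa \<Rightarrow> 'a wa \<Rightarrow> 'a wa" is "\<lambda>P Q x. P x + Q x"
  subgoal for P Q by (rule finite_subset[of _ "wsupp P \<union> wsupp Q"]) (auto simp: wsupp_def)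
  done

lift_definition minus_wa :: "'a wa \<Rightarrow> 'a wa \<Rightarrow> 'a wa" is "\<lambda>P Q x. P x - Q x"
  subgoal for P Q by (rule finite_subset[of _ "wsupp P \<union> wsupp Q"]) (auto simp: wsupp_def)
  done

lift_definition uminus_wa :: "'a wa \<Rightarrow> 'a wa" is "\<lambda>P x. - P x"
  by (simp add: wsupp_def)

instance
  by standard (transfer; simp add: fun_eq_iff algebra_simps)+

end

lemma cf_simps [simp]:
  "cf 0 x = 0" "cf (P + Q) x = cf P x + cf Q x" "cf (P - Q) x = cf P x - cf Q x"
  "cf (- P) x = - cf P x"
  by (transfer; simp)+

lemma cf_sum: "cf (sum f A) x = (\<Sum>i\<in>A. cf (f i) x)"
  by (induction A rule: infinite_finite_induct) simp_all

lift_definition smul :: "'k::field_char_0 \<Rightarrow> 'k wa \<Rightarrow> 'k wa" is "\<lambda>c P x. c * P x"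
  by (rule finite_subset) (auto simp: wsupp_def)

lift_definition mon :: "rat \<Rightarrow> nat \<Rightarrow> 'k::field_char_0 wa" is "\<lambda>a j x. if x = (a, j) then 1 else 0"
  by (simp add: wsupp_def)

text \<open>Left multiplication by \<open>X^a\<close> and by \<open>Y\<close>. They generate all left multiplications, so that associativity follows from \<open>ly (lx a P) = lx a (ly P) + a lx (a - 1) P\<close>.\<close>

lift_definition lx :: "rat \<Rightarrow> 'k::field_char_0 wa \<Rightarrow> 'k wa" is "\<lambda>a P x. P (fst x - a, snd x)"
proof -
  fix a and P :: "'k wel" assume f: "finite (wsupp P)"
  show "finite (wsupp (\<lambda>x. P (fst x - a, snd x)))"
    by (rule finite_subset[OF _ finite_imageI[OF f, of "\<lambda>x. (fst x + a, snd x)"]])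
       (force simp: wsupp_def image_iff)
qed

lift_definition ly :: "'k::field_char_0 wa \<Rightarrow> 'k wa" is
  "\<lambda>P x. (if snd x = 0 then 0 else P (fst x, snd x - 1)) + of_rat (fst x + 1) * P (fst x + 1, snd x)"
proof -
  fix P :: "'k wel" assume f: "finite (wsupp P)"
  show "finite (wsupp (\<lambda>x. (if snd x = 0 then 0 else P (fst x, snd x - 1)) + of_rat (fst x + 1) * P (fst x + 1, snd x)))"
  proof (rule finite_subset[OF _ finite_UnI[OF finite_imageI[OF f, of "\<lambda>x. (fst x, snd x + 1)"]
           finite_imageI[OF f, of "\<lambda>x. (fst x - 1, snd x)"]]], rule subsetI)
    fix x assume "x \<in> wsupp (\<lambda>x. (if snd x = 0 then 0 else P (fst x, snd x - 1)) + of_rat (fst x + 1) * P (fst x + 1, snd x))"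
    then have "snd x \<noteq> 0 \<and> (fst x, snd x - 1) \<in> wsupp P \<or> (fst x + 1, snd x) \<in> wsupp P"
      by (auto simp: wsupp_def split: if_splits)
    then show "x \<in> (\<lambda>x. (fst x, snd x + 1)) ` wsupp P \<union> (\<lambda>x. (fst x - 1, snd x)) ` wsupp P"
      by (cases x) (force simp: image_iff)
  qed
qed

lemma cf_smul [simp]: "cf (smul c P) x = c * cf P x"
  by transfer simp

lemma cf_mon: "cf (mon a j) x = (if x = (a, j) then 1 else 0)"
  by transfer simp

lemma smul_simps:
  "smul c (P + Q) = smul c P + smul c Q" "smul (c + d) P = smul c P + smul d P"
  "smul c (smul d P) = smul (c * d) P" "smul 1 P = P" "smul 0 P = 0" "smul c 0 = 0"
  "smul c (P - Q) = smul c P - smul c Q" "smul (c - d) P = smul c P - smul d P"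
  "smul c (- P) = - smul c P" "smul (- c) P = - smul c P"
  by (rule wa_eqI; simp add: algebra_simps)+

lemma smul_sum: "smul c (sum f A) = (\<Sum>i\<in>A. smul c (f i))"
  by (rule wa_eqI) (simp add: cf_sum sum_distrib_left)

lemma wa_expand_superset:
  assumes "finite A" "supp P \<subseteq> A"
  shows "P = (\<Sum>x\<in>A. smul (cf P x) (mon (fst x) (snd x)))"
proof (rule wa_eqI)
  fix y
  have "cf (\<Sum>x\<in>A. smul (cf P x) (mon (fst x) (snd x))) y = (\<Sum>x\<in>A. if y = x then cf P x else 0)"
    by (simp add: cf_sum cf_mon if_distrib cong: if_cong)
  also have "\<dots> = cf P y"
    using assms by (auto simp: sum.delta' in_supp)
  finally show "cf P y = cf (\<Sum>x\<in>A. smul (cf P x) (mon (fst x) (snd x))) y" by simp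
qed

lemma wa_expand: "P = (\<Sum>x\<in>supp P. smul (cf P x) (mon (fst x) (snd x)))"
  by (rule wa_expand_superset) auto

text \<open>Bilinear identities that hold only below a weight bound are reduced to monomials this
  way; the set \<open>S\<close> carries the bound into the monomial case.\<close>

lemma wa_induct_on [consumes 1, case_names zero mon add smul]:
  assumes "supp P \<subseteq> S" and "R 0" and "\<And>a j. (a, j) \<in> S \<Longrightarrow> R (mon a j)"
    and "\<And>P Q. R P \<Longrightarrow> R Q \<Longrightarrow> R (P + Q)" and "\<And>c P. R P \<Longrightarrow> R (smul c P)"
  shows "R P"
proof -
  have "R (\<Sum>x\<in>A. smul (c x) (mon (fst x) (snd x)))" if "A \<subseteq> S" for A and c :: "rat \<times> nat \<Rightarrow> 'a"
    using that
  proof (induction A rule: infinite_finite_induct)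
    case (insert x F)
    then have "R (mon (fst x) (snd x))" using assms(3)[of "fst x" "snd x"] by simp
    with insert show ?case by (simp add: assms(4,5))
  qed (simp_all add: assms(2))
  from this[OF assms(1)] show ?thesis using wa_expand[of P] by metis
qed

lemma wa_induct [case_names mon add smul]:
  assumes "\<And>a j. R (mon a j)" "\<And>P Q. R P \<Longrightarrow> R Q \<Longrightarrow> R (P + Q)" "\<And>c P. R P \<Longrightarrow> R (smul c P)"
  shows "R P"
  using wa_induct_on[of P UNIV R] assms assms(3)[OF assms(1), of 0 0 0] by (simp add: smul_simps)

lemma lx_lin: "lx a (P + Q) = lx a P + lx a Q" "lx a (smul c P) = smul c (lx a P)" "lx a 0 = 0"
  by (transfer; simp add: fun_eq_iff)+

lemma ly_lin: "ly (P + Q) = ly P + ly Q" "ly (smul c P) = smul c (ly P)" "ly 0 = 0"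
  by (transfer; simp add: fun_eq_iff algebra_simps)+

lemma ly_pow_lin: "(ly ^^ j) (P + Q) = (ly ^^ j) P + (ly ^^ j) Q"
    "(ly ^^ j) (smul c P) = smul c ((ly ^^ j) P)" "(ly ^^ j) 0 = 0"
  by (induction j) (simp_all add: ly_lin)

lemma lx_mon: "lx a (mon b k) = mon (a + b) k"
  by transfer (auto simp: fun_eq_iff)

lemma ly_mon: "ly (mon b k) = mon b (Suc k) + smul (of_rat b) (mon (b - 1) k)"
  by transfer (force simp: fun_eq_iff of_rat_add)

lemma lx_lx: "lx a (lx b P) = lx (a + b) P"
  by transfer (auto simp: fun_eq_iff algebra_simps)

lemma lx_0: "lx 0 P = P"
  by transfer auto

lemma ly_lx: "ly (lx a P) = lx a (ly P) + smul (of_rat a) (lx (a - 1) P)"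
proof (induction P rule: wa_induct)
  case (mon b k)
  show ?case
    by (simp add: lx_mon ly_mon lx_lin smul_simps of_rat_add algebra_simps)
next
  case (add P Q)
  then show ?case by (simp add: lx_lin ly_lin smul_simps algebra_simps)
next
  case (smul c P)
  then show ?case by (simp add: lx_lin ly_lin smul_simps algebra_simps)
qed

instantiation wa :: (field_char_0) ring_1
begin

text \<open>\<open>P\<close> acts on \<open>Q\<close> as an operator, so associativity becomes
  composition of operators; \<open>cf_mult\<close> identifies the result with
  \<open>wmul\<close>.\<close>

definition times_wa :: "'a wa \<Rightarrow> 'a wa \<Rightarrow> 'a wa" where
  "P * Q = (\<Sum>x\<in>supp P. smul (cf P x) (lx (fst x) ((ly ^^ snd x) Q)))"

definition one_wa :: "'a wa" where "1 = mon 0 0"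

lemma times_superset:
  assumes "finite A" "supp P \<subseteq> A"
  shows "P * Q = (\<Sum>x\<in>A. smul (cf P x) (lx (fst x) ((ly ^^ snd x) Q)))"
  unfolding times_wa_def by (rule sum.mono_neutral_left) (use assms in \<open>auto simp: in_supp smul_simps\<close>)

lemma wa_distrib_right: "(P + P') * Q = P * Q + P' * (Q :: 'a wa)"
proof -
  let ?A = "supp P \<union> supp P'"
  have "supp (P + P') \<subseteq> ?A" by (auto simp: in_supp)
  then show ?thesis
    using times_superset[of ?A P Q] times_superset[of ?A P' Q] times_superset[of ?A "P + P'" Q]
    by (simp add: smul_simps sum.distrib)
qed

lemma wa_distrib_left: "P * (Q + Q') = P * Q + P * (Q' :: 'a wa)"
  by (simp add: times_wa_def ly_pow_lin lx_lin smul_simps sum.distrib)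

lemma smul_mult_left: "smul c P * Q = smul c (P * (Q :: 'a wa))"
proof -
  have "supp (smul c P) \<subseteq> supp P" by (auto simp: in_supp)
  then show ?thesis
    using times_superset[of "supp P" "smul c P" Q] times_superset[of "supp P" P Q]
    by (simp add: smul_simps smul_sum)
qed

lemma smul_mult_right: "P * smul c Q = smul c (P * (Q :: 'a wa))"
  by (simp add: times_wa_def ly_pow_lin lx_lin smul_simps smul_sum mult.commute)

lemma mon_mult_eq: "mon a j * Q = lx a ((ly ^^ j) (Q :: 'a wa))"
proof -
  have "supp (mon a j) \<subseteq> {(a, j)}" by (auto simp: in_supp cf_mon split: if_splits)
  then show ?thesis using times_superset[of "{(a, j)}" "mon a j" Q] by (simp add: cf_mon smul_simps)
qed

lemma lx_mult: "lx a P * Q = lx a (P * (Q :: 'a wa))"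
  by (induction P rule: wa_induct)
     (simp_all add: mon_mult_eq lx_mon lx_lx wa_distrib_right lx_lin smul_mult_left)

lemma ly_mult: "ly P * Q = ly (P * (Q :: 'a wa))"
  by (induction P rule: wa_induct)
     (simp_all add: mon_mult_eq ly_mon ly_lin ly_lx wa_distrib_right lx_lin smul_mult_left smul_simps)

lemma ly_pow_mult: "(ly ^^ j) P * Q = (ly ^^ j) (P * (Q :: 'a wa))"
  by (induction j) (simp_all add: ly_mult)

lemma ly_pow_one: "(ly ^^ j) (mon 0 k) = (mon 0 (j + k) :: 'a wa)"
  by (induction j) (simp_all add: ly_mon smul_simps)

lemma wa_mult_assoc: "(P * Q) * R = P * (Q * (R :: 'a wa))"
  by (induction P rule: wa_induct)
     (simp_all add: mon_mult_eq lx_mult ly_pow_mult wa_distrib_right smul_mult_left)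

instance
proof
  fix P Q R :: "'a wa"
  show "P * Q * R = P * (Q * R)" by (rule wa_mult_assoc)
  show "(P + Q) * R = P * R + Q * R" by (rule wa_distrib_right)
  show "P * (Q + R) = P * Q + P * R" by (rule wa_distrib_left)
  show "1 * P = P" by (simp add: one_wa_def mon_mult_eq lx_0)
  show "P * 1 = P"
    by (induction P rule: wa_induct)
       (simp_all add: one_wa_def mon_mult_eq ly_pow_one lx_mon wa_distrib_right smul_mult_left)
  have "cf (0 :: 'a wa) (0, 0) \<noteq> cf 1 (0, 0)" by (simp add: one_wa_def cf_mon)
  then show "(0 :: 'a wa) \<noteq> 1" by metis
qed

end

lemmas smul_mult = smul_mult_left smul_mult_right

section \<open>Products of monomials and agreement with the given multiplication\<close>

abbreviation ffall :: "rat \<Rightarrow> nat \<Rightarrow> 'k::field_char_0" where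
  "ffall b t \<equiv> (\<Prod>i<t. of_rat b - of_nat i)"

lemma ly_sum: "ly (sum f A) = (\<Sum>i\<in>A. ly (f i))"
  by (induction A rule: infinite_finite_induct) (simp_all add: ly_lin)

lemma lx_sum: "lx a (sum f A) = (\<Sum>i\<in>A. lx a (f i))"
  by (induction A rule: infinite_finite_induct) (simp_all add: lx_lin)

text \<open>Leibniz rule for \<open>Y^j X^b\<close>. One more \<open>Y\<close> either passes or is
  contracted with \<open>X\<close>, and the two resulting sums merge by Pascal's rule after an index
  shift.\<close>

lemma ly_pow_mon:
  "(ly ^^ j) (mon b k :: 'k::field_char_0 wa) =
     (\<Sum>t\<le>j. smul (of_nat (j choose t) * ffall b t) (mon (b - of_nat t) (j - t + k)))"
proof (induction j)
  case 0
  show ?case by (simp add: smul_simps)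
next
  case (Suc j)
  define M where "M t = (mon (b - of_nat t) (Suc j - t + k) :: 'k wa)" for t
  have M1: "mon (b - of_nat t) (Suc (j - t + k)) = M t" if "t \<le> j" for t
    using that by (simp add: M_def Suc_diff_le)
  have M2: "mon (b - of_nat t - 1) (j - t + k) = M (Suc t)" for t
    by (simp add: M_def algebra_simps)
  have "(ly ^^ Suc j) (mon b k) = (\<Sum>t\<le>j. smul (of_nat (j choose t) * ffall b t) (M t)
          + smul (of_nat (j choose t) * ffall b (Suc t)) (M (Suc t)))"
    unfolding funpow.simps o_apply Suc.IH ly_sum
  proof (rule sum.cong[OF refl])
    fix t assume "t \<in> {..j}"
    then have "t \<le> j" by simp
    show "ly (smul (of_nat (j choose t) * ffall b t) (mon (b - of_nat t) (j - t + k))) =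
        smul (of_nat (j choose t) * ffall b t) (M t) + smul (of_nat (j choose t) * ffall b (Suc t)) (M (Suc t))"
      unfolding ly_lin ly_mon M1[OF \<open>t \<le> j\<close>] M2 by (simp add: smul_simps of_rat_diff algebra_simps)
  qed
  also have "\<dots> = (\<Sum>t\<le>Suc j. smul (of_nat (j choose t) * ffall b t) (M t))
      + (\<Sum>t\<le>j. smul (of_nat (j choose t) * ffall b (Suc t)) (M (Suc t)))"
    by (simp add: sum.distrib smul_simps binomial_eq_0)
  also have "\<dots> = smul (ffall b 0) (M 0) + (\<Sum>t\<le>j. smul (of_nat (j choose Suc t) * ffall b (Suc t)) (M (Suc t)))
      + (\<Sum>t\<le>j. smul (of_nat (j choose t) * ffall b (Suc t)) (M (Suc t)))"
    by (subst sum.atMost_Suc_shift) simp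
  also have "\<dots> = smul (ffall b 0) (M 0) + (\<Sum>t\<le>j. smul (of_nat (Suc j choose Suc t) * ffall b (Suc t)) (M (Suc t)))"
    by (simp add: smul_simps sum.distrib algebra_simps del: prod.lessThan_Suc)
  also have "\<dots> = (\<Sum>t\<le>Suc j. smul (of_nat (Suc j choose t) * ffall b t) (M t))"
    by (subst sum.atMost_Suc_shift) simp
  finally show ?case by (simp add: M_def)
qed

lemma mon_mult:
  "(mon a j * mon b k :: 'k::field_char_0 wa) =
     (\<Sum>t\<le>j. smul (of_nat (j choose t) * ffall b t) (mon (a + b - of_nat t) (j - t + k)))"
  by (simp add: mon_mult_eq ly_pow_mon lx_sum lx_lin lx_mon algebra_simps)

lemma mon_mult_X: "mon a 0 * mon b k = mon (a + b) k"
  by (simp add: mon_mult smul_simps)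

lemma mon_Y_power: "mon 0 1 ^ j = mon 0 j"
  by (induction j) (simp_all add: one_wa_def[symmetric], simp add: mon_mult_eq ly_mon lx_0 smul_simps)

lemma mon_eq: "mon a j = mon a 0 * mon 0 1 ^ j"
  by (metis mon_Y_power mon_mult_X add_0_right)

lemma wa_mult_expand:
  "P * Q = (\<Sum>x\<in>supp P. \<Sum>y\<in>supp Q. smul (cf P x * cf Q y) (mon (fst x) (snd x) * mon (fst y) (snd y)))"
proof -
  have "P * Q = (\<Sum>x\<in>supp P. smul (cf P x) (mon (fst x) (snd x))) * (\<Sum>y\<in>supp Q. smul (cf Q y) (mon (fst y) (snd y)))"
    using wa_expand[of P] wa_expand[of Q] by simp
  also have "\<dots> = (\<Sum>x\<in>supp P. \<Sum>y\<in>supp Q. smul (cf P x * cf Q y) (mon (fst x) (snd x) * mon (fst y) (snd y)))"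
    by (simp add: sum_product smul_mult smul_simps mult.commute)
  finally show ?thesis .
qed

text \<open>Links the ring to the given product, so that ring laws apply to the coefficient
  functions of the theorem.\<close>

lemma cf_mult: "cf (P * Q) = wmul (cf P) (cf Q)"
proof
  fix z :: "rat \<times> nat"
  let ?g = "\<lambda>x y t. cf P x * cf Q y * of_nat (snd x choose t) * ffall (fst y) t"
  let ?c = "\<lambda>x y t. fst x + fst y - of_nat t = fst z \<and> snd x - t + snd y = snd z"
  let ?A = "Sigma (supp P) (\<lambda>x. supp Q \<times> {..snd x})"
  have "cf (P * Q) z = (\<Sum>x\<in>supp P. \<Sum>y\<in>supp Q. \<Sum>t\<le>snd x. if ?c x y t then ?g x y t else 0)"
    unfolding wa_mult_expand[of P Q] cf_sum cf_smul mon_mult cf_mon sum_distrib_left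
    by (intro sum.cong refl) (auto simp: prod_eq_iff mult.assoc)
  also have "\<dots> = (\<Sum>(x, y, t)\<in>?A. if ?c x y t then ?g x y t else 0)"
    unfolding sum.cartesian_product by (subst sum.Sigma) auto
  also have "\<dots> = (\<Sum>u\<in>?A. if (case u of (x, y, t) \<Rightarrow> ?c x y t) then (case u of (x, y, t) \<Rightarrow> ?g x y t) else 0)"
    by (simp only: case_prod_unfold)
  also have "\<dots> = (\<Sum>u\<in>{u \<in> ?A. case u of (x, y, t) \<Rightarrow> ?c x y t}. case u of (x, y, t) \<Rightarrow> ?g x y t)"
    by (rule sum.inter_filter[symmetric]) auto
  also have "{u \<in> ?A. case u of (x, y, t) \<Rightarrow> ?c x y t} = {(x, y, t). x \<in> supp P \<and> y \<in> supp Q \<and> t \<le> snd x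
        \<and> fst x + fst y - of_nat t = fst z \<and> snd x - t + snd y = snd z}"
    by auto
  finally show "cf (P * Q) z = wmul (cf P) (cf Q) z" by (simp add: wmul_def case_prod_unfold)
qed

lemma supp_mult:
  assumes "z \<in> supp (P * Q :: 'k::field_char_0 wa)"
  obtains x y t where "x \<in> supp P" "y \<in> supp Q" "t \<le> snd x" "(ffall (fst y) t :: 'k) \<noteq> 0"
    "z = (fst x + fst y - of_nat t, snd x - t + snd y)"
proof -
  have "\<exists>x y t. x \<in> supp P \<and> y \<in> supp Q \<and> t \<le> snd x
        \<and> fst x + fst y - of_nat t = fst z \<and> snd x - t + snd y = snd z \<and> (ffall (fst y) t :: 'k) \<noteq> 0"
  proof (rule ccontr)
    assume "\<not> ?thesis"
    then have "cf (P * Q) z = 0"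
      unfolding cf_mult wmul_def case_prod_unfold by (intro sum.neutral) auto
    then show False using assms by (simp add: in_supp)
  qed
  then show ?thesis using that by (metis prod.collapse)
qed

section \<open>Weights and leading forms\<close>

abbreviation cm :: "'k::field_char_0 wa \<Rightarrow> 'k wa \<Rightarrow> 'k wa" where
  "cm P Q \<equiv> P * Q - Q * P"

definition fil :: "rat \<Rightarrow> rat \<Rightarrow> rat \<Rightarrow> 'k::field_char_0 wa \<Rightarrow> bool" where
  "fil u v d P \<longleftrightarrow> (\<forall>x\<in>supp P. u * fst x + v * of_nat (snd x) \<le> d)"

definition sfil :: "rat \<Rightarrow> rat \<Rightarrow> rat \<Rightarrow> 'k::field_char_0 wa \<Rightarrow> bool" where
  "sfil u v d P \<longleftrightarrow> (\<forall>x\<in>supp P. u * fst x + v * of_nat (snd x) < d)"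

lemma fil_0 [simp]: "fil u v d 0" "sfil u v d 0"
  by (auto simp: fil_def sfil_def in_supp)

lemma supp_add: "supp (P + Q) \<subseteq> supp P \<union> supp Q" and supp_diff: "supp (P - Q) \<subseteq> supp P \<union> supp Q"
  by (auto simp: in_supp)

lemma fil_add: "fil u v d P \<Longrightarrow> fil u v d Q \<Longrightarrow> fil u v d (P + Q)"
  using supp_add[of P Q] unfolding fil_def by blast

lemma sfil_add: "sfil u v d P \<Longrightarrow> sfil u v d Q \<Longrightarrow> sfil u v d (P + Q)"
  using supp_add[of P Q] unfolding sfil_def by blast

lemma fil_smul: "fil u v d P \<Longrightarrow> fil u v d (smul c P)" "sfil u v d P \<Longrightarrow> sfil u v d (smul c P)"
  by (auto simp: fil_def sfil_def in_supp)

lemma fil_minus: "fil u v d P \<Longrightarrow> fil u v d Q \<Longrightarrow> fil u v d (P - Q)"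
  using supp_diff[of P Q] unfolding fil_def by blast

lemma fil_mono: "fil u v d P \<Longrightarrow> d \<le> e \<Longrightarrow> fil u v e P"
  by (force simp: fil_def)

lemma supp_mon [simp]: "supp (mon a j) = {(a, j)}"
  by (auto simp: in_supp cf_mon split: if_splits)

lemma fil_mon: "fil u v d (mon a j) \<longleftrightarrow> u * a + v * of_nat j \<le> d"
  by (simp add: fil_def)

lemma sfil_mon: "sfil u v d (mon a j) \<longleftrightarrow> u * a + v * of_nat j < d"
  by (simp add: sfil_def)

text \<open>Each contraction of a \<open>Y\<close> with an \<open>X\<close> costs weight
  \<open>u + v\<close>. For \<open>u + v > 0\<close> the uncontracted term dominates, so leading
  forms multiply commutatively.\<close>

lemma weight_shift:
  assumes "t \<le> j"
  shows "u * (a + b - of_nat t) + v * of_nat (j - t + k)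
      = (u * a + v * of_nat j) + (u * b + v * of_nat k) - of_nat t * (u + v :: rat)"
  using assms by (simp add: of_nat_diff algebra_simps)

lemma fil_mult:
  assumes "fil u v d P" "fil u v e Q" "u + v \<ge> 0"
  shows "fil u v (d + e) (P * Q)"
  unfolding fil_def
proof
  fix z assume "z \<in> supp (P * Q)"
  then obtain x y t where h: "x \<in> supp P" "y \<in> supp Q" "t \<le> snd x"
      "z = (fst x + fst y - of_nat t, snd x - t + snd y)" by (rule supp_mult)
  have "of_nat t * (u + v) \<ge> 0" using assms(3) by simp
  moreover have "u * fst x + v * of_nat (snd x) \<le> d" "u * fst y + v * of_nat (snd y) \<le> e"
    using assms h by (auto simp: fil_def)
  ultimately show "u * fst z + v * of_nat (snd z) \<le> d + e"
    unfolding h(4) fst_conv snd_conv weight_shift[OF h(3)] by linarith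
qed

lemma sfil_mult:
  assumes "fil u v d P \<and> sfil u v e Q \<or> sfil u v d P \<and> fil u v e Q" "u + v \<ge> 0"
  shows "sfil u v (d + e) (P * Q)"
  unfolding sfil_def
proof
  fix z assume "z \<in> supp (P * Q)"
  then obtain x y t where h: "x \<in> supp P" "y \<in> supp Q" "t \<le> snd x"
      "z = (fst x + fst y - of_nat t, snd x - t + snd y)" by (rule supp_mult)
  have "of_nat t * (u + v) \<ge> 0" using assms(2) by simp
  moreover have "u * fst x + v * of_nat (snd x) + (u * fst y + v * of_nat (snd y)) < d + e"
    using assms(1) h(1,2) unfolding fil_def sfil_def by fastforce
  ultimately show "u * fst z + v * of_nat (snd z) < d + e"
    unfolding h(4) fst_conv snd_conv weight_shift[OF h(3)] by linarith
qed

text \<open>The component of weight \<open>d\<close> for the direction \<open>(1, s)\<close>: the form \<open>x^d p(y x^(-s))\<close> is recorded as \<open>p\<close>.\<close>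

definition cp :: "rat \<Rightarrow> rat \<Rightarrow> 'k::field_char_0 wa \<Rightarrow> 'k poly" where
  "cp s d P = (\<Sum>x\<in>supp P. if fst x + s * of_nat (snd x) = d then monom (cf P x) (snd x) else 0)"

lemma coeff_cp [simp]: "coeff (cp s d P) j = cf P (d - s * of_nat j, j)"
proof -
  have "coeff (cp s d P) j = (\<Sum>x\<in>supp P. if x = (d - s * of_nat j, j) then cf P x else 0)"
    unfolding cp_def coeff_sum by (rule sum.cong) (auto simp: prod_eq_iff)
  also have "\<dots> = cf P (d - s * of_nat j, j)"
    by (simp add: sum.delta in_supp)
  finally show ?thesis .
qed

lemma cp_simps [simp]: "cp s d 0 = 0" "cp s d (P + Q) = cp s d P + cp s d Q"
   "cp s d (P - Q) = cp s d P - cp s d Q" "cp s d (smul c P) = smult c (cp s d P)"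
  by (rule poly_eqI; simp)+

lemma cp_sum: "cp s d (sum f A) = (\<Sum>i\<in>A. cp s d (f i))"
  by (induction A rule: infinite_finite_induct) simp_all

lemma cp_mon: "cp s d (mon a j) = (if a + s * of_nat j = d then monom 1 j else 0)"
  by (rule poly_eqI) (auto simp: cf_mon)

lemma fil_iff_cp: "fil 1 s d P \<longleftrightarrow> (\<forall>D>d. cp s D P = 0)"
proof
  assume f: "fil 1 s d P"
  show "\<forall>D>d. cp s D P = 0"
  proof (intro allI impI poly_eqI)
    fix D j assume "D > d"
    then have "(D - s * of_nat j, j) \<notin> supp P"
      using f[unfolded fil_def] by force
    then show "coeff (cp s D P) j = coeff 0 j" by (simp add: in_supp)
  qed
next
  assume c: "\<forall>D>d. cp s D P = 0"
  show "fil 1 s d P" unfolding fil_def in_supp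
  proof (intro ballI, rule ccontr)
    fix x assume x: "x \<in> supp P" "\<not> 1 * fst x + s * of_nat (snd x) \<le> d"
    then have "coeff (cp s (fst x + s * of_nat (snd x)) P) (snd x) = 0"
      using c by simp
    then show False using x by (simp add: in_supp)
  qed
qed

lemma cp_mon_mult:
  "cp s D (mon a j * mon b k) = (\<Sum>t\<le>j. if t \<le> j \<and> (a + s * of_nat j) + (b + s * of_nat k) - of_nat t * (1 + s) = D
      then smult (of_nat (j choose t) * ffall b t) (monom 1 (j - t + k)) else 0)"
  unfolding mon_mult cp_sum
proof (rule sum.cong[OF refl])
  fix t assume "t \<in> {..j}"
  then have "t \<le> j" by simp
  have "(a + b - of_nat t + s * of_nat (j - t + k) = D) = ((a + s * of_nat j) + (b + s * of_nat k) - of_nat t * (1 + s) = D)"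
    using weight_shift[OF \<open>t \<le> j\<close>, of 1 a b s k] unfolding mult_1_left by (rule arg_cong)
  then show "cp s D (smul (of_nat (j choose t) * ffall b t) (mon (a + b - of_nat t) (j - t + k))) =
        (if t \<le> j \<and> (a + s * of_nat j) + (b + s * of_nat k) - of_nat t * (1 + s) = D
         then smult (of_nat (j choose t) * ffall b t) (monom 1 (j - t + k)) else 0)"
    unfolding cp_simps cp_mon using \<open>t \<le> j\<close> by auto
qed

lemma fil_supp: "fil u v d P \<longleftrightarrow> supp P \<subseteq> {x. u * fst x + v * of_nat (snd x) \<le> d}"
  by (auto simp: fil_def)

lemma cp_mult:
  assumes "fil 1 s d P" "fil 1 s e Q" "1 + s > 0"
  shows "cp s (d + e) (P * Q) = cp s d P * cp s e Q"
proof -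
  have mm: "cp s (d + e) (mon a j * mon b k :: 'a wa) = cp s d (mon a j) * cp s e (mon b k)"
    if "1 * a + s * of_nat j \<le> d" "1 * b + s * of_nat k \<le> e" for a b j k
  proof -
    let ?w = "(a + s * of_nat j) + (b + s * of_nat k)"
    have "?w - of_nat t * (1 + s) \<noteq> d + e" if "t > 0" for t
    proof -
      have "of_nat t * (1 + s) > 0" using that assms(3) by simp
      then show ?thesis using \<open>1 * a + s * of_nat j \<le> d\<close> \<open>1 * b + s * of_nat k \<le> e\<close> by linarith
    qed
    then have "cp s (d + e) (mon a j * mon b k :: 'a wa) = (\<Sum>t\<le>j. if t = 0 then
        (if ?w = d + e then monom 1 (j + k) else 0) else 0)"
      unfolding cp_mon_mult by (intro sum.cong refl) auto
    also have "\<dots> = (if ?w = d + e then monom 1 (j + k) else 0)" by simp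
    also have "\<dots> = cp s d (mon a j) * cp s e (mon b k)"
      using that by (auto simp: cp_mon mult_monom)
    finally show ?thesis .
  qed
  have mQ: "cp s (d + e) (mon a j * Q) = cp s d (mon a j) * cp s e Q" if "1 * a + s * of_nat j \<le> d" for a j
    using assms(2)[unfolded fil_supp]
  proof (induction Q rule: wa_induct_on)
    case (mon b k)
    then show ?case using mm[OF that, of b k] by simp
  next
    case (add P Q)
    then show ?case by (simp add: distrib_left)
  next
    case (smul c P)
    then show ?case by (simp add: smul_mult)
  qed simp
  show ?thesis
    using assms(1)[unfolded fil_supp]
  proof (induction P rule: wa_induct_on)
    case (mon b k)
    then show ?case using mQ[of b k] by simp
  next
    case (add P Q)
    then show ?case by (simp add: distrib_right)
  next
    case (smul c P)
    then show ?case by (simp add: smul_mult)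
  qed simp
qed

text \<open>In a commutator the uncontracted terms cancel, so the highest possible contribution
  comes from the single contractions \<open>t = 1\<close>, with coefficients \<open>j b\<close> and
  \<open>k a\<close>.\<close>

lemma cp_comm_mon:
  fixes a b :: rat and j k :: nat
  assumes "1 + s > 0"
  shows "(a + s * of_nat j) + (b + s * of_nat k) < D + (1 + s) \<Longrightarrow> cp s D (cm (mon a j) (mon b k :: 'k::field_char_0 wa)) = 0"
    and "(a + s * of_nat j) + (b + s * of_nat k) = D + (1 + s) \<Longrightarrow>
      cp s D (cm (mon a j) (mon b k :: 'k wa)) = smult (of_nat j * of_rat b - of_nat k * of_rat a) (monom 1 (j + k - 1))"
proof -
  let ?w = "\<lambda>a j b k. (a + s * of_nat j) + (b + s * of_nat k)"
  {
    assume l: "?w a j b k < D + (1 + s)"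
    have z: "cp s D (mon a j * mon b k :: 'k wa) = (if ?w a j b k = D then monom 1 (j + k) else 0)"
      if l: "?w a j b k < D + (1 + s)" for a b j k
    proof -
      have "?w a j b k - of_nat t * (1 + s) \<noteq> D" if "t > 0" for t
      proof -
        have "of_nat t * (1 + s) \<ge> 1 * (1 + s)" using that assms by (intro mult_right_mono) auto
        then have "?w a j b k - of_nat t * (1 + s) < D" using l unfolding mult_1_left by linarith
        then show ?thesis by simp
      qed
      then have "cp s D (mon a j * mon b k :: 'k wa) = (\<Sum>t\<le>j. if t = 0 then
        (if ?w a j b k = D then monom 1 (j + k) else 0) else 0)"
        unfolding cp_mon_mult by (intro sum.cong refl) auto
      then show ?thesis by simp
    qed
    have l': "?w b k a j < D + (1 + s)" using l by linarith
    show "cp s D (cm (mon a j) (mon b k :: 'k::field_char_0 wa)) = 0"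
      unfolding cp_simps z[OF l] z[OF l'] by (auto simp: add.commute)
  }
  {
    assume l: "?w a j b k = D + (1 + s)"
    have key: "w - T = D \<longleftrightarrow> T = u" if "w = D + u" for w T u :: rat
      using that by auto
    have z: "cp s D (mon a j * mon b k :: 'k wa) = smult (of_nat j * of_rat b) (monom 1 (j + k - 1))"
      if l: "?w a j b k = D + (1 + s)" for a b j k
    proof -
      have "?w a j b k - of_nat t * (1 + s) = D \<longleftrightarrow> t = 1" for t
      proof -
        have "?w a j b k - of_nat t * (1 + s) = D \<longleftrightarrow> of_nat t * (1 + s) = 1 * (1 + s)"
          by (rule key) (simp only: l mult_1_left)
        also have "\<dots> \<longleftrightarrow> t = 1" 
          by (metis assms less_irrefl mult_cancel_right of_nat_eq_1_iff)
        finally show ?thesis .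
      qed
      then have "cp s D (mon a j * mon b k :: 'k wa) = (\<Sum>t\<le>j. if t = 1 then
        smult (of_nat j * of_rat b) (monom 1 (j - 1 + k)) else 0)"
        unfolding cp_mon_mult by (intro sum.cong refl) auto
      then show ?thesis by (cases j) auto
    qed
    have l': "?w b k a j = D + (1 + s)" using l by linarith
    show "cp s D (cm (mon a j) (mon b k :: 'k wa)) = smult (of_nat j * of_rat b - of_nat k * of_rat a) (monom 1 (j + k - 1))"
      unfolding cp_simps z[OF l] z[OF l'] by (simp add: add.commute smult_diff_left)
  }
qed

text \<open>The bracket of two forms of weights \<open>d\<close> and \<open>e\<close> in terms of their polynomials.\<close>

definition br :: "rat \<Rightarrow> rat \<Rightarrow> 'k::field_char_0 poly \<Rightarrow> 'k poly \<Rightarrow> 'k poly" where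
  "br e d p q = smult (of_rat e) (pderiv p * q) - smult (of_rat d) (p * pderiv q)"

lemma br_lin:
  "br e d (p + p') q = br e d p q + br e d p' q" "br e d p (q + q') = br e d p q + br e d p q'"
  "br e d (smult c p) q = smult c (br e d p q)" "br e d p (smult c q) = smult c (br e d p q)"
  "br e d 0 q = 0" "br e d p 0 = 0"
  by (simp_all add: br_def pderiv_add pderiv_smult pderiv_0 algebra_simps smult_add_right smult_diff_right)

lemma cm_lin:
  "cm (P + P') Q = cm P Q + cm P' Q" "cm P (Q + Q') = cm P Q + cm P Q'"
  "cm (smul c P) Q = smul c (cm P Q)" "cm P (smul c Q) = smul c (cm P Q)"
  by (simp_all add: algebra_simps smul_mult smul_simps)

lemma cp_comm:
  assumes "fil 1 s d P" "fil 1 s e Q" "1 + s > 0"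
  shows "cp s (d + e - (1 + s)) (cm P Q) = br e d (cp s d P) (cp s e Q)"
proof -
  have mm: "cp s (d + e - (1 + s)) (cm (mon a j) (mon b k) :: 'a wa) = br e d (cp s d (mon a j)) (cp s e (mon b k))"
    if h: "1 * a + s * of_nat j \<le> d" "1 * b + s * of_nat k \<le> e" for a b j k
  proof (cases "a + s * of_nat j = d \<and> b + s * of_nat k = e")
    case False
    then have "(a + s * of_nat j) + (b + s * of_nat k) < d + e - (1 + s) + (1 + s)" using h by auto
    from cp_comm_mon(1)[OF assms(3) this] False show ?thesis
      by (auto simp: cp_mon br_lin simp del: cp_simps)
  next
    case True
    then have "(a + s * of_nat j) + (b + s * of_nat k) = d + e - (1 + s) + (1 + s)" by auto
    from cp_comm_mon(2)[OF assms(3) this]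
    have "cp s (d + e - (1 + s)) (cm (mon a j) (mon b k) :: 'a wa)
      = smult (of_nat j * of_rat b - of_nat k * of_rat a) (monom 1 (j + k - 1))" by simp
    \<comment> \<open>With \<open>d = a + s j\<close> and \<open>e = b + s k\<close> the mixed terms
      \<open>s j k\<close> cancel.\<close>
    also have "\<dots> = smult (of_rat e * of_nat j - of_rat d * of_nat k) (monom 1 (j + k - 1))"
    proof -
      have "of_nat j * b - of_nat k * a = e * of_nat j - d * of_nat k"
        using True by (auto simp: algebra_simps)
      then have "of_rat (of_nat j * b - of_nat k * a) = (of_rat (e * of_nat j - d * of_nat k) :: 'a)" by simp
      then show ?thesis by (simp add: of_rat_diff of_rat_mult)
    qed
    also have "\<dots> = br e d (monom 1 j) (monom 1 k)"
      by (cases j; cases k) (auto simp: br_def pderiv_monom mult_monom smult_monom diff_monom minus_monom algebra_simps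
            simp flip: smult_diff_left)
    finally show ?thesis using True by (simp add: cp_mon)
  qed
  have mQ: "cp s (d + e - (1 + s)) (cm (mon a j) Q) = br e d (cp s d (mon a j)) (cp s e Q)"
    if "1 * a + s * of_nat j \<le> d" for a j
    using assms(2)[unfolded fil_supp]
  proof (induction Q rule: wa_induct_on)
    case (add P Q)
    then show ?case unfolding cm_lin cp_simps(2) br_lin by simp
  next
    case (smul c P)
    then show ?case unfolding cm_lin cp_simps(4) br_lin by simp
  next
    case (mon b k)
    then have "1 * b + s * of_nat k \<le> e" by simp
    then show ?case by (rule mm[OF that])
  qed (simp add: br_lin)
  show ?thesis
    using assms(1)[unfolded fil_supp]
  proof (induction P rule: wa_induct_on)
    case (add P Q)
    then show ?case unfolding cm_lin cp_simps(2) br_lin by simp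
  next
    case (smul c P)
    then show ?case unfolding cm_lin cp_simps(4) br_lin by simp
  next
    case (mon b k)
    then have "1 * b + s * of_nat k \<le> d" by simp
    then show ?case by (rule mQ)
  qed (simp add: br_lin)
qed

text \<open>Sharper by \<open>1 + s\<close> than the bound coming from the two products. A component
  of excessive weight is computed by the bracket formula with the bound on \<open>P\<close> raised
  just enough, and at that weight the form of \<open>P\<close> is zero.\<close>

lemma fil_comm:
  assumes "fil 1 s d P" "fil 1 s e Q" "1 + s > 0"
  shows "fil 1 s (d + e - (1 + s)) (cm P Q)"
  unfolding fil_iff_cp
proof (intro allI impI)
  fix D assume "D > d + e - (1 + s)"
  define d' where "d' = d + (D - (d + e - (1 + s)))"
  have d': "d' > d" using \<open>D > _\<close> by (simp add: d'_def)
  then have "cp s d' P = 0" using assms(1) fil_iff_cp by blast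
  moreover have "fil 1 s d' P" using fil_mono[OF assms(1)] d' by simp
  moreover have "d' + e - (1 + s) = D" by (simp add: d'_def)
  ultimately show "cp s D (cm P Q) = 0" using cp_comm[of s d' P e Q] assms by (simp add: br_lin)
qed

definition top_at :: "rat \<Rightarrow> 'k::field_char_0 wa \<Rightarrow> rat \<Rightarrow> 'k poly \<Rightarrow> bool" where
  "top_at s P d p \<longleftrightarrow> fil 1 s d P \<and> cp s d P = p \<and> p \<noteq> 0"

lemma top_atD: "top_at s P d p \<Longrightarrow> fil 1 s d P" "top_at s P d p \<Longrightarrow> cp s d P = p" "top_at s P d p \<Longrightarrow> p \<noteq> 0"
  by (auto simp: top_at_def)

lemma cp_nonzero_point:
  assumes "coeff (cp s d P) j \<noteq> 0"
  shows "(d - s * of_nat j, j) \<in> supp P"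
  using assms by (simp add: in_supp)

lemma top_at_exists:
  assumes "P \<noteq> 0"
  obtains d p where "top_at s P d p"
proof -
  have "supp P \<noteq> {}"
  proof
    assume "supp P = {}"
    then have "P = 0" by (intro wa_eqI) (auto simp: wsupp_def)
    then show False using assms by simp
  qed
  let ?w = "\<lambda>x. fst x + s * of_nat (snd x)"
  let ?d = "Max (?w ` supp P)"
  have "?d \<in> ?w ` supp P" using \<open>supp P \<noteq> {}\<close> by (intro Max_in) auto
  then obtain x where x: "x \<in> supp P" "?w x = ?d" by auto
  have "fil 1 s ?d P" by (auto simp: fil_def)
  moreover have "coeff (cp s ?d P) (snd x) \<noteq> 0"
    using x by (simp add: in_supp flip: x(2))
  then have "cp s ?d P \<noteq> 0" by (metis coeff_0)
  ultimately show ?thesis using that by (auto simp: top_at_def)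
qed

lemma top_at_le_fil: "top_at s P d p \<Longrightarrow> fil 1 s e P \<Longrightarrow> d \<le> e"
  unfolding top_at_def fil_iff_cp by (meson not_le)

lemma cp_one [simp]: "cp s 0 1 = 1"
  by (simp add: one_wa_def cp_mon monom_eq_1)

lemma fil_one [simp]: "fil u v 0 1"
  by (simp add: one_wa_def fil_mon)

lemma top_at_one: "top_at s 1 0 1"
  by (simp add: top_at_def)

lemma fil_power: "fil u v d P \<Longrightarrow> u + v \<ge> 0 \<Longrightarrow> fil u v (of_nat n * d) (P ^ n)"
proof (induction n)
  case (Suc n)
  then show ?case using fil_mult[of u v d P "of_nat n * d" "P ^ n"] by (simp add: algebra_simps)
qed simp

lemma cp_power: "fil 1 s d P \<Longrightarrow> 1 + s > 0 \<Longrightarrow> cp s (of_nat n * d) (P ^ n) = cp s d P ^ n"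
proof (induction n)
  case (Suc n)
  then show ?case using cp_mult[OF Suc.prems(1) fil_power[OF Suc.prems(1), of n] Suc.prems(2)]
    by (simp add: algebra_simps)
qed simp

lemma top_at_power: "top_at s P d p \<Longrightarrow> 1 + s > 0 \<Longrightarrow> top_at s (P ^ n) (of_nat n * d) (p ^ n)"
  by (simp add: top_at_def fil_power cp_power)

lemma top_at_smul: "top_at s P d p \<Longrightarrow> c \<noteq> 0 \<Longrightarrow> top_at s (smul c P) d (smult c p)"
  by (auto simp: top_at_def fil_smul)

lemma top_at_lower:
  assumes "fil 1 s d P" "cp s d P = 0" "P \<noteq> 0"
  obtains e q where "e < d" "top_at s P e q"
proof -
  obtain e q where t: "top_at s P e q" using top_at_exists[OF assms(3)] by metis
  then have "e \<le> d" using top_at_le_fil assms(1) by metis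
  moreover have "e \<noteq> d" using t assms(2) by (auto simp: top_at_def)
  ultimately show ?thesis using that t by force
qed

section \<open>Homomorphisms, translations and the Fourier automorphism\<close>

definition xspan :: "rat set \<Rightarrow> 'k::field_char_0 wa set" where
  "xspan E = {P. \<forall>x\<in>supp P. fst x \<in> E}"

text \<open>These are exponent sets that span a subalgebra: \<open>[Y, X^a] = a X^(a - 1)\<close>
  vanishes for \<open>a = 0\<close>, so \<open>-1\<close> may be missing. \<open>\<nat>\<close>
  gives the Weyl algebra and \<open>El l\<close> gives \<open>W^(l)\<close>.\<close>

definition exps_ok :: "rat set \<Rightarrow> bool" where
  "exps_ok E \<longleftrightarrow> 0 \<in> E \<and> (\<forall>a\<in>E. \<forall>b\<in>E. a + b \<in> E) \<and> (\<forall>a\<in>E. a \<noteq> 0 \<longrightarrow> a - 1 \<in> E)"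

lemma xspan_supp: "P \<in> xspan E \<longleftrightarrow> supp P \<subseteq> {x. fst x \<in> E}"
  by (auto simp: xspan_def)

lemma supp_0 [simp]: "supp 0 = {}"
  by (auto simp: wsupp_def)

lemma xspan_0 [simp]: "0 \<in> xspan E"
  by (simp add: xspan_def)

lemma xspan_mon [simp]: "mon a j \<in> xspan E \<longleftrightarrow> a \<in> E"
  by (simp add: xspan_def)

lemma xspan_add: "P \<in> xspan E \<Longrightarrow> Q \<in> xspan E \<Longrightarrow> P + Q \<in> xspan E"
  using supp_add[of P Q] unfolding xspan_def by blast

lemma xspan_diff: "P \<in> xspan E \<Longrightarrow> Q \<in> xspan E \<Longrightarrow> P - Q \<in> xspan E"
  using supp_diff[of P Q] unfolding xspan_def by blast

lemma xspan_smul: "P \<in> xspan E \<Longrightarrow> smul c P \<in> xspan E"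
  by (auto simp: xspan_def in_supp)

lemma xspan_induct [consumes 1, case_names zero mon add smul]:
  assumes "P \<in> xspan E" "R 0" "\<And>a j. a \<in> E \<Longrightarrow> R (mon a j)"
    and "\<And>P Q. R P \<Longrightarrow> R Q \<Longrightarrow> R (P + Q)" "\<And>c P. R P \<Longrightarrow> R (smul c P)"
  shows "R P"
  using assms(1)[unfolded xspan_supp] by (induction P rule: wa_induct_on) (auto simp: assms)

lemma xspan_ly:
  assumes "P \<in> xspan E" "exps_ok E"
  shows "ly P \<in> xspan E"
  using assms(1)
proof (induction P rule: xspan_induct)
  case (mon a j)
  then show ?case
    using assms(2) by (cases "a = 0") (auto simp: ly_mon exps_ok_def smul_simps intro!: xspan_add xspan_smul)
qed (auto simp: ly_lin intro: xspan_add xspan_smul)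

lemma xspan_lx:
  assumes "P \<in> xspan E" "exps_ok E" "a \<in> E"
  shows "lx a P \<in> xspan E"
  using assms(1)
  by (induction P rule: xspan_induct) (use assms(2,3) in \<open>auto simp: lx_lin lx_mon exps_ok_def intro: xspan_add xspan_smul\<close>)

lemma xspan_ly_pow: "P \<in> xspan E \<Longrightarrow> exps_ok E \<Longrightarrow> (ly ^^ j) P \<in> xspan E"
  by (induction j) (auto intro: xspan_ly)

lemma xspan_mult:
  assumes "P \<in> xspan E" "Q \<in> xspan E" "exps_ok E"
  shows "P * Q \<in> xspan E"
  using assms(1)
proof (induction P rule: xspan_induct)
  case (mon a j)
  then show ?case unfolding mon_mult_eq by (intro xspan_lx xspan_ly_pow assms)
qed (auto simp: distrib_right smul_mult intro: xspan_add xspan_smul)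

lemma xspan_one: "exps_ok E \<Longrightarrow> 1 \<in> xspan E"
  by (simp add: one_wa_def exps_ok_def)

lemma xspan_power: "P \<in> xspan E \<Longrightarrow> exps_ok E \<Longrightarrow> P ^ n \<in> xspan E"
  by (induction n) (auto intro: xspan_mult xspan_one)

text \<open>\<open>U a\<close> is the image of \<open>X^a\<close> and \<open>B\<close> the image of \<open>Y\<close>.\<close>

definition hm :: "(rat \<Rightarrow> 'k::field_char_0 wa) \<Rightarrow> 'k wa \<Rightarrow> 'k wa \<Rightarrow> 'k wa" where
  "hm U B P = (\<Sum>x\<in>supp P. smul (cf P x) (U (fst x) * B ^ snd x))"

lemma hm_superset:
  assumes "finite A" "supp P \<subseteq> A"
  shows "hm U B P = (\<Sum>x\<in>A. smul (cf P x) (U (fst x) * B ^ snd x))"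
  unfolding hm_def by (rule sum.mono_neutral_left) (use assms in \<open>auto simp: in_supp smul_simps\<close>)

lemma hm_add: "hm U B (P + Q) = hm U B P + hm U B Q"
proof -
  let ?A = "supp P \<union> supp Q"
  show ?thesis
    using hm_superset[of ?A P] hm_superset[of ?A Q] hm_superset[of ?A "P + Q", OF _ supp_add]
    by (simp add: smul_simps sum.distrib)
qed

lemma hm_smul: "hm U B (smul c P) = smul c (hm U B P)"
proof -
  have "supp (smul c P) \<subseteq> supp P" by (auto simp: in_supp)
  then show ?thesis
    using hm_superset[of "supp P" "smul c P"] by (simp add: hm_def smul_simps smul_sum)
qed

lemma hm_0 [simp]: "hm U B 0 = 0"
  using hm_smul[of U B 0 0] by (simp add: smul_simps)

lemma hm_mon: "hm U B (mon a j) = U a * B ^ j"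
  by (simp add: hm_def cf_mon smul_simps)

lemma hm_diff: "hm U B (P - Q) = hm U B P - hm U B Q"
  using hm_add[of U B "P - Q" Q] by simp

text \<open>Universal property: images of \<open>X^a\<close> and \<open>Y\<close> that satisfy the
  defining relations extend to a homomorphism. As for associativity, it is enough to follow
  \<open>lx\<close> and \<open>ly\<close>.\<close>

lemma hm_mult:
  assumes E: "exps_ok E"
    and U: "\<And>a b. a \<in> E \<Longrightarrow> b \<in> E \<Longrightarrow> U (a + b) = U a * U b"
    and B: "\<And>a. a \<in> E \<Longrightarrow> B * U a = U a * B + smul (of_rat a) (U (a - 1))"
    and P: "P \<in> xspan E" and Q: "Q \<in> xspan E"
  shows "hm U B (P * Q) = hm U B P * hm U B Q"
proof -
  have y: "hm U B (ly R) = B * hm U B R" if "R \<in> xspan E" for R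
    using that
  proof (induction R rule: xspan_induct)
    case (mon a j)
    then show ?case
      by (simp add: ly_mon hm_add hm_mon hm_smul B power_commutes distrib_right smul_mult flip: mult.assoc)
  qed (auto simp: ly_lin hm_add hm_smul distrib_left smul_mult)
  have yj: "hm U B ((ly ^^ j) R) = B ^ j * hm U B R" if "R \<in> xspan E" for R j
    by (induction j) (simp_all add: y xspan_ly_pow that E mult.assoc)
  have x: "hm U B (lx a R) = U a * hm U B R" if "R \<in> xspan E" "a \<in> E" for R a
    using that(1)
    by (induction R rule: xspan_induct)
       (auto simp: lx_lin lx_mon hm_add hm_smul hm_mon distrib_left smul_mult U that mult.assoc)
  show ?thesis
    using P
  proof (induction P rule: xspan_induct)
    case (mon a j)
    then show ?case
      unfolding mon_mult_eq using x[OF xspan_ly_pow[OF Q E] mon] yj[OF Q] by (simp add: hm_mon mult.assoc)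
  qed (auto simp: distrib_right hm_add hm_smul smul_mult)
qed

lemma hm_xspan:
  assumes "exps_ok E" "\<And>a. a \<in> E \<Longrightarrow> U a \<in> xspan E" "B \<in> xspan E" "P \<in> xspan E"
  shows "hm U B P \<in> xspan E"
  using assms(4)
  by (induction P rule: xspan_induct)
     (use assms(1-3) in \<open>auto simp: hm_add hm_smul hm_mon intro!: xspan_add xspan_smul xspan_mult xspan_power\<close>)

text \<open>The substitution \<open>Y \<mapsto> Y + \<alpha> X^s\<close>.\<close>

definition Bt :: "rat \<Rightarrow> 'k \<Rightarrow> 'k::field_char_0 wa" where
  "Bt s \<alpha> = mon 0 1 + smul \<alpha> (mon s 0)"

definition tr :: "rat \<Rightarrow> 'k::field_char_0 \<Rightarrow> 'k wa \<Rightarrow> 'k wa" where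
  "tr s \<alpha> = hm (\<lambda>a. mon a 0) (Bt s \<alpha>)"

lemma Bt_comm: "Bt s \<alpha> * mon a 0 = mon a 0 * Bt s \<alpha> + smul (of_rat a) (mon (a - 1) 0)"
proof -
  have "mon 0 1 * mon a 0 = mon a 0 * mon 0 1 + smul (of_rat a) (mon (a - 1) 0 :: 'a wa)"
    by (simp add: mon_mult_eq lx_0 ly_mon lx_mon)
  then show ?thesis
    by (simp add: Bt_def distrib_left distrib_right smul_mult mon_mult_X add.commute add.left_commute)
qed

lemma exps_UNIV: "exps_ok UNIV" by (simp add: exps_ok_def)

lemma xspan_UNIV [simp]: "P \<in> xspan UNIV" by (simp add: xspan_def)

lemma tr_add: "tr s \<alpha> (P + Q) = tr s \<alpha> P + tr s \<alpha> Q"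
  and tr_diff: "tr s \<alpha> (P - Q) = tr s \<alpha> P - tr s \<alpha> Q"
  and tr_smul: "tr s \<alpha> (smul c P) = smul c (tr s \<alpha> P)"
  and tr_0 [simp]: "tr s \<alpha> 0 = 0"
  and tr_mon: "tr s \<alpha> (mon a j) = mon a 0 * Bt s \<alpha> ^ j"
  by (simp_all add: tr_def hm_add hm_diff hm_smul hm_mon)

lemma tr_mult: "tr s \<alpha> (P * Q) = tr s \<alpha> P * tr s \<alpha> Q"
  unfolding tr_def
  by (rule hm_mult[OF exps_UNIV]) (simp_all add: mon_mult_X Bt_comm)

lemma tr_1 [simp]: "tr s \<alpha> 1 = 1"
  by (simp add: one_wa_def tr_mon) (simp flip: one_wa_def)

lemma tr_power: "tr s \<alpha> (P ^ n) = tr s \<alpha> P ^ n"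
  by (induction n) (simp_all add: tr_mult)

lemma tr_inverse: "tr s \<alpha> (tr s (- \<alpha>) P) = P"
proof (induction P rule: wa_induct)
  case (mon a j)
  have "tr s \<alpha> (Bt s (- \<alpha>)) = mon 0 1"
    unfolding Bt_def[of s "- \<alpha>"] tr_add tr_smul tr_mon by (simp add: Bt_def smul_simps flip: one_wa_def)
  then have "tr s \<alpha> (tr s (- \<alpha>) (mon a j)) = mon a 0 * mon 0 1 ^ j"
    by (simp add: tr_mon tr_mult tr_power)
  then show ?case by (simp only: mon_eq[symmetric])
qed (simp_all add: tr_add tr_smul)

lemma tr_xspan:
  assumes "exps_ok E" "s \<in> E" "P \<in> xspan E"
  shows "tr s \<alpha> P \<in> xspan E"
  unfolding tr_def
  by (rule hm_xspan) (use assms in \<open>auto simp: Bt_def exps_ok_def intro!: xspan_add xspan_smul\<close>)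

lemma tr_comm: "cm (tr s \<alpha> P) (tr s \<alpha> Q) = tr s \<alpha> (cm P Q)"
  by (simp add: tr_diff tr_mult)

text \<open>\<open>Bt s \<alpha>\<close> is homogeneous of weight \<open>s\<close> with polynomial
  \<open>y + \<alpha>\<close>; hence for this one slope the substitution shifts the variable of
  leading polynomials.\<close>

lemma tr_top_mon:
  assumes "1 + s > 0"
  shows "fil 1 s (a + s * of_nat j) (tr s \<alpha> (mon a j))"
    and "cp s (a + s * of_nat j) (tr s \<alpha> (mon a j)) = [:\<alpha>, 1:] ^ j"
proof -
  have f: "fil 1 s s (Bt s \<alpha>)" "fil 1 s a (mon a 0 :: 'a wa)"
    unfolding Bt_def by (auto intro!: fil_add fil_smul simp: fil_mon)
  have c: "cp s s (Bt s \<alpha>) = [:\<alpha>, 1:]"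
    by (simp add: Bt_def cp_mon monom_altdef)
  have "cp s a (mon a 0 :: 'a wa) = 1" by (simp add: cp_mon)
  then show "cp s (a + s * of_nat j) (tr s \<alpha> (mon a j)) = [:\<alpha>, 1:] ^ j"
    using cp_mult[OF f(2) fil_power[OF f(1), of j] assms] cp_power[OF f(1) assms, of j] assms
    by (simp add: tr_mon c mult.commute)
  show "fil 1 s (a + s * of_nat j) (tr s \<alpha> (mon a j))"
    using fil_mult[OF f(2) fil_power[OF f(1), of j]] assms by (simp add: tr_mon mult.commute)
qed

lemma pcompose_power_left: "pcompose (p ^ n) q = pcompose p q ^ n"
  by (induction n) (simp_all add: pcompose_mult pcompose_1)

lemma tr_top:
  assumes "1 + s > 0" "fil 1 s d P"
  shows "fil 1 s d (tr s \<alpha> P) \<and> cp s d (tr s \<alpha> P) = pcompose (cp s d P) [:\<alpha>, 1:]"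
  using assms(2)[unfolded fil_supp]
proof (induction P rule: wa_induct_on)
  case (mon a j)
  then have le: "a + s * of_nat j \<le> d" by simp
  show ?case
  proof (cases "a + s * of_nat j = d")
    case True
    then show ?thesis using tr_top_mon[OF assms(1), of a j \<alpha>]
      by (simp add: cp_mon monom_altdef pcompose_smult pcompose_power_left pcompose_pCons)
  next
    case False
    then show ?thesis using tr_top_mon(1)[OF assms(1), of a j \<alpha>] le fil_mono[of 1 s "a + s * of_nat j"]
      by (auto simp: cp_mon fil_iff_cp)
  qed
qed (auto simp: tr_add tr_smul fil_add fil_smul pcompose_add pcompose_smult)

lemma top_at_tr:
  assumes "1 + s > 0" "top_at s P d p"
  shows "top_at s (tr s \<alpha> P) d (pcompose p [:\<alpha>, 1:])"
proof -
  have "p \<noteq> 0" using assms(2) by (auto simp: top_at_def)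
  then have "pcompose p [:\<alpha>, 1:] \<noteq> 0" by (simp add: pcompose_eq_0_iff)
  then show ?thesis using assms tr_top[of s d P \<alpha>] by (auto simp: top_at_def)
qed

lemma tr_lower_mon:
  assumes "u + v \<ge> 0" "u * s < v"
  shows "sfil u v (v * of_nat j) (Bt s \<alpha> ^ j - mon 0 1 ^ j) \<and> fil u v (v * of_nat j) (Bt s \<alpha> ^ j)"
proof (induction j)
  case (Suc j)
  have B: "fil u v v (Bt s \<alpha>)"
    unfolding Bt_def using assms(2) by (auto intro!: fil_add fil_smul simp: fil_mon)
  have A: "sfil u v v (smul \<alpha> (mon s 0))" using assms(2) by (intro fil_smul) (simp add: sfil_mon)
  have Y: "fil u v (v * of_nat j) (mon 0 1 ^ j :: 'a wa)" by (simp only: mon_Y_power fil_mon)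
  have "Bt s \<alpha> ^ Suc j - mon 0 1 ^ Suc j = Bt s \<alpha> * (Bt s \<alpha> ^ j - mon 0 1 ^ j) + smul \<alpha> (mon s 0) * mon 0 1 ^ j"
    by (simp add: right_diff_distrib) (simp add: Bt_def distrib_right)
  moreover have "sfil u v (v + v * of_nat j) (Bt s \<alpha> * (Bt s \<alpha> ^ j - mon 0 1 ^ j) + smul \<alpha> (mon s 0) * mon 0 1 ^ j)"
    by (intro sfil_add sfil_mult) (use Suc B A Y assms in auto)
  moreover have "fil u v (v + v * of_nat j) (Bt s \<alpha> * Bt s \<alpha> ^ j)"
    by (intro fil_mult) (use Suc B assms in auto)
  ultimately show ?case by (simp add: algebra_simps)
qed auto

text \<open>In every direction that weighs \<open>X^s\<close> below \<open>Y\<close> the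
  substitution only adds terms of smaller weight. Directions are general pairs \<open>(u, v)\<close>
  because those beyond the edge may have \<open>u \<le> 0\<close>.\<close>

lemma tr_lower:
  assumes "u + v \<ge> 0" "u * s < v" "fil u v d P"
  shows "sfil u v d (tr s \<alpha> P - P)"
  using assms(3)[unfolded fil_supp]
proof (induction P rule: wa_induct_on)
  case (mon a j)
  then have le: "u * a + v * of_nat j \<le> d" by simp
  have "fil u v (d - v * of_nat j) (mon a 0 :: 'a wa)" using le by (simp add: fil_mon)
  then have "sfil u v (d - v * of_nat j + v * of_nat j) (mon a 0 * (Bt s \<alpha> ^ j - mon 0 1 ^ j))"
    using tr_lower_mon[OF assms(1,2), of j \<alpha>] assms(1) by (intro sfil_mult) auto
  moreover have "tr s \<alpha> (mon a j) - mon a j = mon a 0 * (Bt s \<alpha> ^ j - mon 0 1 ^ j)"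
    using mon_eq[of a j] by (simp add: tr_mon right_diff_distrib)
  ultimately show ?case by simp
next
  case (add P Q)
  have "tr s \<alpha> (P + Q) - (P + Q) = (tr s \<alpha> P - P) + (tr s \<alpha> Q - Q)" by (simp add: tr_add)
  then show ?case using add by (simp only: sfil_add)
next
  case (smul c P)
  have "tr s \<alpha> (smul c P) - smul c P = smul c (tr s \<alpha> P - P)" by (simp add: tr_smul smul_simps)
  then show ?case using smul by (simp only: fil_smul)
qed simp

section \<open>The Fourier automorphism of the Weyl algebra\<close>

lemma ring_comm_power:
  fixes b y :: "'a::ring_1"
  assumes "b * y = y * b + 1"
  shows "b * y ^ n = y ^ n * b + of_nat n * y ^ (n - 1)"
proof (induction n)
  case (Suc n)
  have "b * y ^ Suc n = (b * y ^ n) * y" by (simp add: power_commutes mult.assoc)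
  also have "\<dots> = y ^ n * (b * y) + of_nat n * (y ^ (n - 1) * y)"
    unfolding Suc by (simp add: distrib_right mult.assoc)
  also have "of_nat n * (y ^ (n - 1) * y) = of_nat n * y ^ n"
    by (cases n) (simp_all add: power_commutes)
  finally show ?case by (simp add: assms distrib_left distrib_right mult.assoc power_commutes)
       (simp add: power_commutes flip: mult.assoc)
qed simp

lemma of_nat_mult_wa: "of_nat n * P = smul (of_nat n) (P :: 'k::field_char_0 wa)"
  by (induction n) (simp_all add: smul_simps distrib_right)

text \<open>The substitution \<open>X \<mapsto> \<epsilon> Y\<close>, \<open>Y \<mapsto> - \<epsilon> X\<close> with \<open>\<epsilon>\<^sup>2 = 1\<close>; only meaningful on exponents \<open>a \<in> \<nat>\<close>.\<close>

definition Us :: "'k \<Rightarrow> rat \<Rightarrow> 'k::field_char_0 wa" where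
  "Us \<epsilon> a = smul \<epsilon> (mon 0 1) ^ nat \<lfloor>a\<rfloor>"

definition sw :: "'k::field_char_0 \<Rightarrow> 'k wa \<Rightarrow> 'k wa" where
  "sw \<epsilon> = hm (Us \<epsilon>) (smul (- \<epsilon>) (mon 1 0))"

lemma exps_Nats: "exps_ok \<nat>"
proof -
  have "a - 1 \<in> \<nat>" if "a \<in> \<nat>" "a \<noteq> 0" for a :: rat
  proof -
    obtain n where "a = of_nat n" using \<open>a \<in> \<nat>\<close> by (elim Nats_cases)
    with \<open>a \<noteq> 0\<close> have "a - 1 = of_nat (n - 1)" by (simp add: of_nat_diff)
    then show ?thesis by simp
  qed
  then show ?thesis by (simp add: exps_ok_def)
qed

lemma Us_nat: "Us \<epsilon> (of_nat n) = smul \<epsilon> (mon 0 1) ^ n"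
  by (simp add: Us_def)

lemma Us_mult: "a \<in> \<nat> \<Longrightarrow> b \<in> \<nat> \<Longrightarrow> Us \<epsilon> (a + b) = Us \<epsilon> a * Us \<epsilon> b"
  by (elim Nats_cases) (simp add: Us_nat power_add flip: of_nat_add)

lemma Us_comm:
  assumes "\<epsilon> * \<epsilon> = 1" "a \<in> \<nat>"
  shows "smul (- \<epsilon>) (mon 1 0) * Us \<epsilon> a = Us \<epsilon> a * smul (- \<epsilon>) (mon 1 0) + smul (of_rat a) (Us \<epsilon> (a - 1))"
proof -
  obtain n where n: "a = of_nat n" using assms(2) by (elim Nats_cases)
  have "mon 0 1 * mon 1 0 = mon 1 0 * mon 0 1 + (1 :: 'a wa)"
    by (simp add: mon_mult_eq lx_0 ly_mon lx_mon smul_simps one_wa_def)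
  then have "smul (- \<epsilon>) (mon 1 0) * smul \<epsilon> (mon 0 1) = smul \<epsilon> (mon 0 1) * smul (- \<epsilon>) (mon 1 0) + (1 :: 'a wa)"
    using assms(1) by (simp add: smul_mult smul_simps)
  from ring_comm_power[OF this, of n]
  have c: "smul (- \<epsilon>) (mon 1 0) * Us \<epsilon> a = Us \<epsilon> a * smul (- \<epsilon>) (mon 1 0) + of_nat n * smul \<epsilon> (mon 0 1) ^ (n - 1)"
    unfolding n Us_nat .
  have "of_nat n * smul \<epsilon> (mon 0 1) ^ (n - 1) = smul (of_rat a) (Us \<epsilon> (a - 1))"
  proof (cases n)
    case 0
    then show ?thesis using n by (simp add: smul_simps)
  next
    case (Suc k)
    then have "a - 1 = of_nat k" using n by simp
    then have "Us \<epsilon> (a - 1) = smul \<epsilon> (mon 0 1) ^ (n - 1)" using Us_nat[of \<epsilon> k] Suc by simp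
    then show ?thesis unfolding of_nat_mult_wa by (simp only: n of_rat_of_nat_eq)
  qed
  with c show ?thesis by simp
qed

lemma sw_add: "sw \<epsilon> (P + Q) = sw \<epsilon> P + sw \<epsilon> Q"
  and sw_smul: "sw \<epsilon> (smul c P) = smul c (sw \<epsilon> P)"
  and sw_0 [simp]: "sw \<epsilon> 0 = 0"
  and sw_mon: "sw \<epsilon> (mon a j) = Us \<epsilon> a * smul (- \<epsilon>) (mon 1 0) ^ j"
  by (simp_all add: sw_def hm_add hm_diff hm_smul hm_mon)

lemma sw_mult: "\<epsilon> * \<epsilon> = 1 \<Longrightarrow> P \<in> xspan \<nat> \<Longrightarrow> Q \<in> xspan \<nat> \<Longrightarrow> sw \<epsilon> (P * Q) = sw \<epsilon> P * sw \<epsilon> Q"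
  unfolding sw_def
  by (rule hm_mult[OF exps_Nats]) (simp_all add: Us_mult Us_comm)

lemma sw_1 [simp]: "sw \<epsilon> 1 = 1"
  by (simp add: one_wa_def sw_mon Us_def) (simp flip: one_wa_def)

lemma sw_power: "\<epsilon> * \<epsilon> = 1 \<Longrightarrow> P \<in> xspan \<nat> \<Longrightarrow> sw \<epsilon> (P ^ n) = sw \<epsilon> P ^ n"
  by (induction n) (simp_all add: sw_mult xspan_power exps_Nats)

lemma sw_xspan: "P \<in> xspan \<nat> \<Longrightarrow> sw \<epsilon> P \<in> xspan \<nat>"
  unfolding sw_def
  by (rule hm_xspan[OF exps_Nats]) (auto simp: Us_def intro!: xspan_power xspan_smul exps_Nats)

lemma mon_X_power: "mon 1 0 ^ n = mon (of_nat n) 0"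
  by (induction n) (simp_all add: mon_mult_X flip: one_wa_def)

text \<open>Changing the sign gives the inverse; the parameter \<open>\<epsilon>\<close> yields both
  maps from one construction.\<close>

lemma sw_inverse:
  assumes "\<epsilon> * \<epsilon> = 1" "P \<in> xspan \<nat>"
  shows "sw \<epsilon> (sw (- \<epsilon>) P) = P"
  using assms(2)
proof (induction P rule: xspan_induct)
  case (mon a j)
  then obtain n where n: "a = of_nat n" by (elim Nats_cases)
  have X: "sw \<epsilon> (smul (- \<epsilon>) (mon 0 1)) = mon 1 0" and Y: "sw \<epsilon> (smul \<epsilon> (mon 1 0)) = mon 0 1"
    using assms(1) Us_nat[of \<epsilon> 0] Us_nat[of \<epsilon> 1] unfolding sw_smul sw_mon by (simp_all add: smul_simps)
  have "sw \<epsilon> (sw (- \<epsilon>) (mon a j)) = mon 1 0 ^ n * mon 0 1 ^ j"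
    by (simp add: n sw_mon Us_nat sw_mult sw_power X[unfolded One_nat_def] Y[unfolded One_nat_def] assms xspan_power xspan_smul exps_Nats)
  then show ?case by (simp only: mon_X_power n mon_eq[symmetric])
qed (simp_all add: sw_add sw_smul)

lemma power_smul: "smul c P ^ n = smul (c ^ n) (P ^ n)"
  by (induction n) (simp_all add: smul_simps smul_mult mult.commute)

text \<open>For slope 1 both variables weigh the same, so leading forms have \<open>x\<close> and
  \<open>y\<close> exchanged up to sign. The coefficient list is reversed within length
  \<open>M + 1\<close>, not within the degree of the polynomial.\<close>

lemma sw_top:
  assumes "P \<in> xspan \<nat>" "fil 1 1 (of_nat M) P"
  shows "fil 1 1 (of_nat M) (sw \<epsilon> P) \<and> (\<forall>k\<le>M. coeff (cp 1 (of_nat M) (sw \<epsilon> P)) k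
            = \<epsilon> ^ k * (- \<epsilon>) ^ (M - k) * coeff (cp 1 (of_nat M) P) (M - k))"
proof -
  have "supp P \<subseteq> {x. fst x \<in> \<nat> \<and> fst x + of_nat (snd x) \<le> of_nat M}"
    using assms by (auto simp: xspan_def fil_def)
  then show ?thesis
  proof (induction P rule: wa_induct_on)
    case (mon a j)
    then obtain n where n: "a = of_nat n" and le: "n + j \<le> M"
      by (auto elim!: Nats_cases simp flip: of_nat_add)
    have e: "sw \<epsilon> (mon a j) = smul (\<epsilon> ^ n * (- \<epsilon>) ^ j) (mon 0 n * mon (of_nat j) 0)"
      by (simp only: sw_mon n Us_nat power_smul smul_mult smul_simps(3) mon_Y_power mon_X_power) (simp add: mult.commute)
    have f: "fil 1 1 (of_nat n) (mon 0 n :: 'a wa)" "fil 1 1 (of_nat j) (mon (of_nat j) 0 :: 'a wa)"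
      by (simp_all add: fil_mon)
    have f2: "fil 1 1 (of_nat (n + j)) (mon 0 n * mon (of_nat j) 0 :: 'a wa)"
      using fil_mult[OF f] by simp
    have f3: "fil 1 1 (of_nat M) (sw \<epsilon> (mon a j))"
      unfolding e by (intro fil_smul fil_mono[OF f2]) (use le in simp)
    show ?case
    proof (cases "n + j = M")
      case True
      have "cp 1 (of_nat M) (mon 0 n * mon (of_nat j) 0 :: 'a wa) = monom 1 n"
        using cp_mult[OF f] by (simp add: cp_mon flip: True)
      then have "coeff (cp 1 (of_nat M) (sw \<epsilon> (mon a j))) k = (if k = n then \<epsilon> ^ n * (- \<epsilon>) ^ j else 0)" for k
        unfolding e cp_simps by simp
      moreover have "coeff (cp 1 (of_nat M) (mon a j :: 'a wa)) (M - k) = (if k = n then 1 else 0)" if "k \<le> M" for k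
        unfolding cp_mon using True that by (auto simp: n simp flip: of_nat_add)
      ultimately show ?thesis using f3 True by auto
    next
      case False
      then have "n + j < M" using le by simp
      then have "(of_nat (n + j) :: rat) < of_nat M" by (simp only: of_nat_less_iff)
      then have "cp 1 (of_nat M) (mon 0 n * mon (of_nat j) 0 :: 'a wa) = 0"
        using f2 unfolding fil_iff_cp by blast
      moreover have "cp 1 (of_nat M) (mon a j :: 'a wa) = 0"
        unfolding cp_mon using False by (simp add: n flip: of_nat_add)
      ultimately show ?thesis using f3 unfolding e cp_simps by simp
    qed
  qed (auto simp: sw_add sw_smul fil_add fil_smul algebra_simps simp del: coeff_cp)
qed

section \<open>The bracket of leading polynomials\<close>

text \<open>Multiplying by \<open>[:-\<alpha>, 1:]\<close> avoids the exponent \<open>k - 1\<close>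
  in derivatives. With multiplicities \<open>\<mu>\<close> and \<open>\<nu>\<close> the cofactor
  takes at \<open>\<alpha>\<close> the value \<open>e \<mu> - d \<nu>\<close> times a nonzero
  factor.\<close>

lemma br_root_factor:
  fixes p q :: "'k::field_char_0 poly"
  assumes "p \<noteq> 0" "q \<noteq> 0"
  obtains h where "[:-\<alpha>, 1:] * br e d p q = [:-\<alpha>, 1:] ^ (order \<alpha> p + order \<alpha> q) * h"
    and "poly h \<alpha> = 0 \<longleftrightarrow> e * of_nat (order \<alpha> p) = d * of_nat (order \<alpha> q)"
proof -
  define L where "L = [:-\<alpha>, 1:]"
  define \<mu> \<nu> where "\<mu> = order \<alpha> p" and "\<nu> = order \<alpha> q"
  obtain p1 where p1: "p = L ^ \<mu> * p1" "\<not> L dvd p1"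
    using order_decomp[OF assms(1), of \<alpha>] by (auto simp: L_def \<mu>_def)
  obtain q1 where q1: "q = L ^ \<nu> * q1" "\<not> L dvd q1"
    using order_decomp[OF assms(2), of \<alpha>] by (auto simp: L_def \<nu>_def)
  have ne: "poly p1 \<alpha> \<noteq> 0" "poly q1 \<alpha> \<noteq> 0"
    using p1(2) q1(2) by (auto simp: poly_eq_0_iff_dvd L_def)
  have dL: "pderiv L = 1" by (simp add: L_def pderiv_pCons)
  have d: "L * pderiv (L ^ k * r) = L ^ k * (smult (of_nat k) r + L * pderiv r)" for k r
  proof (cases k)
    case (Suc n)
    have "pderiv (L ^ Suc n) = smult (of_nat (Suc n)) (L ^ n)" by (simp only: pderiv_power_Suc dL mult_1_right)
    then show ?thesis unfolding Suc pderiv_mult by (simp add: algebra_simps del: of_nat_Suc)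
  qed simp
  define h where "h = smult (of_rat e * of_nat \<mu> - of_rat d * of_nat \<nu>) (p1 * q1) + L * br e d p1 q1"
  have "L * br e d p q = smult (of_rat e) (L * pderiv p * q) - smult (of_rat d) (p * (L * pderiv q))"
    by (simp add: br_def algebra_simps smult_diff_right)
  also have "\<dots> = L ^ (\<mu> + \<nu>) * h"
    unfolding p1(1) q1(1) d h_def br_def
    by (simp add: algebra_simps power_add smult_add_right smult_diff_right smult_add_left smult_diff_left)
  finally have eq: "L * br e d p q = L ^ (\<mu> + \<nu>) * h" .
  have "poly h \<alpha> = (of_rat e * of_nat \<mu> - of_rat d * of_nat \<nu>) * (poly p1 \<alpha> * poly q1 \<alpha>)"
    by (simp add: h_def L_def)
  then have "poly h \<alpha> = 0 \<longleftrightarrow> of_rat (e * of_nat \<mu>) = (of_rat (d * of_nat \<nu>) :: 'k)"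
    using ne by (simp add: of_rat_mult)
  then have "poly h \<alpha> = 0 \<longleftrightarrow> e * of_nat \<mu> = d * of_nat \<nu>" by simp
  then show ?thesis using that eq unfolding L_def \<mu>_def \<nu>_def by blast
qed

lemma order_br:
  fixes p q :: "'k::field_char_0 poly"
  assumes "p \<noteq> 0" "q \<noteq> 0" "e * of_nat (order \<alpha> p) \<noteq> d * of_nat (order \<alpha> q)"
  shows "br e d p q \<noteq> 0" "Suc (order \<alpha> (br e d p q)) = order \<alpha> p + order \<alpha> q"
proof -
  define L where "L = [:-\<alpha>, 1:]"
  obtain h where h: "L * br e d p q = L ^ (order \<alpha> p + order \<alpha> q) * h" "poly h \<alpha> \<noteq> 0"
    using br_root_factor[OF assms(1,2), of \<alpha> e d] assms(3) unfolding L_def by metis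
  have "h \<noteq> 0" using h(2) by auto
  have "L \<noteq> 0" by (simp add: L_def)
  then show nz: "br e d p q \<noteq> 0" using h(1) \<open>h \<noteq> 0\<close> by auto
  have "order \<alpha> (L * br e d p q) = Suc (order \<alpha> (br e d p q))"
  proof -
    have "order \<alpha> L = 1" unfolding L_def using order_power_n_n[of \<alpha> 1] by simp
    then show ?thesis using order_mult[of L "br e d p q" \<alpha>] nz \<open>L \<noteq> 0\<close> by (metis mult_eq_0_iff plus_1_eq_Suc)
  qed
  moreover have "order \<alpha> (L ^ (order \<alpha> p + order \<alpha> q) * h) = order \<alpha> p + order \<alpha> q"
    using \<open>h \<noteq> 0\<close> \<open>L \<noteq> 0\<close> h(2) by (simp add: order_mult L_def order_power_n_n order_0I)
  ultimately show "Suc (order \<alpha> (br e d p q)) = order \<alpha> p + order \<alpha> q" using h(1) by simp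
qed

lemma order_br_ge:
  fixes p q :: "'k::field_char_0 poly"
  assumes "p \<noteq> 0" "q \<noteq> 0" "br e d p q \<noteq> 0" "e * of_nat (order \<alpha> p) = d * of_nat (order \<alpha> q)"
  shows "order \<alpha> p + order \<alpha> q \<le> order \<alpha> (br e d p q)"
proof -
  define L where "L = [:-\<alpha>, 1:]"
  obtain h where h: "L * br e d p q = L ^ (order \<alpha> p + order \<alpha> q) * h" "poly h \<alpha> = 0"
    using br_root_factor[OF assms(1,2), of \<alpha> e d] assms(4) unfolding L_def by metis
  have "L \<noteq> 0" by (simp add: L_def)
  from h(2) obtain k where "h = L * k" by (auto simp: poly_eq_0_iff_dvd L_def)
  then have "L * br e d p q = L * (L ^ (order \<alpha> p + order \<alpha> q) * k)" using h(1) by (simp add: algebra_simps)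
  then have "br e d p q = L ^ (order \<alpha> p + order \<alpha> q) * k" 
    using mult_left_cancel[OF \<open>L \<noteq> 0\<close>] by blast
  then have "L ^ (order \<alpha> p + order \<alpha> q) dvd br e d p q" by simp
  then show ?thesis using assms(3) by (simp add: order_divides L_def)
qed

lemma coeff_br:
  "coeff (br e d p q) i = (\<Sum>a\<le>Suc i. (of_rat e * of_nat a - of_rat d * of_nat (Suc i - a)) * coeff p a * coeff q (Suc i - a))"
proof -
  \<comment> \<open>\<open>y d/dy\<close> multiplies the coefficient of degree \<open>k\<close> by
    \<open>k\<close>, which avoids the index shift of the derivative.\<close>
  have z: "coeff (pCons 0 (pderiv r)) k = of_nat k * coeff r k" for r :: "'a poly" and k
    by (cases k) (simp_all add: coeff_pderiv)
  have "coeff (br e d p q) i = coeff (pCons 0 (br e d p q)) (Suc i)" by simp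
  also have "pCons 0 (br e d p q) = smult (of_rat e) (pCons 0 (pderiv p) * q) - smult (of_rat d) (p * pCons 0 (pderiv q))"
    by (simp add: br_def)
  also have "coeff \<dots> (Suc i) = (\<Sum>a\<le>Suc i. of_rat e * (of_nat a * coeff p a * coeff q (Suc i - a))
       - of_rat d * (coeff p a * (of_nat (Suc i - a) * coeff q (Suc i - a))))"
    unfolding coeff_diff coeff_smult coeff_mult z sum_distrib_left sum_subtractf ..
  finally show ?thesis by (simp add: algebra_simps del: sum.atMost_Suc)
qed

text \<open>The counterpart at infinity of the multiplicity count: degrees take the place of
  multiplicities.\<close>

lemma degree_br_coeff:
  fixes p q :: "'k::field_char_0 poly"
  assumes "degree p + degree q = Suc i"
  shows "coeff (br e d p q) i = (of_rat e * of_nat (degree p) - of_rat d * of_nat (degree q)) * lead_coeff p * lead_coeff q"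
proof -
  have "coeff (br e d p q) i = (\<Sum>a\<le>Suc i. if a = degree p then
     (of_rat e * of_nat (degree p) - of_rat d * of_nat (degree q)) * lead_coeff p * lead_coeff q else 0)"
    unfolding coeff_br
  proof (rule sum.cong[OF refl])
    fix a assume "a \<in> {..Suc i}"
    then consider "a = degree p" "Suc i - a = degree q" | "a > degree p" | "a < degree p" "Suc i - a > degree q"
      using assms by fastforce
    then show "(of_rat e * of_nat a - of_rat d * of_nat (Suc i - a)) * coeff p a * coeff q (Suc i - a) =
        (if a = degree p then (of_rat e * of_nat (degree p) - of_rat d * of_nat (degree q)) * lead_coeff p * lead_coeff q else 0)"
      by cases (auto simp: coeff_eq_0)
  qed
  then show ?thesis using assms by simp
qed

lemma br_zero_degree:
  fixes p q :: "'k::field_char_0 poly"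
  assumes "p \<noteq> 0" "q \<noteq> 0" "br e d p q = 0"
  shows "e * of_nat (degree p) = d * of_nat (degree q)"
proof (cases "degree p + degree q")
  case (Suc i)
  then have "(of_rat e * of_nat (degree p) - of_rat d * of_nat (degree q) :: 'k) = 0"
    using degree_br_coeff[OF Suc, of e d] assms by simp
  then have "(of_rat (e * of_nat (degree p)) :: 'k) = of_rat (d * of_nat (degree q))" by (simp add: of_rat_mult)
  then show ?thesis by simp
qed simp

lemma br_zero_order:
  fixes p q :: "'k::field_char_0 poly"
  assumes "p \<noteq> 0" "q \<noteq> 0" "br e d p q = 0"
  shows "e * of_nat (order \<alpha> p) = d * of_nat (order \<alpha> q)"
  using order_br(1)[of p q e \<alpha> d] assms by blast

section \<open>Divisibility and proportional powers over an algebraically closed field\<close>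

lemma poly_dvd_by_order:
  fixes a b :: "'k::field_char_0 poly"
  assumes K: "alg_closed TYPE('k)" and "a \<noteq> 0" "b \<noteq> 0" "\<And>\<alpha>. order \<alpha> a \<le> order \<alpha> b"
  shows "a dvd b"
  using assms(2-)
proof (induction "degree a" arbitrary: a b)
  case 0
  then obtain c where "a = [:c:]" by (metis degree_eq_zeroE)
  then show ?case using 0 by (simp add: const_poly_dvd_iff_dvd_content is_unit_iff_degree unit_imp_dvd)
next
  case (Suc n)
  then obtain \<alpha> where \<alpha>: "poly a \<alpha> = 0" using K unfolding alg_closed_def by (metis zero_less_Suc)
  define L where "L = [:-\<alpha>, 1:]"
  have "L \<noteq> 0" by (simp add: L_def)
  obtain a' where a': "a = L * a'" using \<alpha> by (auto simp: poly_eq_0_iff_dvd L_def)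
  have "poly b \<alpha> = 0" using \<alpha> Suc.prems order_root[of a \<alpha>] order_root[of b \<alpha>] by (metis le_zero_eq)
  then obtain b' where b': "b = L * b'" by (auto simp: poly_eq_0_iff_dvd L_def)
  have nz: "a' \<noteq> 0" "b' \<noteq> 0" using a' b' Suc.prems by auto
  have "degree a = degree L + degree a'" unfolding a' using nz \<open>L \<noteq> 0\<close> by (intro degree_mult_eq)
  then have "degree a = Suc (degree a')" by (simp add: L_def)
  then have "n = degree a'" using Suc.hyps(2) by simp
  moreover have "order \<beta> a' \<le> order \<beta> b'" for \<beta>
    using Suc.prems(3)[of \<beta>] a' b' nz \<open>L \<noteq> 0\<close> by (simp add: order_mult)
  ultimately have "a' dvd b'" using Suc.hyps(1) nz by blast
  then show ?case by (simp add: a' b')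
qed

lemma order_power_eq: "p \<noteq> 0 \<Longrightarrow> order \<alpha> (p ^ n) = n * order \<alpha> (p :: 'k::field_char_0 poly)"
  by (induction n) (simp_all add: order_mult)

lemma poly_eq_smult_by_order:
  fixes a b :: "'k::field_char_0 poly"
  assumes K: "alg_closed TYPE('k)" and "a \<noteq> 0" "b \<noteq> 0" "\<And>\<alpha>. order \<alpha> a \<le> order \<alpha> b" "degree a = degree b"
  obtains c where "c \<noteq> 0" "b = smult c a"
proof -
  obtain k where k: "b = a * k" using poly_dvd_by_order[OF assms(1-4)] by (auto elim: dvdE)
  then have "k \<noteq> 0" using assms by auto
  then have "degree k = 0" using k assms by (simp add: degree_mult_eq)
  then obtain c where "k = [:c:]" by (metis degree_eq_zeroE)
  then show ?thesis using that[of c] k \<open>k \<noteq> 0\<close> by auto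
qed

text \<open>A vanishing bracket makes the multiplicities of \<open>g\<close> at all points, and its
  degree, equal to \<open>w / d = m / n\<close> times those of \<open>p\<close>; this determines
  \<open>g^n\<close> up to a constant.\<close>

lemma br_zero_power:
  fixes p g :: "'k::field_char_0 poly"
  assumes K: "alg_closed TYPE('k)" and "p \<noteq> 0" "g \<noteq> 0" "br w d p g = 0" "d > 0"
    and "w * of_nat n = d * of_nat m"
  obtains c where "c \<noteq> 0" "g ^ n = smult c (p ^ m)"
proof -
  have key: "n * x = m * y" if "w * of_nat y = d * of_nat x" for x y
  proof -
    have "d * of_nat (n * x) = (w * of_nat n) * of_nat y" using that by simp
    also have "\<dots> = d * of_nat (m * y)" using assms(6) by simp
    finally show ?thesis using assms(5) by (metis less_irrefl mult_left_cancel of_nat_eq_iff)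
  qed
  have o: "order \<alpha> (p ^ m) \<le> order \<alpha> (g ^ n)" for \<alpha>
    using key[OF br_zero_order[OF assms(2-4), of \<alpha>]] assms(2,3) by (simp add: order_power_eq)
  have "degree (p ^ m) = degree (g ^ n)"
    using key[OF br_zero_degree[OF assms(2-4)]] by (simp add: degree_power_eq assms)
  then show ?thesis
    using poly_eq_smult_by_order[OF K _ _ o] that assms(2,3) by auto
qed

lemma single_root_order:
  fixes p :: "'k::field_char_0 poly"
  assumes K: "alg_closed TYPE('k)" and "p \<noteq> 0" "\<And>\<beta>. poly p \<beta> = 0 \<Longrightarrow> \<beta> = \<alpha>"
  shows "order \<alpha> p = degree p"
proof -
  obtain p1 where p1: "p = [:-\<alpha>, 1:] ^ order \<alpha> p * p1" "\<not> [:-\<alpha>, 1:] dvd p1"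
    using order_decomp[OF assms(2), of \<alpha>] by auto
  then have "p1 \<noteq> 0" by auto
  have "poly p1 \<beta> \<noteq> 0" for \<beta>
  proof
    assume z: "poly p1 \<beta> = 0"
    have "poly p \<beta> = poly ([:-\<alpha>, 1:] ^ order \<alpha> p) \<beta> * poly p1 \<beta>" by (metis p1(1) poly_mult)
    then have "\<beta> = \<alpha>" using assms(3)[of \<beta>] z by simp
    then show False using z p1(2) by (simp add: poly_eq_0_iff_dvd)
  qed
  then have "degree p1 = 0" using K unfolding alg_closed_def by blast
  moreover have "degree p = degree ([:-\<alpha>, 1:] ^ order \<alpha> p) + degree p1"
    by (subst p1(1), subst degree_mult_eq) (use \<open>p1 \<noteq> 0\<close> in auto)
  ultimately show ?thesis by (simp add: degree_power_eq)
qed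

section \<open>The equation \<open>\<tau> p' f - d p f' = p\<close>\<close>

context
  fixes p f :: "'k::field_char_0 poly" and \<tau> d :: rat
  assumes ode: "br \<tau> d p f = p" and p: "p \<noteq> 0" and \<tau>: "\<tau> > 0" and d: "d > 0"
begin

lemma ode_nz: "f \<noteq> 0"
  using ode p by (auto simp: br_lin)

text \<open>Let \<open>\<mu>\<close> and \<open>\<nu>\<close> be the multiplicities in
  \<open>p\<close> and \<open>f\<close>; the bracket must have multiplicity exactly
  \<open>\<mu>\<close>. If \<open>\<tau> \<mu> = d \<nu>\<close>, it would be at least
  \<open>\<mu> + \<nu>\<close>, forcing \<open>\<nu> = 0\<close> and then \<open>\<mu> = 0\<close>.
  Otherwise it is \<open>\<mu> + \<nu> - 1\<close>, so \<open>\<nu> = 1\<close>.\<close>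

lemma ode_root:
  assumes "poly p \<alpha> = 0"
  shows "order \<alpha> f = 1" "\<tau> * of_nat (order \<alpha> p) \<noteq> d"
proof -
  have \<mu>: "order \<alpha> p > 0" using assms p by (simp add: order_root)
  have ne: "\<tau> * of_nat (order \<alpha> p) \<noteq> d * of_nat (order \<alpha> f)"
  proof
    assume e: "\<tau> * of_nat (order \<alpha> p) = d * of_nat (order \<alpha> f)"
    have "order \<alpha> p + order \<alpha> f \<le> order \<alpha> p"
      using order_br_ge[OF p ode_nz _ e] ode p by simp
    then show False using e \<mu> \<tau> by simp
  qed
  show 1: "order \<alpha> f = 1" using order_br(2)[OF p ode_nz ne] ode by simp
  show "\<tau> * of_nat (order \<alpha> p) \<noteq> d" using ne 1 by simp
qed

lemma ode_degree_ge: "degree f \<ge> 1"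
proof (rule ccontr)
  assume "\<not> degree f \<ge> 1"
  then have f0: "degree f = 0" by simp
  then have df: "pderiv f = 0" by (simp add: pderiv_eq_0_iff)
  have "degree (br \<tau> d p f) < degree p \<or> br \<tau> d p f = 0"
  proof (cases "degree p = 0")
    case True
    then have "pderiv p = 0" by (simp add: pderiv_eq_0_iff)
    then show ?thesis by (simp add: br_def df)
  next
    case False
    have "degree (br \<tau> d p f) \<le> degree (pderiv p * f)" by (simp add: br_def df degree_smult_le)
    also have "\<dots> \<le> degree (pderiv p) + degree f" by (rule degree_mult_le)
    also have "\<dots> < degree p" using f0 False by (simp add: degree_pderiv)
    finally show ?thesis by simp
  qed
  then show False using ode p by simp
qed

text \<open>In degree \<open>degree p + degree f - 1\<close>, which exceeds \<open>degree p\<close>,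
  the contributions of the leading coefficients must cancel.\<close>

lemma ode_degree:
  assumes "degree f \<ge> 2"
  shows "\<tau> * of_nat (degree p) = d * of_nat (degree f)"
proof -
  obtain i where i: "degree p + degree f = Suc i" using assms by (cases "degree p + degree f") auto
  have "coeff p i = 0" using i assms by (intro coeff_eq_0) simp
  then have "(of_rat \<tau> * of_nat (degree p) - of_rat d * of_nat (degree f) :: 'k) = 0"
    using degree_br_coeff[OF i, of \<tau> d] ode p ode_nz by simp
  then have "(of_rat (\<tau> * of_nat (degree p)) :: 'k) = of_rat (d * of_nat (degree f))" by (simp add: of_rat_mult)
  then show ?thesis by simp
qed

lemma ode_single:
  assumes K: "alg_closed TYPE('k)" and "degree f = 1"
  obtains \<alpha> where "order \<alpha> p = degree p"
proof -
  obtain \<alpha> where \<alpha>: "poly f \<alpha> = 0" using K assms(2) unfolding alg_closed_def by (metis zero_less_one)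
  have "\<beta> = \<alpha>" if "poly p \<beta> = 0" for \<beta>
  proof (rule ccontr)
    assume "\<beta> \<noteq> \<alpha>"
    have "poly f \<beta> = 0" using ode_root(1)[OF that] by (simp add: order_root)
    then have "{\<alpha>, \<beta>} \<subseteq> {x. poly f x = 0}" using \<alpha> by auto
    then have "card {\<alpha>, \<beta>} \<le> card {x. poly f x = 0}"
      by (rule card_mono[OF poly_roots_finite[OF ode_nz]])
    also have "\<dots> \<le> degree f" by (rule card_poly_roots_bound[OF ode_nz])
    finally show False using \<open>\<beta> \<noteq> \<alpha>\<close> assms(2) by simp
  qed
  then show ?thesis using that single_root_order[OF K p] by blast
qed

text \<open>Suppose \<open>\<tau> \<mu> < d\<close> at every root of \<open>p\<close>; equality is
  excluded by \<open>ode_root\<close>. Roots of \<open>p\<close> are simple in \<open>f\<close>, so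
  with \<open>A / B = \<tau> / d\<close> the power \<open>p^A\<close> divides \<open>f^B\<close>. By
  \<open>ode_degree\<close> the degrees agree, so the two are proportional, against
  \<open>A \<mu> < B\<close> at any root.\<close>

lemma ode_big_root:
  assumes K: "alg_closed TYPE('k)" and "degree f \<ge> 2"
  shows "\<exists>\<alpha>. poly p \<alpha> = 0 \<and> \<tau> * of_nat (order \<alpha> p) > d"
proof (rule ccontr)
  assume no: "\<not> ?thesis"
  have small: "\<tau> * of_nat (order \<alpha> p) < d" if "poly p \<alpha> = 0" for \<alpha>
    using that ode_root(2)[OF that] no by (meson linorder_neqE)
  obtain a b where ab: "\<tau> / d = of_int a / of_int b" "b > 0"
    by (metis quotient_of_div quotient_of_denom_pos surj_pair)
  have "\<tau> / d > 0" using \<tau> d by simp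
  then have "a > 0" using ab by (simp add: zero_less_divide_iff)
  define A B where "A = nat a" and "B = nat b"
  have AB: "\<tau> * of_nat B = d * of_nat A" "A > 0" "B > 0"
    using ab \<open>a > 0\<close> d by (auto simp: A_def B_def field_simps)
  have lt: "A * order \<alpha> p < B" if "poly p \<alpha> = 0" for \<alpha>
  proof -
    have "d * of_nat (A * order \<alpha> p) = of_nat B * (\<tau> * of_nat (order \<alpha> p))" using AB(1) by (simp add: algebra_simps)
    also have "\<dots> < of_nat B * d" using small[OF that] AB(3) by simp
    finally have "d * of_nat (A * order \<alpha> p) < d * of_nat B" by (simp add: mult.commute)
    then show ?thesis using d by (simp only: mult_less_cancel_left_pos of_nat_less_iff)
  qed
  have o: "order \<alpha> (p ^ A) \<le> order \<alpha> (f ^ B)" for \<alpha>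
  proof (cases "poly p \<alpha> = 0")
    case True
    then show ?thesis using lt[OF True] ode_root(1)[OF True] p ode_nz by (simp add: order_power_eq)
  next
    case False
    then show ?thesis using p by (simp add: order_power_eq order_0I)
  qed
  have deg: "degree (p ^ A) = degree (f ^ B)"
  proof -
    have "d * of_nat (A * degree p) = of_nat B * (\<tau> * of_nat (degree p))" using AB(1) by (simp add: algebra_simps)
    also have "\<dots> = d * of_nat (B * degree f)" using ode_degree[OF assms(2)] by (simp add: algebra_simps)
    finally have "A * degree p = B * degree f" using d by (metis less_irrefl mult_left_cancel of_nat_eq_iff)
    then show ?thesis by (simp add: degree_power_eq p ode_nz)
  qed
  obtain c where c: "c \<noteq> 0" "f ^ B = smult c (p ^ A)"
    using poly_eq_smult_by_order[OF K _ _ o deg] p ode_nz by auto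
  have "degree p > 0"
    using ode_degree[OF assms(2)] assms(2) d by (intro gr0I) auto
  then obtain \<alpha> where \<alpha>: "poly p \<alpha> = 0" using K unfolding alg_closed_def by blast
  have "order \<alpha> (f ^ B) = order \<alpha> (p ^ A)" unfolding c(2) using c(1) by (simp add: order_smult)
  then show False using lt[OF \<alpha>] ode_root(1)[OF \<alpha>] p ode_nz by (simp add: order_power_eq)
qed

end

text \<open>Substitute \<open>f = g p / b\<close> into the equation and use
  \<open>b' / b = (H / D) p' / p\<close>. With the primed letters as free variables this is an
  identity modulo polynomial relations, within reach of Groebner bases.\<close>

lemma idom_ode_identity:
  fixes p p' g g' b b' f f' w d \<tau> D H :: "'a::idom"
  assumes "g * p = b * f" "g' * p + g * p' = b' * f + b * f'" "b = w * (p' * g) - d * (p * g')"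
    "D * (b' * p) = H * (b * p')" "H * d = D * (w + d - \<tau>)" "b \<noteq> 0" "D \<noteq> 0"
  shows "\<tau> * (p' * f) - d * (p * f') = p"
proof -
  have "D * b * (\<tau> * (p' * f) - d * (p * f') - p) = 0"
    using assms(1-5) by algebra
  then show ?thesis using assms(6,7) by simp
qed

text \<open>The solution is \<open>f = g p / b\<close> for \<open>b = br w d p g\<close>. The
  relation between \<open>b\<close> and \<open>p\<close> serves twice: it bounds the multiplicities
  of \<open>b\<close> where the bracket formula does not, and it supplies
  \<open>b' / b\<close>.\<close>

lemma ode_from_bracket:
  fixes p g :: "'k::field_char_0 poly"
  assumes K: "alg_closed TYPE('k)" and p: "p \<noteq> 0" and b: "br w d p g \<noteq> 0" and c: "c \<noteq> 0" and D: "D > 0"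
    and pw: "br w d p g ^ D = smult c (p ^ H)" and wt: "of_nat H * d = of_nat D * (w + d - \<tau>)"
    and d: "d > 0" and \<tau>: "\<tau> > 0"
  obtains f where "br \<tau> d p f = p"
proof -
  define b where "b = br w d p g"
  have bnz: "b \<noteq> 0" and bD: "b ^ D = smult c (p ^ H)" using b pw by (simp_all add: b_def)
  have g: "g \<noteq> 0" using bnz by (auto simp: b_def br_lin)
  have "b dvd g * p"
  proof (rule poly_dvd_by_order[OF K bnz])
    show "g * p \<noteq> 0" using g p by simp
    fix \<alpha>
    show "order \<alpha> b \<le> order \<alpha> (g * p)"
    proof (cases "w * of_nat (order \<alpha> p) = d * of_nat (order \<alpha> g)")
      case False
      then show ?thesis using order_br(2)[OF p g False] g p by (simp add: order_mult b_def)
    next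
      \<comment> \<open>At such a root the bracket formula bounds the multiplicity of
        \<open>b\<close> only from below; the upper bound comes from \<open>b^D = c p^H\<close> and
        the weight identity \<open>wt\<close>.\<close>
      case True
      have "order \<alpha> (b ^ D) = order \<alpha> (p ^ H)" unfolding bD using c by (simp add: order_smult)
      then have "D * order \<alpha> b = H * order \<alpha> p" using bnz p by (simp add: order_power_eq)
      then have DH: "(of_nat D :: rat) * of_nat (order \<alpha> b) = of_nat H * of_nat (order \<alpha> p)"
        by (metis of_nat_mult)
      have "of_nat D * (d * of_nat (order \<alpha> b)) = d * (of_nat D * of_nat (order \<alpha> b))" by (simp add: algebra_simps)
      also have "\<dots> = (of_nat H * d) * of_nat (order \<alpha> p)" unfolding DH by (simp add: algebra_simps)
      also have "\<dots> = of_nat D * ((w + d - \<tau>) * of_nat (order \<alpha> p))" unfolding wt by (simp add: algebra_simps)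
      finally have "d * of_nat (order \<alpha> b) = (w + d - \<tau>) * of_nat (order \<alpha> p)" using D by simp
      also have "\<dots> = d * of_nat (order \<alpha> g + order \<alpha> p) - \<tau> * of_nat (order \<alpha> p)"
        using True by (simp add: algebra_simps)
      also have "\<dots> \<le> d * of_nat (order \<alpha> g + order \<alpha> p)" using \<tau> by simp
      finally have "order \<alpha> b \<le> order \<alpha> g + order \<alpha> p" using d by (simp only: mult_le_cancel_left_pos of_nat_le_iff)
      then show ?thesis using g p by (simp add: order_mult)
    qed
  qed
  then obtain f where f: "g * p = b * f" by (auto elim: dvdE)
  have d1: "pderiv g * p + g * pderiv p = pderiv b * f + b * pderiv f"
    using arg_cong[OF f, of pderiv] by (simp add: pderiv_mult algebra_simps)
  \<comment> \<open>The logarithmic derivative of \<open>b^D = c p^H\<close>, cleared of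
    denominators.\<close>
  have d2: "of_nat D * (pderiv b * p) = of_nat H * (b * pderiv p)"
  proof -
    have pd: "of_nat n * x ^ n * pderiv x = pderiv (x ^ n) * x" for n and x :: "'k poly"
    proof (cases n)
      case (Suc k)
      show ?thesis unfolding Suc pderiv_power_Suc by (simp add: of_nat_poly mult_ac del: of_nat_Suc)
    qed simp
    have "b ^ D * (of_nat D * (pderiv b * p)) = of_nat D * b ^ D * pderiv b * p" by (simp add: algebra_simps)
    also have "\<dots> = pderiv (b ^ D) * b * p" by (simp add: pd)
    also have "\<dots> = smult c (pderiv (p ^ H) * p) * b" by (simp add: bD pderiv_smult algebra_simps)
    also have "pderiv (p ^ H) * p = of_nat H * p ^ H * pderiv p" by (rule pd[symmetric])
    also have "smult c (of_nat H * p ^ H * pderiv p) * b = b ^ D * (of_nat H * (b * pderiv p))"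
      by (simp add: bD algebra_simps)
    finally show ?thesis using bnz by simp
  qed
  have b_eq: "b = [:of_rat w:] * (pderiv p * g) - [:of_rat d:] * (p * pderiv g)"
    by (simp add: b_def br_def)
  have H: "of_nat H * [:of_rat d :: 'k:] = of_nat D * ([:of_rat w:] + [:of_rat d:] - [:of_rat \<tau>:])"
  proof -
    have "of_rat (of_nat H * d) = (of_rat (of_nat D * (w + d - \<tau>)) :: 'k)" using wt by simp
    then show ?thesis by (simp add: of_nat_poly of_rat_mult of_rat_add of_rat_diff mult.commute)
  qed
  have "[:of_rat \<tau>:] * (pderiv p * f) - [:of_rat d:] * (p * pderiv f) = p"
    by (rule idom_ode_identity[OF f d1 b_eq d2 H bnz]) (use D in simp)
  then have "br \<tau> d p f = p" by (simp add: br_def)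
  then show ?thesis by (rule that)
qed

section \<open>Existence of a homogeneous F with [P, F] = P on leading forms\<close>

definition El :: "nat \<Rightarrow> rat set" where
  "El l = {a. of_nat l * a \<in> \<int>}"

lemma exps_El: "exps_ok (El l)"
  by (auto simp: exps_ok_def El_def distrib_left right_diff_distrib)

lemma cm_power_self: "cm P (P ^ n) = 0"
  by (simp add: power_commutes)

text \<open>By the Leibniz rule the bracket is a sum of \<open>n + 1\<close> terms with the same
  leading polynomial, because leading polynomials commute; in characteristic zero they do not
  cancel.\<close>

lemma top_at_comm_power:
  assumes G: "top_at s G w g" and C: "top_at s (cm P G) h \<kappa>" and s: "1 + s > 0"
  shows "top_at s (cm P (G ^ Suc n)) (of_nat n * w + h) (smult (of_nat (Suc n)) (g ^ n * \<kappa>))"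
proof -
  have "fil 1 s (of_nat n * w + h) (cm P (G ^ Suc n))
      \<and> cp s (of_nat n * w + h) (cm P (G ^ Suc n)) = smult (of_nat (Suc n)) (g ^ n * \<kappa>)"
  proof (induction n)
    case 0
    then show ?case using C by (simp add: top_at_def)
  next
    case (Suc n)
    have eq: "cm P (G ^ Suc (Suc n)) = cm P (G ^ Suc n) * G + G ^ Suc n * cm P G"
    proof -
      have "cm P (A * B) = cm P A * B + A * cm P B" for A B by (simp add: algebra_simps)
      from this[of "G ^ Suc n" G] show ?thesis by (simp add: power_commutes mult.assoc)
    qed
    have f1: "fil 1 s (of_nat n * w + h) (cm P (G ^ Suc n))" using Suc by simp
    have f2: "fil 1 s w G" "fil 1 s h (cm P G)" "fil 1 s (of_nat (Suc n) * w) (G ^ Suc n)"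
      using top_atD(1)[OF G] top_atD(1)[OF C] fil_power[OF top_atD(1)[OF G], of "Suc n"] s by simp_all
    have e: "of_nat (Suc n) * w + h = (of_nat n * w + h) + w" "of_nat (Suc n) * w + h = of_nat (Suc n) * w + h"
      by (simp_all add: algebra_simps)
    have s0: "1 + s \<ge> 0" using s by simp
    have "fil 1 s (of_nat (Suc n) * w + h) (cm P (G ^ Suc n) * G)"
      unfolding e(1) by (rule fil_mult[OF f1 f2(1) s0])
    moreover have "fil 1 s (of_nat (Suc n) * w + h) (G ^ Suc n * cm P G)"
      by (rule fil_mult[OF f2(3,2) s0])
    moreover have "cp s (of_nat (Suc n) * w + h) (cm P (G ^ Suc n) * G) = smult (of_nat (Suc n)) (g ^ n * \<kappa>) * g"
      unfolding e(1) cp_mult[OF f1 f2(1) s] using Suc top_atD(2)[OF G] by simp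
    moreover have "cp s (of_nat (Suc n) * w + h) (G ^ Suc n * cm P G) = g ^ Suc n * \<kappa>"
      unfolding cp_mult[OF f2(3,2) s] cp_power[OF f2(1) s] top_atD(2)[OF G] top_atD(2)[OF C] ..
    moreover have "smult (of_nat (Suc n)) (g ^ n * \<kappa>) * g + g ^ Suc n * \<kappa> = smult (of_nat (Suc (Suc n))) (g ^ Suc n * \<kappa>)"
    proof -
      have "smult (of_nat (Suc n)) (g ^ n * \<kappa>) * g = smult (of_nat (Suc n)) (g ^ Suc n * \<kappa>)" by (simp add: mult_ac)
      then show ?thesis by (simp only: of_nat_Suc[of "Suc n"] smult_add_left smult_1_left add.commute)
    qed
    ultimately show ?case unfolding eq cp_simps(2) by (simp only: fil_add simp_thms)
  qed
  moreover have "smult (of_nat (Suc n)) (g ^ n * \<kappa>) \<noteq> 0"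
    using top_atD(3)[OF G] top_atD(3)[OF C] by (simp del: of_nat_Suc)
  ultimately show ?thesis unfolding top_at_def by blast
qed

text \<open>\<open>r\<close> clears the denominator of \<open>s\<close>. All weights in the descent
  lie in one lattice, so a strict decrease is a decrease by a whole step.\<close>

lemma top_weight_int:
  assumes "G \<in> xspan (El l)" "top_at s G w g" "of_nat r * s \<in> \<int>"
  shows "of_nat (l * r) * w \<in> \<int>"
proof -
  obtain j where "coeff g j \<noteq> 0" using top_atD(3)[OF assms(2)] by (metis leading_coeff_neq_0)
  then have "(w - s * of_nat j, j) \<in> supp G" using cp_nonzero_point top_atD(2)[OF assms(2)] by metis
  then have "of_nat l * (w - s * of_nat j) \<in> \<int>" using assms(1) by (auto simp: xspan_def El_def)
  then have "of_nat r * (of_nat l * (w - s * of_nat j)) + of_nat l * (of_nat r * s) * of_nat j \<in> \<int>"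
    using Ints_mult[OF Ints_of_nat, of _ r] Ints_mult[OF Ints_mult[OF Ints_of_nat assms(3)] Ints_of_nat]
    by (intro Ints_add) auto
  then show ?thesis by (simp add: algebra_simps)
qed

lemma Ints_less_imp_le:
  fixes x y :: rat
  assumes "x < y" "x \<in> \<int>" "y \<in> \<int>"
  shows "x \<le> y - 1"
proof -
  obtain i j where ij: "x = of_int i" "y = of_int j" using assms(2,3) by (auto elim!: Ints_cases)
  then have "i \<le> j - 1" using assms(1) by simp
  then have "(of_int i :: rat) \<le> of_int (j - 1)" by (simp only: of_int_le_iff)
  then show ?thesis by (simp add: ij)
qed

text \<open>The measure is the gap between the expected weight \<open>d + w - (1 + s)\<close> of
  \<open>[P, G]\<close> and its actual weight \<open>h\<close>, in lattice units and bounded by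
  \<open>k\<close>. Passing to \<open>G1\<close> adds \<open>n w\<close> to \<open>h\<close>, while
  the weight of \<open>G1\<close> falls below \<open>(n + 1) w\<close>. The equations for
  \<open>\<kappa>^D\<close> and \<open>D h\<close> form the invariant that
  \<open>ode_from_bracket\<close> uses once the gap is 0.\<close>

lemma gap_descent:
  fixes P :: "'k::field_char_0 wa"
  assumes K: "alg_closed TYPE('k)" and s: "1 + s > 0" and P: "P \<in> xspan (El l)" and tP: "top_at s P d p"
    and d: "d > 0" and dp: "degree p > 0" and r: "of_nat r * s \<in> \<int>" and l: "l > 0" "r > 0"
  shows "G \<in> xspan (El l) \<Longrightarrow> top_at s G w g \<Longrightarrow> top_at s (cm P G) h \<kappa> \<Longrightarrow> D > 0 \<Longrightarrow> c \<noteq> 0 \<Longrightarrow>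
     \<kappa> ^ D = smult c (p ^ H) \<Longrightarrow> of_nat D * h = of_nat H * d \<Longrightarrow>
     of_nat (l * r) * (d + w - (1 + s) - h) < of_nat k \<Longrightarrow> \<exists>f. br (1 + s) d p f = p"
proof (induction k arbitrary: G w g h \<kappa> D c H)
  case (0 G w g h \<kappa> D c H)
  have "h \<le> d + w - (1 + s)"
    using top_at_le_fil[OF 0(3)] fil_comm[OF top_atD(1)[OF tP] top_atD(1)[OF 0(2)] s] by simp
  then have "of_nat (l * r) * (d + w - (1 + s) - h) \<ge> 0" by simp
  then show ?case using 0 by simp
next
  case (Suc k G w g h \<kappa> D c H)
  note tG = Suc.prems(2) and tC = Suc.prems(3)
  have hle: "h \<le> d + w - (1 + s)"
    using top_at_le_fil[OF tC] fil_comm[OF top_atD(1)[OF tP] top_atD(1)[OF tG] s] by simp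
  have br: "cp s (d + w - (1 + s)) (cm P G) = br w d p g"
    using cp_comm[OF top_atD(1)[OF tP] top_atD(1)[OF tG] s] top_atD(2)[OF tP] top_atD(2)[OF tG] by simp
  have p: "p \<noteq> 0" and g: "g \<noteq> 0" using top_atD(3) tP tG by auto
  show ?case
  proof (cases "h = d + w - (1 + s)")
    case True
    then have \<kappa>: "\<kappa> = br w d p g" using br top_atD(2)[OF tC] by simp
    have "of_nat H * d = of_nat D * (w + d - (1 + s))" using Suc.prems(7) True by (simp add: add.commute)
    then show ?thesis
      using ode_from_bracket[OF K p _ Suc.prems(5,4), of w d g H "1 + s"] Suc.prems(6) top_atD(3)[OF tC] d s
      unfolding \<kappa> by metis
  next
    case False
    then have "h < d + w - (1 + s)" using hle by simp
    then have br0: "br w d p g = 0" using top_atD(1)[OF tC] br unfolding fil_iff_cp by metis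
    have "w * of_nat (degree p) = d * of_nat (degree g)" by (rule br_zero_degree[OF p g br0])
    then have "w * of_nat (degree p) \<ge> 0" using d by simp
    then have w: "w \<ge> 0" using dp by (simp add: zero_le_mult_iff)
    \<comment> \<open>\<open>w / d = m / (n + 1)\<close>, so that \<open>G^(n + 1)\<close> and
      \<open>P^m\<close> have the same weight; \<open>n\<close> is the denominator minus one, which
      keeps the exponent of \<open>G\<close> positive.\<close>
    obtain a b where ab: "w / d = of_int a / of_int b" "b > 0"
      by (metis quotient_of_div quotient_of_denom_pos surj_pair)
    have "a \<ge> 0"
    proof -
      have "w / d \<ge> 0" using w d by simp
      then show ?thesis using ab by (simp add: zero_le_divide_iff)
    qed
    define m n where "m = nat a" and "n = nat b - 1"
    have mn: "w * of_nat (Suc n) = d * of_nat m"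
      using ab \<open>a \<ge> 0\<close> d by (simp add: m_def n_def field_simps)
    obtain c1 where c1: "c1 \<noteq> 0" "g ^ Suc n = smult c1 (p ^ m)"
      using br_zero_power[OF K p g br0 d mn] by metis
    define G1 where "G1 = G ^ Suc n - smul c1 (P ^ m)"
    have cmG1: "cm P G1 = cm P (G ^ Suc n)"
      using cm_power_self[of P m] by (simp add: G1_def right_diff_distrib left_diff_distrib smul_mult smul_simps)
    have tC1: "top_at s (cm P G1) (of_nat n * w + h) (smult (of_nat (Suc n)) (g ^ n * \<kappa>))"
      unfolding cmG1 by (rule top_at_comm_power[OF tG tC s])
    have G1nz: "G1 \<noteq> 0"
    proof
      assume "G1 = 0"
      then have "cm P G1 = 0" by simp
      then show False using top_atD(2,3)[OF tC1] by (metis cp_simps(1))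
    qed
    have fG: "fil 1 s (of_nat (Suc n) * w) (G ^ Suc n)" "cp s (of_nat (Suc n) * w) (G ^ Suc n) = g ^ Suc n"
      using top_at_power[OF tG s, of "Suc n"] by (simp_all only: top_at_def)
    have fP: "fil 1 s (of_nat (Suc n) * w) (P ^ m)" "cp s (of_nat (Suc n) * w) (P ^ m) = p ^ m"
      using top_at_power[OF tP s, of m] mn by (simp_all only: top_at_def mult.commute)
    have "fil 1 s (of_nat (Suc n) * w) G1" unfolding G1_def by (intro fil_minus fil_smul fG fP)
    moreover have "cp s (of_nat (Suc n) * w) G1 = 0" unfolding G1_def cp_simps fG fP c1(2) by simp
    ultimately obtain w1 g1 where w1: "w1 < of_nat (Suc n) * w" and tG1: "top_at s G1 w1 g1"
      using top_at_lower G1nz by metis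
    have G1: "G1 \<in> xspan (El l)"
      unfolding G1_def by (intro xspan_diff xspan_smul xspan_power exps_El Suc.prems(1) P)
    \<comment> \<open>\<open>(g^n \<kappa>)^(D (n + 1)) = (g^(n + 1))^(D n) (\<kappa>^D)^(n +
      1)\<close>, and both factors are constants times powers of \<open>p\<close>; this yields the
      new exponents.\<close>
    have pw: "smult (of_nat (Suc n)) (g ^ n * \<kappa>) ^ (D * Suc n)
       = smult (of_nat (Suc n) ^ (D * Suc n) * c1 ^ (D * n) * c ^ Suc n) (p ^ (m * D * n + H * Suc n))"
    proof -
      have "(g ^ n * \<kappa>) ^ (D * Suc n) = (g ^ Suc n) ^ (D * n) * (\<kappa> ^ D) ^ Suc n"
        by (simp only: power_mult_distrib power_mult[symmetric] mult_ac)
      also have "\<dots> = smult (c1 ^ (D * n) * c ^ Suc n) (p ^ (m * D * n + H * Suc n))"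
        unfolding c1(2) Suc.prems(6)
        by (simp only: smult_power mult_smult_left mult_smult_right smult_smult power_add power_mult[symmetric] mult_ac)
      finally show ?thesis by (simp only: smult_power smult_smult mult.assoc)
    qed
    have wt: "of_nat (D * Suc n) * (of_nat n * w + h) = of_nat (m * D * n + H * Suc n) * d"
    proof -
      have "of_nat (D * Suc n) * (of_nat n * w + h) = of_nat (D * n) * (w * of_nat (Suc n)) + of_nat (Suc n) * (of_nat D * h)"
        by (simp add: algebra_simps)
      also have "\<dots> = of_nat (m * D * n + H * Suc n) * d"
        unfolding mn Suc.prems(7) by (simp add: algebra_simps)
      finally show ?thesis .
    qed
    have cmspan: "cm P A \<in> xspan (El l)" if "A \<in> xspan (El l)" for A
      by (intro xspan_diff xspan_mult exps_El P that)
    let ?N = "of_nat (l * r) :: rat"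
    have Z: "?N * d \<in> \<int>" "?N * w \<in> \<int>" "?N * h \<in> \<int>" "?N * w1 \<in> \<int>" "?N * (of_nat n * w + h) \<in> \<int>"
      using top_weight_int[OF P tP r] top_weight_int[OF Suc.prems(1) tG r] top_weight_int[OF cmspan[OF Suc.prems(1)] tC r]
        top_weight_int[OF G1 tG1 r] top_weight_int[OF cmspan[OF G1] tC1 r] by simp_all
    have Zs: "?N * (1 + s) \<in> \<int>"
    proof -
      have "of_nat (l * r) + of_nat l * (of_nat r * s) \<in> \<int>" using Ints_mult[OF Ints_of_nat r] by (intro Ints_add) auto
      then show ?thesis by (simp add: algebra_simps)
    qed
    have "?N * (d + w1 - (1 + s) - (of_nat n * w + h)) < ?N * (d + w - (1 + s) - h)"
      using w1 l by (intro mult_strict_left_mono) (auto simp: algebra_simps)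
    moreover have "?N * (d + w1 - (1 + s) - (of_nat n * w + h)) \<in> \<int>"
      using Z Zs by (simp only: right_diff_distrib distrib_left[of ?N d w1] Ints_diff Ints_add)
    moreover have "?N * (d + w - (1 + s) - h) \<in> \<int>"
      using Z Zs by (simp only: right_diff_distrib distrib_left[of ?N d w] Ints_diff Ints_add)
    ultimately have "?N * (d + w1 - (1 + s) - (of_nat n * w + h)) \<le> ?N * (d + w - (1 + s) - h) - 1"
      using Ints_less_imp_le by blast
    then have small: "?N * (d + w1 - (1 + s) - (of_nat n * w + h)) < of_nat k"
      using Suc.prems(8) by simp
    have cnz: "of_nat (Suc n) ^ (D * Suc n) * c1 ^ (D * n) * c ^ Suc n \<noteq> 0"
      using c1(1) Suc.prems(5) by (simp del: of_nat_Suc)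
    show ?thesis
      by (rule Suc.IH[OF G1 tG1 tC1 _ cnz pw wt small]) (use Suc.prems(4) in simp)
  qed
qed

text \<open>The equation is graded by the class of the \<open>x\<close>-exponent modulo \<open>(1/l)\<int>\<close>, so the part of \<open>f\<close> with exponents in \<open>(1/l)\<int>\<close> is again a solution.\<close>

lemma ode_project:
  fixes p f :: "'k::field_char_0 poly"
  assumes ode: "br (1 + s) d p f = p" and p: "\<And>i. coeff p i \<noteq> 0 \<Longrightarrow> d - s * of_nat i \<in> El l"
  obtains f' where "br (1 + s) d p f' = p" "\<And>j. coeff f' j \<noteq> 0 \<Longrightarrow> 1 + s - s * of_nat j \<in> El l"
proof -
  define f' where "f' = (\<Sum>j\<le>degree f. if 1 + s - s * of_nat j \<in> El l then monom (coeff f j) j else 0)"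
  have cf': "coeff f' j = (if 1 + s - s * of_nat j \<in> El l then coeff f j else 0)" for j
  proof -
    have "coeff f' j = (\<Sum>i\<le>degree f. if i = j then (if 1 + s - s * of_nat j \<in> El l then coeff f j else 0) else 0)"
      unfolding f'_def coeff_sum by (rule sum.cong) auto
    then show ?thesis by (auto simp: coeff_eq_0)
  qed
  have "coeff (br (1 + s) d p f') i = coeff p i" for i
  proof -
    \<comment> \<open>In degree \<open>i\<close> the factor from \<open>p\<close> has its exponent
      in \<open>El l\<close>, so all contributing coefficients of \<open>f\<close> belong to the
      class determined by \<open>d - s i\<close>.\<close>
    have key: "1 + s - s * of_nat (Suc i - a) \<in> El l \<longleftrightarrow> d - s * of_nat i \<in> El l"
      if "coeff p a \<noteq> 0" "a \<le> Suc i" for a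
    proof -
      have a: "of_nat l * (d - s * of_nat a) \<in> \<int>" using p[OF that(1)] by (simp add: El_def)
      have e: "of_nat l * (1 + s - s * of_nat (Suc i - a)) = of_nat l + of_nat l * (d - s * of_nat i) - of_nat l * (d - s * of_nat a)"
        using that(2) by (simp add: of_nat_diff algebra_simps)
      show ?thesis
      proof
        assume "1 + s - s * of_nat (Suc i - a) \<in> El l"
        then have "of_nat l * (1 + s - s * of_nat (Suc i - a)) - of_nat l + of_nat l * (d - s * of_nat a) \<in> \<int>"
          using a by (intro Ints_add Ints_diff) (auto simp: El_def)
        then show "d - s * of_nat i \<in> El l" by (simp add: e El_def)
      next
        assume "d - s * of_nat i \<in> El l"
        then have "of_nat l + of_nat l * (d - s * of_nat i) - of_nat l * (d - s * of_nat a) \<in> \<int>"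
          using a by (intro Ints_add Ints_diff) (auto simp: El_def)
        then show "1 + s - s * of_nat (Suc i - a) \<in> El l" by (simp only: e[symmetric] El_def mem_Collect_eq)
      qed
    qed
    show ?thesis
    proof (cases "d - s * of_nat i \<in> El l")
      case True
      have "coeff (br (1 + s) d p f') i = coeff (br (1 + s) d p f) i"
        unfolding coeff_br
      proof (rule sum.cong[OF refl])
        fix a assume "a \<in> {..Suc i}"
        then show "(of_rat (1 + s) * of_nat a - of_rat d * of_nat (Suc i - a)) * coeff p a * coeff f' (Suc i - a) =
             (of_rat (1 + s) * of_nat a - of_rat d * of_nat (Suc i - a)) * coeff p a * coeff f (Suc i - a)"
          using key[of a] True by (cases "coeff p a = 0") (auto simp: cf')
      qed
      then show ?thesis by (simp add: ode)
    next
      case False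
      then have "coeff p i = 0" using p by blast
      moreover have "coeff (br (1 + s) d p f') i = 0"
        unfolding coeff_br
      proof (rule sum.neutral, rule ballI)
        fix a assume "a \<in> {..Suc i}"
        then show "(of_rat (1 + s) * of_nat a - of_rat d * of_nat (Suc i - a)) * coeff p a * coeff f' (Suc i - a) = 0"
          using key[of a] False by (cases "coeff p a = 0") (auto simp: cf')
      qed
      ultimately show ?thesis by simp
    qed
  qed
  then have "br (1 + s) d p f' = p" by (rule poly_eqI)
  then show ?thesis using that[of f'] cf' by metis
qed

lemma ode_exists:
  fixes P Q :: "'k::field_char_0 wa"
  assumes K: "alg_closed TYPE('k)" and s: "1 + s > 0" and P: "P \<in> xspan (El l)" and Q: "Q \<in> xspan (El l)"
    and tP: "top_at s P d p" and d: "d > 0" and dp: "degree p > 0" and l: "l > 0" and QP: "cm Q P = 1"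
  obtains f where "br (1 + s) d p f = p" "\<And>j. coeff f j \<noteq> 0 \<Longrightarrow> 1 + s - s * of_nat j \<in> El l"
proof -
  obtain a b where ab: "s = of_int a / of_int b" "b > 0"
    by (metis quotient_of_div quotient_of_denom_pos surj_pair)
  define r where "r = nat b"
  have r: "of_nat r * s \<in> \<int>" "r > 0" using ab by (simp_all add: r_def)
  have "Q \<noteq> 0" using QP by auto
  then obtain w g where tQ: "top_at s Q w g" using top_at_exists by metis
  have PQ: "cm P Q = smul (- 1) 1" using QP by (simp add: smul_simps algebra_simps)
  have tC: "top_at s (cm P Q) 0 [:- 1:]"
    unfolding PQ using top_at_smul[OF top_at_one, of "-1"] by simp
  obtain k where k: "of_nat (l * r) * (d + w - (1 + s) - 0) < (of_nat k :: rat)"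
    using reals_Archimedean2 by blast
  \<comment> \<open>\<open>[P, Q] = -1\<close> has weight 0 and polynomial \<open>-1\<close>, the
    zeroth power of \<open>p\<close> up to a constant: hence \<open>D = 1\<close>,
    \<open>c = -1\<close>, \<open>H = 0\<close>.\<close>
  have "\<exists>f. br (1 + s) d p f = p"
    by (rule gap_descent[OF K s P tP d dp r(1) l r(2) Q tQ tC, where D = 1 and c = "- 1" and H = 0, OF _ _ _ _ k]) auto
  then obtain f where "br (1 + s) d p f = p" by blast
  moreover have "d - s * of_nat i \<in> El l" if "coeff p i \<noteq> 0" for i
    using cp_nonzero_point[of s d P i] top_atD(2)[OF tP] that P by (auto simp: xspan_def)
  ultimately show ?thesis using ode_project that by metis
qed

section \<open>Corners and edges of the Newton polygon\<close>

lemma order_0_coeff: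
  fixes p :: "'k::field_char_0 poly"
  assumes "p \<noteq> 0"
  shows "coeff p (order 0 p) \<noteq> 0" "j < order 0 p \<Longrightarrow> coeff p j = 0"
proof -
  have "monom 1 (order 0 p) dvd p" "\<not> monom 1 (Suc (order 0 p)) dvd p"
    using monom_1_dvd_iff[OF assms] by auto
  then show "coeff p (order 0 p) \<noteq> 0" "j < order 0 p \<Longrightarrow> coeff p j = 0"
    unfolding monom_1_dvd_iff' by (auto simp: less_Suc_eq)
qed

lemma order_0_less_iff:
  fixes p :: "'k::field_char_0 poly"
  assumes "p \<noteq> 0"
  shows "order 0 p < b \<longleftrightarrow> (\<exists>j<b. coeff p j \<noteq> 0)"
proof
  assume "order 0 p < b"
  then show "\<exists>j<b. coeff p j \<noteq> 0" using order_0_coeff(1)[OF assms] by blast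
next
  assume "\<exists>j<b. coeff p j \<noteq> 0"
  then obtain j where "j < b" "coeff p j \<noteq> 0" by blast
  moreover from this have "\<not> j < order 0 p" using order_0_coeff(2)[OF assms] by blast
  ultimately show "order 0 p < b" by simp
qed

lemma order_pcompose_shift:
  fixes p :: "'k::field_char_0 poly"
  assumes "p \<noteq> 0"
  shows "order 0 (pcompose p [:\<alpha>, 1:]) = order \<alpha> p"
proof -
  obtain p1 where p1: "p = [:-\<alpha>, 1:] ^ order \<alpha> p * p1" "\<not> [:-\<alpha>, 1:] dvd p1"
    using order_decomp[OF assms, of \<alpha>] by auto
  have "poly p1 \<alpha> \<noteq> 0" using p1(2) by (simp add: poly_eq_0_iff_dvd)
  define r where "r = pcompose p1 [:\<alpha>, 1:]"
  have r: "poly r 0 \<noteq> 0" using \<open>poly p1 \<alpha> \<noteq> 0\<close> by (simp add: r_def poly_pcompose)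
  have "pcompose p [:\<alpha>, 1:] = [:0, 1:] ^ order \<alpha> p * r"
    by (subst p1(1)) (simp add: pcompose_mult pcompose_power_left pcompose_pCons r_def)
  moreover have "order 0 ([:0, 1:] ^ order \<alpha> p * r) = order \<alpha> p"
    using r order_power_n_n[of 0 "order \<alpha> p"] by (subst order_mult) (auto simp: order_0I)
  ultimately show ?thesis by simp
qed

lemma degree_pcompose_shift: "degree (pcompose p [:\<alpha>, 1:]) = degree (p :: 'k::field_char_0 poly)"
  by (simp add: degree_pcompose)

text \<open>The slopes at which a point of the support below the corner \<open>(a, b)\<close> gets the same weight as the corner.\<close>

definition crit :: "rat \<Rightarrow> nat \<Rightarrow> 'k::field_char_0 wa \<Rightarrow> rat set" where
  "crit a b P = (\<lambda>x. (fst x - a) / (of_nat b - of_nat (snd x))) ` {x \<in> supp P. snd x < b}"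

lemma finite_crit: "finite (crit a b P)"
  by (simp add: crit_def)

text \<open>The corner is the lower end of the edge, so support points with smaller second
  coordinate lie strictly below the supporting line and meet it only after the slope has
  decreased.\<close>

lemma crit_less:
  fixes P :: "'k::field_char_0 wa"
  assumes "top_at s P d p" "c \<in> crit (d - s * of_nat (order 0 p)) (order 0 p) P"
  shows "c < s"
proof -
  let ?b = "order 0 p"
  obtain x where x: "x \<in> supp P" "snd x < ?b" "c = (fst x - (d - s * of_nat ?b)) / (of_nat ?b - of_nat (snd x))"
    using assms(2) by (auto simp: crit_def)
  have p: "p \<noteq> 0" using assms(1) by (auto simp: top_at_def)
  have "fst x + s * of_nat (snd x) \<le> d" using assms(1) x(1) by (auto simp: top_at_def fil_def)
  moreover have "fst x + s * of_nat (snd x) \<noteq> d"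
  proof
    assume "fst x + s * of_nat (snd x) = d"
    then have "coeff p (snd x) = cf P x" using top_atD(2)[OF assms(1)] by (metis add_diff_cancel_right' coeff_cp prod.collapse)
    then show False using order_0_coeff(2)[OF p x(2)] x(1) by (simp add: in_supp)
  qed
  ultimately have "fst x - (d - s * of_nat ?b) < s * (of_nat ?b - of_nat (snd x))" by (simp add: algebra_simps)
  then show ?thesis using x(2,3) by (simp add: pos_divide_less_eq)
qed

text \<open>The supporting line turns about the corner from slope \<open>s\<close> down to
  \<open>t\<close>. Points above height \<open>b\<close> lose weight against the corner, and points
  below it do not overtake, since no critical slope exceeds \<open>t\<close>. So the corner becomes
  the upper end, with a second point exactly when \<open>t\<close> is critical.\<close>

lemma corner_edge:
  fixes P :: "'k::field_char_0 wa"
  assumes tP: "top_at s P d p" and b: "b = order 0 p" and a: "a = d - s * of_nat b"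
    and t: "t < s" "\<And>c. c \<in> crit a b P \<Longrightarrow> c \<le> t"
  shows "top_at t P (a + t * of_nat b) (cp t (a + t * of_nat b) P)"
    and "degree (cp t (a + t * of_nat b) P) = b"
    and "order 0 (cp t (a + t * of_nat b) P) < b \<longleftrightarrow> t \<in> crit a b P"
proof -
  let ?p = "cp t (a + t * of_nat b) P"
  have p: "p \<noteq> 0" using tP by (auto simp: top_at_def)
  have up: "fst x + t * of_nat (snd x) \<le> a + t * of_nat b - (s - t) * (of_nat (snd x) - of_nat b)" if "x \<in> supp P" for x
  proof -
    have "fst x + s * of_nat (snd x) \<le> d" using tP that by (auto simp: top_at_def fil_def)
    then show ?thesis by (simp add: a algebra_simps)
  qed
  have f: "fst x + t * of_nat (snd x) \<le> a + t * of_nat b" if x: "x \<in> supp P" for x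
  proof (cases "snd x < b")
    case True
    then have "(fst x - a) / (of_nat b - of_nat (snd x)) \<le> t" using x t(2) by (auto simp: crit_def)
    then have "fst x - a \<le> t * (of_nat b - of_nat (snd x))" using True by (simp add: pos_divide_le_eq)
    then show ?thesis by (simp add: algebra_simps)
  next
    case False
    then have "(s - t) * (of_nat (snd x) - of_nat b) \<ge> 0" using t(1) by simp
    then show ?thesis using up[OF x] by linarith
  qed
  have cb: "coeff ?p b \<noteq> 0"
  proof -
    have "coeff ?p b = coeff p b" using top_atD(2)[OF tP] a by (metis add_diff_cancel_right' coeff_cp)
    then show ?thesis using order_0_coeff(1)[OF p] b by simp
  qed
  then have nz: "?p \<noteq> 0" by (metis coeff_0)
  show "top_at t P (a + t * of_nat b) ?p" using nz f by (auto simp: top_at_def fil_def)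
  have "coeff ?p j = 0" if "j > b" for j
  proof (rule ccontr)
    assume "coeff ?p j \<noteq> 0"
    then have "(a + t * of_nat b - t * of_nat j, j) \<in> supp P" by (rule cp_nonzero_point)
    from up[OF this] have "(s - t) * (of_nat j - of_nat b) \<le> 0" by simp
    moreover have "(s - t) * (of_nat j - of_nat b) > 0" using t(1) that by simp
    ultimately show False by linarith
  qed
  then have "degree ?p \<le> b" by (intro degree_le) auto
  then show "degree ?p = b" using le_degree[OF cb] by simp
  show "order 0 ?p < b \<longleftrightarrow> t \<in> crit a b P"
    unfolding order_0_less_iff[OF nz]
  proof
    assume "\<exists>j<b. coeff ?p j \<noteq> 0"
    then obtain j where j: "j < b" "coeff ?p j \<noteq> 0" by blast
    then have "(a + t * of_nat b - t * of_nat j, j) \<in> supp P" by (intro cp_nonzero_point)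
    moreover have "t = (a + t * of_nat b - t * of_nat j - a) / (of_nat b - of_nat j)"
      using j(1) by (simp add: field_simps)
    ultimately show "t \<in> crit a b P" unfolding crit_def using j(1) by force
  next
    assume "t \<in> crit a b P"
    then obtain x where x: "x \<in> supp P" "snd x < b" "t = (fst x - a) / (of_nat b - of_nat (snd x))"
      by (auto simp: crit_def)
    then have "fst x = a + t * of_nat b - t * of_nat (snd x)" by (simp add: field_simps)
    then have "coeff ?p (snd x) = cf P x" by (metis coeff_cp prod.collapse)
    then show "\<exists>j<b. coeff ?p j \<noteq> 0" using x by (metis in_supp)
  qed
qed

section \<open>Consequences of \<open>[Q, P] = 1\<close> and the next edge\<close>

lemma cp_one_other: "D \<noteq> 0 \<Longrightarrow> cp s D 1 = 0"
  by (simp add: one_wa_def cp_mon)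

lemma bracket_one_order:
  fixes p q :: "'k::field_char_0 poly"
  assumes "br d e q p = 1"
  shows "order 0 p + order 0 q \<le> 1"
proof -
  have nz: "p \<noteq> 0" "q \<noteq> 0" using assms by (auto simp: br_lin)
  show ?thesis
  proof (cases "d * of_nat (order 0 q) = e * of_nat (order 0 p)")
    case True
    then show ?thesis using order_br_ge[OF nz(2,1) _ True] assms by simp
  next
    case False
    then show ?thesis using order_br(2)[OF nz(2,1) False] assms by simp
  qed
qed

lemma weight_sum_ge:
  fixes P Q :: "'k::field_char_0 wa"
  assumes "cm Q P = 1" "1 + s > 0" "fil 1 s d P" "fil 1 s e Q"
  shows "1 + s \<le> d + e"
proof -
  have "fil 1 s (e + d - (1 + s)) (1 :: 'k wa)" using fil_comm[OF assms(4,3,2)] assms(1) by simp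
  then show ?thesis by (simp add: one_wa_def fil_mon)
qed

text \<open>The bracket polynomial is the component of \<open>1\<close> at weight
  \<open>d + e - (1 + s)\<close>, and \<open>1\<close> lives in weight 0 only. The second
  alternative is where a chain ends.\<close>

lemma bracket_cases:
  fixes P Q :: "'k::field_char_0 wa"
  assumes QP: "cm Q P = 1" and s: "1 + s > 0" and tP: "top_at s P d p" and tQ: "top_at s Q e q"
  shows "1 + s < d + e \<and> br d e q p = 0 \<or> d + e = 1 + s \<and> br d e q p = 1"
proof -
  have c: "cp s (e + d - (1 + s)) (1 :: 'k wa) = br d e q p"
    using cp_comm[OF top_atD(1)[OF tQ] top_atD(1)[OF tP] s] top_atD(2)[OF tP] top_atD(2)[OF tQ] QP by simp
  have "1 + s \<le> d + e" by (rule weight_sum_ge[OF QP s top_atD(1)[OF tP] top_atD(1)[OF tQ]])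
  then show ?thesis
  proof (cases "d + e = 1 + s")
    case True
    then have "e + d - (1 + s) = 0" by (simp only: add.commute[of e d] right_minus_eq)
    then have "br d e q p = cp s 0 (1 :: 'k wa)" using c by metis
    then have "br d e q p = 1" by simp
    then show ?thesis using True by blast
  next
    case False
    then have "e + d - (1 + s) \<noteq> 0" by (simp only: add.commute[of e d] right_minus_eq not_False_eq_True)
    then have "br d e q p = 0" using c cp_one_other by metis
    moreover have "1 + s < d + e" using False \<open>1 + s \<le> d + e\<close> by (metis order_le_less)
    ultimately show ?thesis by blast
  qed
qed

lemma ratio_nat:
  fixes d e :: rat
  assumes "of_nat m * e = of_nat n * d" "d > 0" "d * of_nat x = e * of_nat y"
  shows "m * x = n * y"
proof -
  have "d * of_nat (m * x) = of_nat m * (d * of_nat x)" by (simp add: algebra_simps)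
  also have "\<dots> = (of_nat m * e) * of_nat y" unfolding assms(3) by (simp add: algebra_simps)
  also have "\<dots> = d * of_nat (n * y)" unfolding assms(1) by (simp add: algebra_simps)
  finally show ?thesis using assms(2) by (metis less_irrefl mult_left_cancel of_nat_eq_iff)
qed

lemma next_edge:
  fixes P Q :: "'k::field_char_0 wa" and m n :: nat
  assumes mn: "m > 1" "n > 1" "coprime m n"
    and QP: "cm Q P = 1" and s: "1 + s > 0" and tP: "top_at s P d p" and tQ: "top_at s Q e q"
    and d: "d > 0" and de: "of_nat m * e = of_nat n * d" and ord: "m * order 0 q = n * order 0 p"
    and big: "(1 + s) * of_nat (order 0 p) > d"
  obtains s' d' e' p' q' where "s' < s" "1 + s' > 0" "top_at s' P d' p'" "top_at s' Q e' q'" "d' > 0"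
    "of_nat m * e' = of_nat n * d'" "degree p' = order 0 p" "degree q' = order 0 q"
    "d' - s' * of_nat (order 0 p) = d - s * of_nat (order 0 p)" "order 0 p' < degree p'" "order 0 q' < degree q'"
    "(1 + s') * of_nat (degree p') > d'"
proof -
  define b b2 where "b = order 0 p" and "b2 = order 0 q"
  define a a2 where "a = d - s * of_nat b" and "a2 = e - s * of_nat b2"
  have mb: "m * b2 = n * b" using ord by (simp add: b_def b2_def)
  have "b > 0" using big d by (intro gr0I) (auto simp: b_def)
  then have b2pos: "b2 > 0" using mb mn by (intro gr0I) auto
  \<comment> \<open>Coprimality makes \<open>m\<close> divide \<open>b\<close> and \<open>n\<close>
    divide \<open>b2\<close>, so both are at least 2; a multiplicity of at most 1 at zero is then
    below the degree.\<close>
  have "m dvd n * b" using mb by (metis dvd_triv_left)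
  then have "m dvd b" using mn(3) by (simp add: coprime_dvd_mult_right_iff)
  then have b2: "b \<ge> 2" using \<open>b > 0\<close> mn(1) dvd_imp_le[of m b] by simp
  have "n dvd m * b2" using mb by (metis dvd_triv_left)
  then have "n dvd b2" using mn(3) by (metis coprime_commute coprime_dvd_mult_right_iff)
  then have b22: "b2 \<ge> 2" using b2pos mn(2) dvd_imp_le[of n b2] by simp
  have mbr: "(of_nat m :: rat) * of_nat b2 = of_nat n * of_nat b" using mb by (metis of_nat_mult)
  have ma: "of_nat m * a2 = of_nat n * a"
  proof -
    have "of_nat m * a2 = of_nat m * e - s * (of_nat m * of_nat b2)" by (simp add: a2_def algebra_simps)
    also have "\<dots> = of_nat n * a" unfolding mbr de by (simp add: a_def algebra_simps)
    finally show ?thesis .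
  qed
  have ab: "a < of_nat b" using big by (simp add: a_def b_def algebra_simps)
  \<comment> \<open>The slope at which the corner of \<open>P\<close>, and by proportionality that
    of \<open>Q\<close>, has weight 0; \<open>a < b\<close> keeps it above -1.\<close>
  define t0 where "t0 = - a / of_nat b"
  have t0: "a + t0 * of_nat b = 0" using \<open>b > 0\<close> by (simp add: t0_def)
  have t02: "a2 + t0 * of_nat b2 = 0"
  proof -
    have "of_nat m * (a2 + t0 * of_nat b2) = of_nat m * a2 + t0 * (of_nat m * of_nat b2)" by (simp add: algebra_simps)
    also have "\<dots> = of_nat n * (a + t0 * of_nat b)" unfolding ma mbr by (simp add: algebra_simps)
    finally show ?thesis using t0 mn(1) by simp
  qed
  have t0s: "t0 < s" using d \<open>b > 0\<close> by (simp add: t0_def a_def field_simps)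
  have t01: "1 + t0 > 0" using ab \<open>b > 0\<close> by (simp add: t0_def field_simps)
  \<comment> \<open>Critical slopes of both elements are taken together, so that \<open>P\<close>
    and \<open>Q\<close> keep a common direction.\<close>
  define C where "C = crit a b P \<union> crit a2 b2 Q"
  have finC: "finite C" by (simp add: C_def finite_crit)
  have "\<exists>c\<in>C. c > t0"
  proof (rule ccontr)
    assume "\<not> ?thesis"
    then have "c \<le> t0" if "c \<in> C" for c using that by force
    then have c: "\<And>c. c \<in> crit a b P \<Longrightarrow> c \<le> t0" "\<And>c. c \<in> crit a2 b2 Q \<Longrightarrow> c \<le> t0" by (auto simp: C_def)
    have "fil 1 t0 0 P" using top_atD(1)[OF corner_edge(1)[OF tP b_def a_def t0s c(1)]] t0 by simp
    moreover have "fil 1 t0 0 Q" using top_atD(1)[OF corner_edge(1)[OF tQ b2_def a2_def t0s c(2)]] t02 by simp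
    ultimately show False using weight_sum_ge[OF QP t01] t01 by force
  qed
  define t where "t = Max C"
  have tC: "t \<in> C" unfolding t_def using finC \<open>\<exists>c\<in>C. c > t0\<close> by (intro Max_in) auto
  have tmax: "c \<le> t" if "c \<in> C" for c unfolding t_def using finC that by simp
  have tt0: "t > t0" using \<open>\<exists>c\<in>C. c > t0\<close> tmax by force
  have ts: "t < s"
    using tC crit_less[OF tP] crit_less[OF tQ] by (auto simp: C_def a_def a2_def b_def b2_def)
  have c: "\<And>c. c \<in> crit a b P \<Longrightarrow> c \<le> t" "\<And>c. c \<in> crit a2 b2 Q \<Longrightarrow> c \<le> t" using tmax by (auto simp: C_def)
  define d' e' where "d' = a + t * of_nat b" and "e' = a2 + t * of_nat b2"
  define p' q' where "p' = cp t d' P" and "q' = cp t e' Q"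
  note eP = corner_edge[OF tP b_def a_def ts c(1), folded d'_def, folded p'_def]
  note eQ = corner_edge[OF tQ b2_def a2_def ts c(2), folded e'_def, folded q'_def]
  have t1: "1 + t > 0" using t01 tt0 by simp
  have d': "d' > 0"
  proof -
    have "t * of_nat b > t0 * of_nat b" using tt0 \<open>b > 0\<close> by simp
    then show ?thesis using t0 by (simp add: d'_def)
  qed
  have de': "of_nat m * e' = of_nat n * d'"
  proof -
    have "of_nat m * e' = of_nat m * a2 + t * (of_nat m * of_nat b2)" by (simp add: e'_def algebra_simps)
    also have "\<dots> = of_nat n * d'" unfolding ma mbr by (simp add: d'_def algebra_simps)
    finally show ?thesis .
  qed
  have nz: "p' \<noteq> 0" "q' \<noteq> 0" using eP(1) eQ(1) by (auto simp: top_at_def)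
  have some: "order 0 p' < b \<or> order 0 q' < b2" using tC eP(3) eQ(3) by (auto simp: C_def)
  have le: "order 0 p' \<le> b" "order 0 q' \<le> b2" using order_degree[OF nz(1), of 0] order_degree[OF nz(2), of 0] eP(2) eQ(2) by auto
  \<comment> \<open>The maximal critical slope gives a second point for at least one element. If the
    leading forms commute, their multiplicities at 0 are proportional and the other follows; a
    bracket equal to 1 bounds both multiplicities by 1.\<close>
  have "order 0 p' < b \<and> order 0 q' < b2"
    using bracket_cases[OF QP t1 eP(1) eQ(1)]
  proof
    assume "1 + t < d' + e' \<and> br d' e' q' p' = 0"
    then have "d' * of_nat (order 0 q') = e' * of_nat (order 0 p')"
      using br_zero_order[OF nz(2,1)] by blast
    then have eq: "m * order 0 q' = n * order 0 p'" by (rule ratio_nat[OF de' d'])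
    have "m * order 0 q' < m * b2 \<longleftrightarrow> n * order 0 p' < n * b" unfolding eq mb ..
    then have "order 0 q' < b2 \<longleftrightarrow> order 0 p' < b" using mn by simp
    then show ?thesis using some by simp
  next
    assume "d' + e' = 1 + t \<and> br d' e' q' p' = 1"
    then have "order 0 p' + order 0 q' \<le> 1" using bracket_one_order by blast
    then show ?thesis using b2 b22 by linarith
  qed
  moreover have "(1 + t) * of_nat b > d'" using ab by (simp add: d'_def algebra_simps)
  moreover have "d' - t * of_nat b = d - s * of_nat b" by (simp add: d'_def a_def)
  ultimately show ?thesis
    using that[OF ts t1 eP(1) eQ(1) d' de'] eP(2) eQ(2) by (simp add: b_def b2_def)
qed

text \<open>The last inequality says that the upper end \<open>(d - s * degree p, degree p)\<close>
  lies strictly above the diagonal; the conditions on \<open>order 0\<close> say that both edges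
  have at least two points.\<close>

definition edge :: "nat \<Rightarrow> nat \<Rightarrow> nat \<Rightarrow> 'k::field_char_0 wa \<Rightarrow> 'k wa \<Rightarrow> rat \<Rightarrow> rat \<Rightarrow> rat \<Rightarrow> 'k poly \<Rightarrow> 'k poly \<Rightarrow> bool" where
  "edge m n l P Q s d e p q \<longleftrightarrow> l > 0 \<and> P \<in> xspan (El l) \<and> Q \<in> xspan (El l) \<and> cm Q P = 1 \<and> 1 + s > 0
     \<and> top_at s P d p \<and> top_at s Q e q \<and> d > 0 \<and> of_nat m * e = of_nat n * d
     \<and> m * degree q = n * degree p \<and> order 0 p < degree p \<and> order 0 q < degree q
     \<and> (1 + s) * of_nat (degree p) > d"

text \<open>A root carrying the full degree qualifies by the last condition of \<open>edge\<close>.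
  Otherwise \<open>degree f \<ge> 2\<close> by \<open>ode_single\<close>, and
  \<open>ode_big_root\<close> supplies a root.\<close>

lemma root_choice:
  fixes P Q :: "'k::field_char_0 wa"
  assumes K: "alg_closed TYPE('k)" and E: "edge m n l P Q s d e p q"
  obtains f \<alpha> where "br (1 + s) d p f = p" "\<And>j. coeff f j \<noteq> 0 \<Longrightarrow> 1 + s - s * of_nat j \<in> El l"
    "poly p \<alpha> = 0" "(1 + s) * of_nat (order \<alpha> p) > d"
    "(\<exists>\<beta>. order \<beta> p = degree p) \<Longrightarrow> order \<alpha> p = degree p" "degree f = 1 \<Longrightarrow> order \<alpha> p = degree p"
proof -
  have h: "l > 0" "P \<in> xspan (El l)" "Q \<in> xspan (El l)" "cm Q P = 1" "1 + s > 0" "top_at s P d p" "d > 0"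
      "order 0 p < degree p" "(1 + s) * of_nat (degree p) > d"
    using E by (auto simp: edge_def)
  have p: "p \<noteq> 0" using h(6) by (auto simp: top_at_def)
  have dp: "degree p > 0" using h(8) by simp
  obtain f where f: "br (1 + s) d p f = p" "\<And>j. coeff f j \<noteq> 0 \<Longrightarrow> 1 + s - s * of_nat j \<in> El l"
    using ode_exists[OF K h(5,2,3,6,7) dp h(1,4)] by metis
  have single: "\<exists>\<beta>. order \<beta> p = degree p" if "degree f = 1"
    using ode_single[OF f(1) p h(5,7) K that] by metis
  show ?thesis
  proof (cases "\<exists>\<beta>. order \<beta> p = degree p")
    case True
    then obtain \<beta> where \<beta>: "order \<beta> p = degree p" by blast
    then have "poly p \<beta> = 0" using dp p by (simp add: order_root)
    then show ?thesis using that[OF f, of \<beta>] \<beta> h(9) by simp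
  next
    case False
    then have "degree f \<ge> 2" using single ode_degree_ge[OF f(1) p h(5,7)] by (cases "degree f = 1") auto
    then obtain \<alpha> where "poly p \<alpha> = 0" "(1 + s) * of_nat (order \<alpha> p) > d"
      using ode_big_root[OF f(1) p h(5,7) K] by blast
    then show ?thesis using that[OF f, of \<alpha>] False single by blast
  qed
qed

text \<open>One translation serves both elements: the leading forms commute, so the multiplicities
  of \<open>\<alpha>\<close> in \<open>p\<close> and \<open>q\<close> are in the ratio
  \<open>m : n\<close>.\<close>

lemma edge_translate:
  fixes P Q :: "'k::field_char_0 wa"
  assumes mn: "m > 1" "n > 1" "coprime m n" and E: "edge m n l P Q s d e p q" and b: "1 + s < d + e"
    and \<alpha>: "(1 + s) * of_nat (order \<alpha> p) > d"
    and l': "l' > 0" "tr s \<alpha> P \<in> xspan (El l')" "tr s \<alpha> Q \<in> xspan (El l')"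
  obtains s' d' e' p' q' where "s' < s" "edge m n l' (tr s \<alpha> P) (tr s \<alpha> Q) s' d' e' p' q'"
    "degree p' = order \<alpha> p" "d' - s' * of_nat (order \<alpha> p) = d - s * of_nat (order \<alpha> p)"
proof -
  have h: "cm Q P = 1" "1 + s > 0" "top_at s P d p" "top_at s Q e q" "d > 0" "of_nat m * e = of_nat n * d"
    using E by (auto simp: edge_def)
  have nz: "p \<noteq> 0" "q \<noteq> 0" using h by (auto simp: top_at_def)
  have "br d e q p = 0" using bracket_cases[OF h(1-4)] b by simp
  then have "m * order \<alpha> q = n * order \<alpha> p"
    using ratio_nat[OF h(6,5)] br_zero_order[OF nz(2,1)] by blast
  then have ord: "m * order 0 (pcompose q [:\<alpha>, 1:]) = n * order 0 (pcompose p [:\<alpha>, 1:])"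
    by (simp add: order_pcompose_shift nz)
  have QP': "cm (tr s \<alpha> Q) (tr s \<alpha> P) = 1" unfolding tr_comm h(1) by simp
  have big: "(1 + s) * of_nat (order 0 (pcompose p [:\<alpha>, 1:])) > d" using \<alpha> nz by (simp add: order_pcompose_shift)
  obtain s' d' e' p' q' where ne: "s' < s" "1 + s' > 0" "top_at s' (tr s \<alpha> P) d' p'" "top_at s' (tr s \<alpha> Q) e' q'" "d' > 0"
    "of_nat m * e' = of_nat n * d'" "degree p' = order 0 (pcompose p [:\<alpha>, 1:])" "degree q' = order 0 (pcompose q [:\<alpha>, 1:])"
    "d' - s' * of_nat (order 0 (pcompose p [:\<alpha>, 1:])) = d - s * of_nat (order 0 (pcompose p [:\<alpha>, 1:]))"
    "order 0 p' < degree p'" "order 0 q' < degree q'" "(1 + s') * of_nat (degree p') > d'"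
    using next_edge[OF mn QP' h(2) top_at_tr[OF h(2,3)] top_at_tr[OF h(2,4)] h(5,6) ord big] by metis
  have "edge m n l' (tr s \<alpha> P) (tr s \<alpha> Q) s' d' e' p' q'"
    unfolding edge_def using ne l' QP' ord by simp
  then show ?thesis using that ne(1,7,9) nz by (simp add: order_pcompose_shift)
qed

text \<open>\<open>p = c (y - \<alpha>)^(k + 1)\<close> with \<open>\<alpha> \<noteq> 0\<close> has
  nonzero coefficients in degrees \<open>k\<close> and \<open>k + 1\<close>, so two support points
  have \<open>X\<close>-exponents that differ by \<open>s\<close>.\<close>

lemma single_root_slope:
  fixes P :: "'k::field_char_0 wa"
  assumes tP: "top_at s P d p" and P: "P \<in> xspan (El l)" and \<alpha>: "order \<alpha> p = degree p" "\<alpha> \<noteq> 0" and dp: "degree p > 0"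
  shows "s \<in> El l"
proof -
  have p: "p \<noteq> 0" using tP by (auto simp: top_at_def)
  obtain p1 where p1: "p = [:-\<alpha>, 1:] ^ degree p * p1" "\<not> [:-\<alpha>, 1:] dvd p1"
    using order_decomp[OF p, of \<alpha>] \<alpha>(1) by auto
  have "p1 \<noteq> 0" using p1(2) by auto
  have "degree p = degree ([:-\<alpha>, 1:] ^ degree p) + degree p1"
    by (subst p1(1), subst degree_mult_eq) (use \<open>p1 \<noteq> 0\<close> in auto)
  then have "degree p1 = 0" by (simp add: degree_power_eq)
  then obtain c where c: "p1 = [:c:]" by (metis degree_eq_zeroE)
  then have c0: "c \<noteq> 0" using \<open>p1 \<noteq> 0\<close> by auto
  obtain k where k: "degree p = Suc k" using dp by (cases "degree p") auto
  have pe: "p = smult c ([:-\<alpha>, 1:] ^ Suc k)" using p1(1) c k by simp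
  have "coeff p k = c * (of_nat (Suc k choose k) * 1 ^ k * (- \<alpha>) ^ (Suc k - k))"
    by (subst pe) (simp only: coeff_smult coeff_linear_poly_power)
  then have "coeff p k \<noteq> 0" using c0 \<alpha>(2) by (simp add: binomial_Suc_n del: of_nat_Suc)
  moreover have "coeff p (Suc k) \<noteq> 0" using p k by (metis leading_coeff_neq_0)
  ultimately have "d - s * of_nat k \<in> El l" "d - s * of_nat (Suc k) \<in> El l"
    using P cp_nonzero_point[of s d P, unfolded top_atD(2)[OF tP]] unfolding xspan_def by fastforce+
  then have "of_nat l * (d - s * of_nat k) - of_nat l * (d - s * of_nat (Suc k)) \<in> \<int>"
    by (intro Ints_diff) (auto simp: El_def)
  then show ?thesis by (simp add: El_def algebra_simps)
qed

section \<open>Chains of edges\<close>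

text \<open>The primitive direction of slope \<open>s\<close> is
  \<open>(den s, num s)\<close>.\<close>

abbreviation den :: "rat \<Rightarrow> int" where "den s \<equiv> snd (quotient_of s)"
abbreviation num :: "rat \<Rightarrow> int" where "num s \<equiv> fst (quotient_of s)"

lemma den_pos: "den s > 0"
  by (metis quotient_of_denom_pos prod.collapse)

lemma num_den: "of_int (num s) = s * of_int (den s)"
proof -
  have "s = of_int (num s) / of_int (den s)" by (metis quotient_of_div prod.collapse)
  then show ?thesis using den_pos[of s] by (metis divide_eq_eq less_irrefl of_int_0_eq_iff)
qed

lemma num_den_coprime: "coprime (num s) (den s)"
  by (metis quotient_of_coprime prod.collapse)

lemma El_den:
  assumes "s \<in> El l"
  shows "den s dvd int l"
proof -
  obtain k where k: "of_nat l * s = of_int k" using assms by (auto simp: El_def elim: Ints_cases)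
  have "of_int (int l * num s) = (of_nat l * s) * (of_int (den s) :: rat)" by (simp add: num_den mult.assoc)
  also have "\<dots> = of_int (k * den s)" by (simp add: k)
  finally have "int l * num s = k * den s" by (simp only: of_int_eq_iff)
  then have "den s dvd int l * num s" by simp
  then show ?thesis using num_den_coprime[of s] by (simp add: coprime_commute coprime_dvd_mult_left_iff)
qed

lemma den_El:
  assumes "den s dvd int l"
  shows "s \<in> El l"
proof -
  obtain k where k: "int l = den s * k" using assms by (auto elim: dvdE)
  have "of_nat l * s = of_int (int l) * s" by simp
  also have "\<dots> = of_int (k * num s)" unfolding k by (simp add: num_den mult_ac)
  finally show ?thesis by (simp add: El_def)
qed

lemma El_mono: "l dvd l' \<Longrightarrow> El l \<subseteq> El l'"
proof
  fix a assume "l dvd l'" "a \<in> El l"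
  then obtain k where "l' = l * k" and "of_nat l * a \<in> \<int>" by (auto simp: El_def elim: dvdE)
  then have "of_nat k * (of_nat l * a) \<in> \<int>" using Ints_mult[OF Ints_of_nat] by blast
  then show "a \<in> El l'" using \<open>l' = l * k\<close> by (simp add: El_def mult_ac)
qed

lemma xspan_mono: "E \<subseteq> E' \<Longrightarrow> P \<in> xspan E \<Longrightarrow> P \<in> xspan E'"
  by (auto simp: xspan_def)

text \<open>The equations for \<open>degree p'\<close> and \<open>d'\<close> say together that the
  upper end of the new edge is the lower end of the translated old one. If
  \<open>degree f = 1\<close>, the translated old edge collapses to its upper end.\<close>

definition stp :: "nat \<Rightarrow> nat \<Rightarrow> nat \<Rightarrow> 'k::field_char_0 wa \<Rightarrow> 'k wa \<Rightarrow> rat \<Rightarrow> 'k \<Rightarrow> nat \<Rightarrow> 'k wa \<Rightarrow> 'k wa \<Rightarrow> rat \<Rightarrow> bool" where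
  "stp m n l P Q s \<alpha> l' P' Q' s' \<longleftrightarrow> (\<exists>d e p q d' e' p' q' f.
     edge m n l P Q s d e p q \<and> 1 + s < d + e \<and> edge m n l' P' Q' s' d' e' p' q'
     \<and> int l' = lcm (int l) (den s) \<and> P' = tr s \<alpha> P \<and> Q' = tr s \<alpha> Q \<and> s' < s
     \<and> degree p' = order \<alpha> p \<and> d' - s' * of_nat (order \<alpha> p) = d - s * of_nat (order \<alpha> p)
     \<and> br (1 + s) d p f = p \<and> (\<forall>j. coeff f j \<noteq> 0 \<longrightarrow> 1 + s - s * of_nat j \<in> El l)
     \<and> (degree f = 1 \<longrightarrow> order \<alpha> p = degree p))"

text \<open>The last conclusion serves termination. If \<open>order \<alpha> p = degree p\<close>,
  then \<open>\<alpha> \<noteq> 0\<close> because the edge has two points, so \<open>s\<close> lies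
  in (1/l)Z and the lcm leaves \<open>l\<close> unchanged.\<close>

lemma step_exists:
  fixes P Q :: "'k::field_char_0 wa"
  assumes K: "alg_closed TYPE('k)" and mn: "m > 1" "n > 1" "coprime m n"
    and E: "edge m n l P Q s d e p q" and b: "1 + s < d + e"
  obtains \<alpha> l' P' Q' s' d' e' p' q' where "stp m n l P Q s \<alpha> l' P' Q' s'" "edge m n l' P' Q' s' d' e' p' q'"
    "degree p' < degree p \<or> degree p' = degree p \<and> l' = l \<and> s \<in> El l \<and> s' < s
        \<and> d' - s' * of_nat (degree p) = d - s * of_nat (degree p)"
proof -
  obtain f \<alpha> where f: "br (1 + s) d p f = p" "\<And>j. coeff f j \<noteq> 0 \<Longrightarrow> 1 + s - s * of_nat j \<in> El l"
    and \<alpha>: "poly p \<alpha> = 0" "(1 + s) * of_nat (order \<alpha> p) > d"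
    "(\<exists>\<beta>. order \<beta> p = degree p) \<Longrightarrow> order \<alpha> p = degree p" "degree f = 1 \<Longrightarrow> order \<alpha> p = degree p"
    using root_choice[OF K E] by metis
  have h: "l > 0" "P \<in> xspan (El l)" "Q \<in> xspan (El l)" "top_at s P d p" "order 0 p < degree p"
    using E by (auto simp: edge_def)
  have p: "p \<noteq> 0" using h(4) by (auto simp: top_at_def)
  define l' where "l' = nat (lcm (int l) (den s))"
  have il': "int l' = lcm (int l) (den s)" by (simp add: l'_def)
  have "l' > 0" using h(1) den_pos[of s] il' by (metis lcm_pos_int less_irrefl of_nat_0_less_iff)
  have "int l dvd int l'" using il' by simp
  then have El: "El l \<subseteq> El l'" by (intro El_mono) simp
  have sl': "s \<in> El l'" by (rule den_El) (simp add: il')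
  have PQ': "tr s \<alpha> P \<in> xspan (El l')" "tr s \<alpha> Q \<in> xspan (El l')"
    using tr_xspan[OF exps_El sl'] xspan_mono[OF El] h(2,3) by blast+
  obtain s' d' e' p' q' where e': "s' < s" "edge m n l' (tr s \<alpha> P) (tr s \<alpha> Q) s' d' e' p' q'"
    "degree p' = order \<alpha> p" "d' - s' * of_nat (order \<alpha> p) = d - s * of_nat (order \<alpha> p)"
    using edge_translate[OF mn E b \<alpha>(2) \<open>l' > 0\<close> PQ'] by metis
  have st: "stp m n l P Q s \<alpha> l' (tr s \<alpha> P) (tr s \<alpha> Q) s'"
    unfolding stp_def using E b e' il' f \<alpha>(4) by blast
  have "degree p' < degree p \<or> degree p' = degree p \<and> l' = l \<and> s \<in> El l \<and> s' < s
        \<and> d' - s' * of_nat (degree p) = d - s * of_nat (degree p)"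
  proof (cases "order \<alpha> p = degree p")
    case True
    then have "\<alpha> \<noteq> 0" using h(5) by auto
    then have "s \<in> El l" using single_root_slope[OF h(4,2) True] h(5) by simp
    then have "lcm (int l) (den s) = int l" using El_den[of s l] by (simp add: lcm_proj1_if_dvd_int)
    then have "l' = l" using il' by simp
    then show ?thesis using True e' \<open>s \<in> El l\<close> by simp
  next
    case False
    then show ?thesis using e'(3) order_degree[OF p, of \<alpha>] by simp
  qed
  then show ?thesis using that st e'(2) by blast
qed

definition chain where
  "chain m n \<nu> L PP QQ S A \<longleftrightarrow>
     (\<forall>j<\<nu>. stp m n (L j) (PP j) (QQ j) (S j) (A j) (L (Suc j)) (PP (Suc j)) (QQ (Suc j)) (S (Suc j)))
     \<and> (\<exists>d e p q. edge m n (L \<nu>) (PP \<nu>) (QQ \<nu>) (S \<nu>) d e p q \<and> d + e = 1 + S \<nu>)"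

lemma chain_Cons:
  assumes "stp m n l P Q s \<alpha> (L 0) (PP 0) (QQ 0) (S 0)" "chain m n \<nu> L PP QQ S A"
  shows "chain m n (Suc \<nu>) (case_nat l L) (case_nat P PP) (case_nat Q QQ) (case_nat s S) (case_nat \<alpha> A)"
  using assms by (auto simp: chain_def less_Suc_eq_0_disj)

text \<open>Nested induction. While the degree stays \<open>b\<close>, the corner
  \<open>(a, b)\<close> and \<open>l\<close> are fixed, and \<open>d > 0\<close> keeps the slope
  above \<open>-a / b\<close>; the inner measure counts integers between \<open>- l a / b\<close>
  and \<open>l s\<close>.\<close>

lemma chain_exists_aux:
  fixes P Q :: "'k::field_char_0 wa"
  assumes K: "alg_closed TYPE('k)" and mn: "m > 1" "n > 1" "coprime m n"
  shows "edge m n l P Q s d e p q \<Longrightarrow> degree p = b \<Longrightarrow>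
    nat (\<lfloor>of_nat l * s\<rfloor> - \<lfloor>- (of_nat l * (d - s * of_nat b)) / of_nat b\<rfloor>) = k \<Longrightarrow>
    \<exists>\<nu> L PP QQ S A. L 0 = l \<and> PP 0 = P \<and> QQ 0 = Q \<and> S 0 = s \<and> chain m n \<nu> L PP QQ S (A :: nat \<Rightarrow> 'k)"
proof (induction b arbitrary: k l P Q s d e p q rule: less_induct)
  case (less b k l P Q s d e p q)
  note outer = less.IH
  show ?case
    using less.prems
  proof (induction k arbitrary: P Q s d e p q rule: less_induct)
    case (less k P Q s d e p q)
    note E = less.prems(1) and b = less.prems(2)
    have tops: "cm Q P = 1" "1 + s > 0" "top_at s P d p" "top_at s Q e q"
      using E by (auto simp: edge_def)
    show ?case
    proof (cases "1 + s < d + e")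
      case False
      then have "d + e = 1 + s" using bracket_cases[OF tops] by blast
      then have "chain m n 0 (\<lambda>_. l) (\<lambda>_. P) (\<lambda>_. Q) (\<lambda>_. s) (\<lambda>_. 0 :: 'k)"
        using E by (auto simp: chain_def)
      then show ?thesis by (intro exI conjI) auto
    next
      case True
      obtain \<alpha> l' P' Q' s' d' e' p' q' where st: "stp m n l P Q s \<alpha> l' P' Q' s'"
        and E': "edge m n l' P' Q' s' d' e' p' q'" and alt:
        "degree p' < degree p \<or> degree p' = degree p \<and> l' = l \<and> s \<in> El l \<and> s' < s
            \<and> d' - s' * of_nat (degree p) = d - s * of_nat (degree p)"
        using step_exists[OF K mn E True] by metis
      have "\<exists>\<nu> L PP QQ S A. L 0 = l' \<and> PP 0 = P' \<and> QQ 0 = Q' \<and> S 0 = s' \<and> chain m n \<nu> L PP QQ S (A :: nat \<Rightarrow> 'k)"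
        using alt
      proof
        assume "degree p' < degree p"
        then show ?thesis using outer[OF _ E' refl refl] b by simp
      next
        assume a: "degree p' = degree p \<and> l' = l \<and> s \<in> El l \<and> s' < s
            \<and> d' - s' * of_nat (degree p) = d - s * of_nat (degree p)"
        have bpos: "b > 0" using E b by (auto simp: edge_def)
        have lpos: "l > 0" and d': "d' > 0" using E E' by (auto simp: edge_def)
        have eq: "d' - s' * of_nat b = d - s * of_nat b" using a b by simp
        define c where "c = - (of_nat l * (d - s * of_nat b)) / of_nat b"
        have "c \<le> of_nat l * s'"
        proof -
          have "- (d - s * of_nat b) \<le> s' * of_nat b" using d' unfolding eq[symmetric] by simp
          then have "of_nat l * - (d - s * of_nat b) \<le> of_nat l * (s' * of_nat b)" by (intro mult_left_mono) auto
          moreover have "c = (of_nat l * - (d - s * of_nat b)) / of_nat b" by (simp only: c_def mult_minus_right)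
          ultimately show ?thesis using bpos by (simp only: pos_divide_le_eq of_nat_0_less_iff mult.assoc)
        qed
        then have 1: "\<lfloor>c\<rfloor> \<le> \<lfloor>of_nat l * s'\<rfloor>" by (rule floor_mono)
        \<comment> \<open>\<open>l s\<close> is an integer, so any smaller rational number, integral
          or not, has a smaller floor.\<close>
        have 2: "\<lfloor>of_nat l * s'\<rfloor> < \<lfloor>of_nat l * s\<rfloor>"
        proof -
          obtain i where i: "of_nat l * s = of_int i" using a by (auto simp: El_def elim: Ints_cases)
          have "of_nat l * s' < of_nat l * s" using a lpos by simp
          then show ?thesis unfolding i by (simp add: floor_less_iff)
        qed
        have "nat (\<lfloor>of_nat l * s'\<rfloor> - \<lfloor>c\<rfloor>) < k"
          using 1 2 less.prems(3) unfolding c_def[symmetric] by linarith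
        moreover have "c = - (of_nat l * (d' - s' * of_nat b)) / of_nat b" unfolding eq c_def ..
        ultimately have small: "nat (\<lfloor>of_nat l * s'\<rfloor> - \<lfloor>- (of_nat l * (d' - s' * of_nat b)) / of_nat b\<rfloor>) < k"
          by (simp only:)
        have "edge m n l P' Q' s' d' e' p' q'" "degree p' = b" using E' a b by simp_all
        from less.IH[OF small this refl] show ?thesis using a by simp
      qed
      then obtain \<nu> L PP QQ S A where c: "L 0 = l'" "PP 0 = P'" "QQ 0 = Q'" "S 0 = s'"
          "chain m n \<nu> L PP QQ S (A :: nat \<Rightarrow> 'k)" by blast
      have "chain m n (Suc \<nu>) (case_nat l L) (case_nat P PP) (case_nat Q QQ) (case_nat s S) (case_nat \<alpha> A)"
        by (rule chain_Cons) (use st c in auto)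
      then show ?thesis by (intro exI conjI) auto
    qed
  qed
qed

lemma chain_exists:
  fixes P Q :: "'k::field_char_0 wa"
  assumes "alg_closed TYPE('k)" "m > 1" "n > 1" "coprime m n" "edge m n l P Q s d e p q"
  obtains \<nu> L PP QQ S A where "L 0 = l" "PP 0 = P" "QQ 0 = Q" "S 0 = s" "chain m n \<nu> L PP QQ S (A :: nat \<Rightarrow> 'k)"
  using chain_exists_aux[OF assms(1-5) refl refl] by blast

section \<open>Transfer to coefficient functions\<close>

lemma wadd_cf: "wadd (cf P) (cf Q) = cf (P + Q)"
  and wsub_cf: "wsub (cf P) (cf Q) = cf (P - Q)"
  and wsmul_cf: "wsmul c (cf P) = cf (smul c P)"
  and wzero_cf: "wzero = cf 0"
  and wone_cf: "wone = cf 1"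
  by (auto simp: fun_eq_iff wadd_def wsub_def wsmul_def wzero_def wone_def one_wa_def cf_mon)

lemma wcomm_cf: "wcomm (cf P) (cf Q) = cf (cm P Q)"
  unfolding wcomm_def by (simp only: cf_mult[symmetric] wsub_cf)

lemma cf_Wa: "finite (wsupp P) \<Longrightarrow> cf (Wa P) = P"
  by (rule Wa_inverse) simp

lemma Wl_eq: "Wl l = cf ` xspan (El l)"
proof (intro set_eqI iffI)
  fix P :: "'a wel" assume "P \<in> Wl l"
  then have "P = cf (Wa P)" and "Wa P \<in> xspan (El l)"
    by (auto simp: Wl_def xspan_def El_def cf_Wa)
  then show "P \<in> cf ` xspan (El l)" by (rule image_eqI)
qed (auto simp: Wl_def xspan_def El_def)

lemma Weyl_eq: "Weyl = cf ` xspan \<nat>"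
proof -
  have N: "a \<in> \<int> \<and> 0 \<le> a \<longleftrightarrow> a \<in> \<nat>" for a :: rat
    by (auto simp: Nats_altdef2)
  show ?thesis
  proof (intro set_eqI iffI)
    fix P :: "'a wel" assume "P \<in> Weyl"
    then have "P = cf (Wa P)" and "Wa P \<in> xspan \<nat>"
      by (auto simp: Weyl_def xspan_def cf_Wa N)
    then show "P \<in> cf ` xspan \<nat>" by (rule image_eqI)
  qed (auto simp: Weyl_def xspan_def N[symmetric])
qed

definition lft :: "('k::field_char_0 wa \<Rightarrow> 'k wa) \<Rightarrow> 'k wel \<Rightarrow> 'k wel" where
  "lft h P = cf (h (Wa P))"

lemma lft_cf [simp]: "lft h (cf P) = cf (h P)"
  by (simp add: lft_def cf_inverse)

lemma lft_auto:
  assumes "\<And>P. P \<in> X \<Longrightarrow> h P \<in> X" "\<And>P. P \<in> X \<Longrightarrow> h' P \<in> X"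
    and "\<And>P. P \<in> X \<Longrightarrow> h' (h P) = P" "\<And>P. P \<in> X \<Longrightarrow> h (h' P) = P"
    and "\<And>P Q. h (P + Q) = h P + h Q" "\<And>c P. h (smul c P) = smul c (h P)"
    and "\<And>P Q. P \<in> X \<Longrightarrow> Q \<in> X \<Longrightarrow> h (P * Q) = h P * h Q" "h 1 = 1"
  shows "alg_auto (cf ` X) (lft h)"
proof -
  have "alg_endo (cf ` X) (lft h)"
    unfolding alg_endo_def using assms(1,5-8)
    by (auto simp: wadd_cf wsmul_cf wone_cf simp flip: cf_mult)
  moreover have "bij_betw (lft h) (cf ` X) (cf ` X)"
    by (rule bij_betw_byWitness[where f' = "lft h'"]) (use assms(1-4) in auto)
  ultimately show ?thesis by (simp add: alg_auto_def)
qed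

lemma tr_auto:
  assumes "exps_ok E" "s \<in> E"
  shows "alg_auto (cf ` xspan E) (lft (tr s \<alpha>))"
  by (rule lft_auto[where h' = "tr s (- \<alpha>)"])
     (use assms tr_inverse[of s \<alpha>] tr_inverse[of s "- \<alpha>"] in \<open>auto simp: tr_add tr_smul tr_mult intro!: tr_xspan\<close>)

lemma sw_auto:
  assumes "\<epsilon> * \<epsilon> = 1"
  shows "alg_auto Weyl (lft (sw \<epsilon>))"
  unfolding Weyl_eq
  by (rule lft_auto[where h' = "sw (- \<epsilon>)"])
     (use assms sw_inverse[of \<epsilon>] sw_inverse[of "- \<epsilon>"] in \<open>auto simp: sw_add sw_smul sw_mult intro!: sw_xspan\<close>)

lemma alg_auto_comp:
  assumes "alg_auto C f" "alg_auto C g"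
  shows "alg_auto C (f \<circ> g)"
  using assms bij_betw_trans[of g C C f C] unfolding alg_auto_def alg_endo_def by auto

lemma alg_auto_id: "alg_auto C id"
  by (simp add: alg_auto_def alg_endo_def)

section \<open>Degrees, leading terms and end points for integer directions\<close>

context
  fixes r c :: int and s :: rat
  assumes r: "r > 0" and rc: "of_int c = s * of_int r"
begin

lemma vpt_eq: "vpt r c x = of_int r * (fst x + s * of_nat (snd x))"
  by (simp add: vpt_def rc algebra_simps)

lemma vdeg_top:
  assumes "top_at s P d p"
  shows "vdeg r c (cf P) = of_int r * d"
  unfolding vdeg_def
proof (rule Max_eqI)
  show "finite (vpt r c ` supp P)" by simp
  show "y \<le> of_int r * d" if "y \<in> vpt r c ` supp P" for y
    using that assms r by (auto simp: vpt_eq top_at_def fil_def)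
  obtain j where "coeff p j \<noteq> 0" using top_atD(3)[OF assms] by (metis leading_coeff_neq_0)
  then have "(d - s * of_nat j, j) \<in> supp P" using cp_nonzero_point top_atD(2)[OF assms] by metis
  moreover have "vpt r c (d - s * of_nat j, j) = of_int r * d" by (simp add: vpt_eq)
  ultimately show "of_int r * d \<in> vpt r c ` supp P" by (metis image_eqI)
qed

lemma lead_top:
  assumes "top_at s P d p"
  shows "lead r c (cf P) x = (if fst x + s * of_nat (snd x) = d then coeff p (snd x) else 0)"
proof -
  have "vpt r c x = vdeg r c (cf P) \<longleftrightarrow> fst x + s * of_nat (snd x) = d"
    unfolding vpt_eq vdeg_top[OF assms] using r by simp
  moreover have "coeff p (snd x) = cf P x" if "fst x + s * of_nat (snd x) = d"
    using top_atD(2)[OF assms] that by (metis add_diff_cancel_right' coeff_cp prod.collapse)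
  ultimately show ?thesis by (simp add: lead_def)
qed

lemma lead_top_eq:
  assumes "top_at s P d p" "top_at s Q d p"
  shows "lead r c (cf P) = lead r c (cf Q)"
  by (rule ext) (simp add: lead_top[OF assms(1)] lead_top[OF assms(2)])

lemma lead_supp:
  assumes "top_at s P d p"
  shows "x \<in> wsupp (lead r c (cf P)) \<longleftrightarrow> fst x = d - s * of_nat (snd x) \<and> coeff p (snd x) \<noteq> 0"
  by (auto simp: wsupp_def lead_top[OF assms])

lemma finite_lead_supp: "finite (wsupp (lead r c (cf P)))"
  by (rule finite_subset[OF _ finite_supp[of P]]) (auto simp: wsupp_def lead_def)

text \<open>Along the edge \<open>b - a = (1 + s) b - d\<close> increases with \<open>b\<close>, so
  \<open>en\<close> sits at the degree of the polynomial and \<open>st\<close> at its multiplicity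
  of the root 0.\<close>

lemma en_top:
  assumes t: "top_at s P d p" and s: "1 + s > 0"
  shows "en r c (cf P) = (d - s * of_nat (degree p), degree p)"
proof -
  let ?e = "(d - s * of_nat (degree p), degree p)"
  let ?S = "wsupp (lead r c (cf P))"
  have mem: "?e \<in> ?S" using top_atD(3)[OF t] by (simp add: lead_supp[OF t])
  have val: "of_nat (snd x) - fst x = (1 + s) * of_nat (snd x) - d" if "x \<in> ?S" for x
    using that by (simp add: lead_supp[OF t] algebra_simps)
  have le: "snd x \<le> degree p" if "x \<in> ?S" for x
    using that by (simp add: lead_supp[OF t] le_degree)
  have eq: "x = ?e" if "x \<in> ?S" "snd x = degree p" for x
    using that by (simp add: lead_supp[OF t] prod_eq_iff)
  have "{x\<in>?S. \<forall>y\<in>?S. of_nat (snd y) - fst y \<le> of_nat (snd x) - fst x} = {?e}"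
  proof (intro set_eqI iffI)
    fix x assume "x \<in> {x\<in>?S. \<forall>y\<in>?S. of_nat (snd y) - fst y \<le> of_nat (snd x) - fst x}"
    then have x: "x \<in> ?S" "of_nat (snd ?e) - fst ?e \<le> of_nat (snd x) - fst x" using mem by blast+
    then have "(1 + s) * of_nat (degree p) \<le> (1 + s) * of_nat (snd x)" using val[OF x(1)] val[OF mem] by simp
    then have "degree p \<le> snd x" using s by simp
    then show "x \<in> {?e}" using le[OF x(1)] eq[OF x(1)] by simp
  next
    fix x assume "x \<in> {?e}"
    then have x: "x = ?e" by simp
    have "of_nat (snd y) - fst y \<le> of_nat (snd ?e) - fst ?e" if "y \<in> ?S" for y
      unfolding val[OF that] val[OF mem] using le[OF that] s by simp
    then show "x \<in> {x\<in>?S. \<forall>y\<in>?S. of_nat (snd y) - fst y \<le> of_nat (snd x) - fst x}" using mem x by simp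
  qed
  then show ?thesis unfolding en_def Let_def by (simp only:) (rule the_equality, auto)
qed

lemma st_top:
  assumes t: "top_at s P d p" and s: "1 + s > 0"
  shows "st r c (cf P) = (d - s * of_nat (order 0 p), order 0 p)"
proof -
  let ?e = "(d - s * of_nat (order 0 p), order 0 p)"
  let ?S = "wsupp (lead r c (cf P))"
  have p: "p \<noteq> 0" using t by (auto simp: top_at_def)
  have mem: "?e \<in> ?S" using order_0_coeff(1)[OF p] by (simp add: lead_supp[OF t])
  have val: "fst x - of_nat (snd x) = d - (1 + s) * of_nat (snd x)" if "x \<in> ?S" for x
    using that by (simp add: lead_supp[OF t] algebra_simps)
  have le: "order 0 p \<le> snd x" if "x \<in> ?S" for x
    using that order_0_coeff(2)[OF p, of "snd x"] by (force simp: lead_supp[OF t])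
  have eq: "x = ?e" if "x \<in> ?S" "snd x = order 0 p" for x
    using that by (simp add: lead_supp[OF t] prod_eq_iff)
  have "{x\<in>?S. \<forall>y\<in>?S. fst y - of_nat (snd y) \<le> fst x - of_nat (snd x)} = {?e}"
  proof (intro set_eqI iffI)
    fix x assume "x \<in> {x\<in>?S. \<forall>y\<in>?S. fst y - of_nat (snd y) \<le> fst x - of_nat (snd x)}"
    then have x: "x \<in> ?S" "fst ?e - of_nat (snd ?e) \<le> fst x - of_nat (snd x)" using mem by blast+
    then have "(1 + s) * of_nat (snd x) \<le> (1 + s) * of_nat (order 0 p)" using val[OF x(1)] val[OF mem] by simp
    then have "snd x \<le> order 0 p" using s by simp
    then show "x \<in> {?e}" using le[OF x(1)] eq[OF x(1)] by simp
  next
    fix x assume "x \<in> {?e}"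
    then have x: "x = ?e" by simp
    have "fst y - of_nat (snd y) \<le> fst ?e - of_nat (snd ?e)" if "y \<in> ?S" for y
      unfolding val[OF that] val[OF mem] using le[OF that] s by simp
    then show "x \<in> {x\<in>?S. \<forall>y\<in>?S. fst y - of_nat (snd y) \<le> fst x - of_nat (snd x)}" using mem x by simp
  qed
  then show ?thesis unfolding st_def Let_def by (simp only:) (rule the_equality, auto)
qed

lemma card_lead_top:
  assumes t: "top_at s P d p" and o: "order 0 p < degree p"
  shows "card (wsupp (lead r c (cf P))) > 1"
proof -
  let ?A = "{(d - s * of_nat (order 0 p), order 0 p), (d - s * of_nat (degree p), degree p)}"
  have p: "p \<noteq> 0" using t by (auto simp: top_at_def)
  have "?A \<subseteq> wsupp (lead r c (cf P))"
    using order_0_coeff(1)[OF p] p by (simp add: lead_supp[OF t])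
  then have "card ?A \<le> card (wsupp (lead r c (cf P)))" by (rule card_mono[OF finite_lead_supp])
  then show ?thesis using o by simp
qed

end

lemma vdeg_one: "vdeg r c (cf 1) = 0"
  by (simp add: vdeg_def one_wa_def vpt_def)

lemma lead_one: "lead r c (cf 1) = cf 1"
proof
  fix x
  have "vpt r c (0, 0) = 0" by (simp add: vpt_def)
  then show "lead r c (cf 1) x = cf 1 x" 
    using vdeg_one[of r c] unfolding one_wa_def by (auto simp: lead_def cf_mon)
qed

text \<open>Formulated for integer directions: those above the edge include some with
  \<open>u \<le> 0\<close>, and \<open>(1, 1)\<close> gives the total degree.\<close>

lemma lead_tr:
  fixes P :: "'k::field_char_0 wa" and u v :: int
  assumes uv: "u + v > 0" "of_int u * s < of_int v" and P: "P \<noteq> 0"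
  shows "vdeg u v (cf (tr s \<alpha> P)) = vdeg u v (cf P)" "lead u v (cf (tr s \<alpha> P)) = lead u v (cf P)"
proof -
  define d where "d = vdeg u v (cf P)"
  have ne: "supp P \<noteq> {}"
  proof
    assume "supp P = {}"
    then have "P = 0" by (intro wa_eqI) (auto simp: wsupp_def)
    then show False using P by simp
  qed
  have le: "vpt u v x \<le> d" if "x \<in> supp P" for x using that by (auto simp: d_def vdeg_def)
  have "d \<in> vpt u v ` supp P" unfolding d_def vdeg_def by (rule Max_in) (use ne in auto)
  then obtain x0 where x0: "x0 \<in> supp P" "vpt u v x0 = d" by auto
  have "fil (of_int u) (of_int v) d P" using le by (auto simp: fil_def vpt_def)
  moreover have "(of_int u + of_int v :: rat) \<ge> 0" using uv(1) by (simp flip: of_int_add)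
  ultimately have sf: "sfil (of_int u) (of_int v) d (tr s \<alpha> P - P)" using uv(2) by (intro tr_lower)
  have same: "cf (tr s \<alpha> P) x = cf P x" if "vpt u v x \<ge> d" for x
  proof (rule ccontr)
    assume "cf (tr s \<alpha> P) x \<noteq> cf P x"
    then have "x \<in> supp (tr s \<alpha> P - P)" by (simp add: in_supp)
    then show False using sf that by (auto simp: sfil_def vpt_def)
  qed
  have le': "vpt u v x \<le> d" if "x \<in> supp (tr s \<alpha> P)" for x
    using same[of x] le[of x] that by (force simp: in_supp)
  show deg: "vdeg u v (cf (tr s \<alpha> P)) = vdeg u v (cf P)"
    unfolding d_def[symmetric] unfolding vdeg_def
  proof (rule Max_eqI)
    show "d \<in> vpt u v ` supp (tr s \<alpha> P)" using x0 same[of x0] by (force simp: in_supp)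
  qed (use le' in auto)
  show "lead u v (cf (tr s \<alpha> P)) = lead u v (cf P)"
    unfolding lead_def deg d_def[symmetric] using same by (auto simp: fun_eq_iff)
qed

section \<open>Slopes and the order on directions\<close>

lemma slope_Vset: "1 + s > 0 \<Longrightarrow> (den s, num s) \<in> Vset"
proof -
  assume "1 + s > 0"
  then have "(1 + s) * of_int (den s) > 0" using den_pos[of s] by simp
  then have "of_int (den s + num s) > (0 :: rat)" by (simp add: num_den algebra_simps)
  then have "den s + num s > 0" by (simp only: of_int_0_less_iff)
  then show ?thesis using num_den_coprime[of s] by (simp add: Vset_def coprime_iff_gcd_eq_1 gcd.commute)
qed

lemma slope_cross: "of_int (den s' * num s - num s' * den s) = (s - s') * of_int (den s * den s')"
  by (simp add: num_den algebra_simps)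

lemma slope_vlt:
  assumes "1 + s > 0" "1 + s' > 0" "s' < s"
  shows "vlt (den s', num s') (den s, num s)"
proof -
  have "(s - s') * of_int (den s * den s') > 0" using assms(3) den_pos[of s] den_pos[of s'] by simp
  then have "den s' * num s - num s' * den s > 0" unfolding slope_cross[symmetric] by (simp only: of_int_0_less_iff)
  then show ?thesis using slope_Vset assms by (auto simp: vlt_def vle_def)
qed

text \<open>Strictness of the order is only inequality of the pairs. A vanishing determinant makes
  two primitive vectors equal up to sign, and positive coordinate sums exclude the opposite
  sign.\<close>

lemma vlt_slope:
  assumes s: "1 + s > 0" and V: "(u, v) \<in> Vset" and lt: "vlt (den s, num s) (u, v)"
  shows "u + v > 0" "of_int u * s < of_int v"
proof -
  show uv: "u + v > 0" using V by (simp add: Vset_def)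
  have dn: "(den s, num s) \<in> Vset" by (rule slope_Vset[OF s])
  then have "den s + num s > 0" by (simp add: Vset_def)
  then have ge: "den s * v - num s * u \<ge> 0"
    using lt uv by (auto simp: vlt_def vle_def)
  have "den s * v - num s * u \<noteq> 0"
  proof
    assume "den s * v - num s * u = 0"
    then have eq: "den s * v = num s * u" by simp
    then have "den s dvd num s * u" by (metis dvd_triv_left)
    then have 1: "den s dvd u"
      using num_den_coprime[of s] coprime_dvd_mult_right_iff[of "den s" "num s" u] coprime_commute by blast
    have "u dvd den s * v" using eq by simp
    moreover have "coprime u v" using V by (simp add: Vset_def coprime_iff_gcd_eq_1)
    ultimately have 2: "u dvd den s" using coprime_dvd_mult_left_iff[of u v "den s"] by blast
    have "\<bar>u\<bar> = \<bar>den s\<bar>" using 1 2 zdvd_antisym_abs by blast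
    then have "u = den s \<or> u = - den s" by (simp add: abs_eq_iff)
    then show False
    proof
      assume "u = den s"
      then have "v = num s" using eq den_pos[of s] by simp
      then show False using \<open>u = den s\<close> lt by (simp add: vlt_def)
    next
      assume "u = - den s"
      then have "den s * v = den s * (- num s)" using eq by simp
      then have "v = - num s" using den_pos[of s] by (metis less_irrefl mult_left_cancel)
      then show False using \<open>u = - den s\<close> uv \<open>den s + num s > 0\<close> by simp
    qed
  qed
  then have "den s * v - num s * u > 0" using ge by simp
  then have "of_int (num s * u) < (of_int (den s * v) :: rat)" by (simp only: of_int_less_iff)
  then have "of_int (den s) * (of_int u * s) < of_int (den s) * (of_int v :: rat)" by (simp add: num_den mult_ac)
  then show "of_int u * s < of_int v" using den_pos[of s] by (simp only: mult_less_cancel_left_pos of_int_0_less_iff)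
qed

section \<open>Edges and steps in the form of the stated properties\<close>

lemma edge_facts:
  fixes P Q :: "'k::field_char_0 wa"
  assumes E: "edge m n l P Q s d e p q" and mn: "m > 1" "n > 1"
  defines "r \<equiv> den s" and "c \<equiv> num s"
  shows "l \<ge> 1" "cf P \<in> Wl l" "cf Q \<in> Wl l" "(r, c) \<in> Vset" "wcomm (cf Q) (cf P) = wone"
    "vpt 1 (-1) (en r c (cf P)) < 0" "vpt 1 (-1) (en r c (cf Q)) < 0" "(r, c) \<in> Val (cf P) \<inter> Val (cf Q)"
    "vdeg r c (cf P) > 0" "vdeg r c (cf Q) > 0"
    "vdeg r c (cf P) / vdeg r c (cf Q) = of_nat m / of_nat n"
    "fst (en r c (cf P)) = of_nat m / of_nat n * fst (en r c (cf Q))"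
    "of_nat (snd (en r c (cf P))) = (of_nat m / of_nat n :: rat) * of_nat (snd (en r c (cf Q)))"
proof -
  have h: "l > 0" "P \<in> xspan (El l)" "Q \<in> xspan (El l)" "cm Q P = 1" "1 + s > 0" "top_at s P d p" "top_at s Q e q"
    "d > 0" "of_nat m * e = of_nat n * d" "m * degree q = n * degree p" "order 0 p < degree p" "order 0 q < degree q"
    "(1 + s) * of_nat (degree p) > d" using E by (auto simp: edge_def)
  have r: "r > 0" "of_int c = s * of_int r" by (simp_all add: r_def c_def den_pos num_den)
  note enP = en_top[OF r h(6,5)] and enQ = en_top[OF r h(7,5)]
  show "l \<ge> 1" using h(1) by simp
  show "cf P \<in> Wl l" "cf Q \<in> Wl l" using h(2,3) by (auto simp: Wl_eq)
  show V: "(r, c) \<in> Vset" unfolding r_def c_def by (rule slope_Vset[OF h(5)])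
  show "wcomm (cf Q) (cf P) = wone" by (simp add: wcomm_cf h(4) wone_cf)
  show "vpt 1 (-1) (en r c (cf P)) < 0" using h(13) by (simp add: enP vpt_def algebra_simps)
  have mr: "(of_nat m :: rat) > 0" "(of_nat n :: rat) > 0" using mn by simp_all
  have dg: "(of_nat m :: rat) * of_nat (degree q) = of_nat n * of_nat (degree p)" using h(10) by (metis of_nat_mult)
  have "of_nat m * e > 0" unfolding h(9) using h(8) mr by simp
  then have e: "e > 0" using mr by (simp add: zero_less_mult_iff)
  have "of_nat m * ((1 + s) * of_nat (degree q)) = of_nat n * ((1 + s) * of_nat (degree p))"
    using dg by (simp add: algebra_simps)
  also have "\<dots> > of_nat n * d" using h(13) mr by simp
  finally have "of_nat m * ((1 + s) * of_nat (degree q)) > of_nat m * e" using h(9) by simp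
  then have "(1 + s) * of_nat (degree q) > e" using mr by (simp only: mult_less_cancel_left_pos)
  then show "vpt 1 (-1) (en r c (cf Q)) < 0" by (simp add: enQ vpt_def algebra_simps)
  show "(r, c) \<in> Val (cf P) \<inter> Val (cf Q)"
    using V card_lead_top[OF r h(6,11)] card_lead_top[OF r h(7,12)] by (simp add: Val_def)
  show "vdeg r c (cf P) > 0" "vdeg r c (cf Q) > 0"
    unfolding vdeg_top[OF r h(6)] vdeg_top[OF r h(7)] using r h(8) e by simp_all
  show "vdeg r c (cf P) / vdeg r c (cf Q) = of_nat m / of_nat n"
    unfolding vdeg_top[OF r h(6)] vdeg_top[OF r h(7)] using r(1) e mr h(9) by (simp add: frac_eq_eq mult_ac)
  show "of_nat (snd (en r c (cf P))) = (of_nat m / of_nat n :: rat) * of_nat (snd (en r c (cf Q)))"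
    using dg mr by (simp add: enP enQ field_simps)
  have "of_nat n * (d - s * of_nat (degree p)) = of_nat n * d - s * (of_nat n * of_nat (degree p))"
    by (simp add: algebra_simps)
  also have "\<dots> = of_nat m * (e - s * of_nat (degree q))"
    unfolding dg[symmetric] h(9)[symmetric] by (simp add: algebra_simps)
  finally show "fst (en r c (cf P)) = of_nat m / of_nat n * fst (en r c (cf Q))"
    using mr by (simp add: enP enQ field_simps)
qed

lemma edge_comm_zero:
  fixes P Q :: "'k::field_char_0 wa"
  assumes E: "edge m n l P Q s d e p q"
  shows "1 + s < d + e \<Longrightarrow> wcomm_rs (den s) (num s) (cf Q) (cf P) = wzero"
    and "d + e = 1 + s \<Longrightarrow> wcomm_rs (den s) (num s) (cf Q) (cf P) = wone"
proof -
  have h: "cm Q P = 1" "1 + s > 0" "top_at s P d p" "top_at s Q e q" using E by (auto simp: edge_def)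
  note r = den_pos[of s] num_den[of s]
  have v: "vdeg (den s) (num s) (cf Q) + vdeg (den s) (num s) (cf P) - of_int (den s + num s) = of_int (den s) * (d + e - (1 + s))"
    unfolding vdeg_top[OF r h(3)] vdeg_top[OF r h(4)] by (simp add: num_den algebra_simps)
  have ne: "cf (1 :: 'k wa) \<noteq> wzero" by (metis cf_inject wzero_cf zero_neq_one)
  have w: "wcomm (cf Q) (cf P) = cf 1" by (simp add: wcomm_cf h(1))
  show "wcomm_rs (den s) (num s) (cf Q) (cf P) = wzero" if "1 + s < d + e"
  proof -
    have "of_int (den s) * (d + e - (1 + s)) > 0" using that r(1) by simp
    then show ?thesis unfolding wcomm_rs_def w v vdeg_one by simp
  qed
  show "wcomm_rs (den s) (num s) (cf Q) (cf P) = wone" if "d + e = 1 + s"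
    unfolding wcomm_rs_def w v vdeg_one lead_one that using ne by (simp add: wone_cf)
qed

lemma ode_realize:
  fixes P :: "'k::field_char_0 wa"
  assumes K: "alg_closed TYPE('k)" and tP: "top_at s P d p" and s: "1 + s > 0" and d: "d > 0" and o: "order 0 p < degree p"
    and f: "br (1 + s) d p f = p" "\<And>j. coeff f j \<noteq> 0 \<Longrightarrow> 1 + s - s * of_nat j \<in> El l"
  defines "r \<equiv> den s" and "c \<equiv> num s"
  obtains F where "F \<in> Wl l" "F \<noteq> wzero" "homogeneous r c F" "card (wsupp F) \<noteq> 1" "vdeg r c F = of_int (r + c)"
    "wcomm_rs r c (cf P) F = lead r c (cf P)" "snd (en r c F) = degree f"
proof -
  define F :: "'k wa" where "F = (\<Sum>j\<le>degree f. smul (coeff f j) (mon (1 + s - s * of_nat j) j))"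
  have r: "r > 0" "of_int c = s * of_int r" by (simp_all add: r_def c_def den_pos num_den)
  have p: "p \<noteq> 0" using tP by (auto simp: top_at_def)
  have fnz: "f \<noteq> 0" by (rule ode_nz[OF f(1) p s d])
  have cfF: "cf F x = (if fst x = 1 + s - s * of_nat (snd x) then coeff f (snd x) else 0)" for x
  proof -
    have "cf F x = (\<Sum>j\<le>degree f. if j = snd x then (if fst x = 1 + s - s * of_nat (snd x) then coeff f (snd x) else 0) else 0)"
      unfolding F_def cf_sum by (rule sum.cong) (auto simp: cf_mon prod_eq_iff)
    then show ?thesis by (auto simp: coeff_eq_0)
  qed
  have tF: "top_at s F (1 + s) f"
  proof -
    have "cp s (1 + s) F = f" by (rule poly_eqI) (simp add: cfF)
    moreover have "fil 1 s (1 + s) F" by (auto simp: fil_def in_supp cfF split: if_splits)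
    ultimately show ?thesis using fnz by (simp add: top_at_def)
  qed
  have "F \<in> xspan (El l)" using f(2) by (auto simp: xspan_def in_supp cfF split: if_splits)
  then have 1: "cf F \<in> Wl l" by (auto simp: Wl_eq)
  have 2: "cf F \<noteq> wzero" using tF by (metis cf_inject cp_simps(1) top_atD(2,3) wzero_cf)
  have 3: "homogeneous r c (cf F)"
    unfolding homogeneous_def by (rule ext) (auto simp: lead_top[OF r tF] cfF)
  \<comment> \<open>The only possible root of a monomial \<open>f\<close> is 0. But \<open>p\<close>
    is not a monomial, so it has a nonzero root, and roots of \<open>p\<close> are roots of
    \<open>f\<close>.\<close>
  have of: "order 0 f < degree f"
  proof (rule ccontr)
    assume "\<not> order 0 f < degree f"
    then have z: "coeff f j = 0" if "j < degree f" for j using order_0_coeff(2)[OF fnz] that by simp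
    have mono: "f = monom (lead_coeff f) (degree f)"
      by (rule poly_eqI) (use z coeff_eq_0[of f] in \<open>force simp: linorder_neq_iff\<close>)
    have "\<exists>\<beta>. poly p \<beta> = 0 \<and> \<beta> \<noteq> 0" using single_root_order[OF K p, of 0] o by auto
    then obtain \<beta> where \<beta>: "poly p \<beta> = 0" "\<beta> \<noteq> 0" by blast
    have "poly f \<beta> = 0" using ode_root(1)[OF f(1) p s d \<beta>(1)] by (simp add: order_root)
    moreover have "poly f \<beta> = lead_coeff f * \<beta> ^ degree f" by (subst mono) (simp add: poly_monom)
    ultimately show False using fnz \<beta>(2) by simp
  qed
  have 4: "card (wsupp (cf F)) \<noteq> 1"
    using card_lead_top[OF r tF of] 3 by (simp add: homogeneous_def)
  have 5: "vdeg r c (cf F) = of_int (r + c)" unfolding vdeg_top[OF r tF] using r(2) by (simp add: algebra_simps)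
  have tC: "top_at s (cm P F) d p"
  proof -
    have e: "d + (1 + s) - (1 + s) = d" by simp
    show ?thesis
      using fil_comm[OF top_atD(1)[OF tP] top_atD(1)[OF tF] s] cp_comm[OF top_atD(1)[OF tP] top_atD(1)[OF tF] s]
        top_atD(2)[OF tP] top_atD(2)[OF tF] f(1) p unfolding e top_at_def by simp
  qed
  have nz: "cf (cm P F) \<noteq> wzero" using tC by (metis cf_inject cp_simps(1) top_atD(2,3) wzero_cf)
  have 6: "wcomm_rs r c (cf P) (cf F) = lead r c (cf P)"
    unfolding wcomm_rs_def wcomm_cf 5 vdeg_top[OF r tC] vdeg_top[OF r tP] lead_top_eq[OF r tC tP] using nz by simp
  have 7: "snd (en r c (cf F)) = degree f" by (simp add: en_top[OF r tF s])
  show ?thesis by (rule that[OF 1 2 3 4 5 6 7])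
qed

lemma stp_facts:
  fixes P Q :: "'k::field_char_0 wa"
  assumes K: "alg_closed TYPE('k)" and st: "stp m n l P Q s \<alpha> l' P' Q' s'"
  defines "r \<equiv> den s" and "c \<equiv> num s"
  shows "alg_auto (Wl l') (lft (tr s \<alpha>))" "int l' = lcm (int l) r"
    "cf P' = lft (tr s \<alpha>) (cf P)" "cf Q' = lft (tr s \<alpha>) (cf Q)"
    "vlt (den s', num s') (r, c)" "vdeg r c (cf P') = vdeg r c (cf P)" "vdeg r c (cf Q') = vdeg r c (cf Q)"
    "\<And>u v. (u, v) \<in> Vset \<Longrightarrow> vlt (r, c) (u, v) \<Longrightarrow> lead u v (cf P') = lead u v (cf P) \<and> lead u v (cf Q') = lead u v (cf Q)"
    "en (den s') (num s') (cf P') = st r c (cf P')"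
    "\<exists>F. F \<in> Wl l \<and> F \<noteq> wzero \<and> homogeneous r c F \<and> card (wsupp F) \<noteq> 1 \<and> vdeg r c F = of_int (r + c)
       \<and> wcomm_rs r c (cf P) F = lead r c (cf P)
       \<and> (en r c F = (1, 1) \<longrightarrow> st r c (cf P') = en r c (cf P))"
    "wcomm_rs r c (cf Q) (cf P) = wzero"
proof -
  obtain d e p q d' e' p' q' f where
     E: "edge m n l P Q s d e p q" and lt: "1 + s < d + e" and E': "edge m n l' P' Q' s' d' e' p' q'"
     and l': "int l' = lcm (int l) (den s)" and P': "P' = tr s \<alpha> P" and Q': "Q' = tr s \<alpha> Q" and ss: "s' < s"
     and dp: "degree p' = order \<alpha> p" and dd: "d' - s' * of_nat (order \<alpha> p) = d - s * of_nat (order \<alpha> p)"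
     and f: "br (1 + s) d p f = p" "\<And>j. coeff f j \<noteq> 0 \<Longrightarrow> 1 + s - s * of_nat j \<in> El l"
     and f1: "degree f = 1 \<Longrightarrow> order \<alpha> p = degree p"
    using st unfolding stp_def by blast
  have r: "r > 0" "of_int c = s * of_int r" by (simp_all add: r_def c_def den_pos num_den)
  have h: "cm Q P = 1" "1 + s > 0" "top_at s P d p" "top_at s Q e q" "d > 0" "order 0 p < degree p"
    using E by (auto simp: edge_def)
  have h': "1 + s' > 0" "top_at s' P' d' p'" using E' by (auto simp: edge_def)
  have p: "p \<noteq> 0" using h(3) by (auto simp: top_at_def)
  have tP': "top_at s P' d (pcompose p [:\<alpha>, 1:])" and tQ': "top_at s Q' e (pcompose q [:\<alpha>, 1:])"
    unfolding P' Q' by (rule top_at_tr[OF h(2,3)], rule top_at_tr[OF h(2,4)])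
  have PQ0: "P \<noteq> 0" "Q \<noteq> 0" using h(1) by auto
  show "alg_auto (Wl l') (lft (tr s \<alpha>))"
    unfolding Wl_eq by (rule tr_auto[OF exps_El den_El]) (simp add: l')
  show "int l' = lcm (int l) r" by (simp add: l' r_def)
  show "cf P' = lft (tr s \<alpha>) (cf P)" "cf Q' = lft (tr s \<alpha>) (cf Q)" by (simp_all add: P' Q')
  show "vlt (den s', num s') (r, c)" unfolding r_def c_def by (rule slope_vlt[OF h(2) h'(1) ss])
  show "vdeg r c (cf P') = vdeg r c (cf P)" "vdeg r c (cf Q') = vdeg r c (cf Q)"
    by (simp_all add: vdeg_top[OF r tP'] vdeg_top[OF r tQ'] vdeg_top[OF r h(3)] vdeg_top[OF r h(4)])
  show "lead u v (cf P') = lead u v (cf P) \<and> lead u v (cf Q') = lead u v (cf Q)"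
    if "(u, v) \<in> Vset" "vlt (r, c) (u, v)" for u v
    unfolding P' Q' using lead_tr(2) vlt_slope[OF h(2) that[unfolded r_def c_def]] PQ0 by blast
  have stP': "st r c (cf P') = (d - s * of_nat (order \<alpha> p), order \<alpha> p)"
    by (simp add: st_top[OF r tP' h(2)] order_pcompose_shift p)
  show "en (den s') (num s') (cf P') = st r c (cf P')"
    unfolding stP' en_top[OF den_pos num_den h'(2,1)] dp dd ..
  obtain F where F: "F \<in> Wl l" "F \<noteq> wzero" "homogeneous r c F" "card (wsupp F) \<noteq> 1" "vdeg r c F = of_int (r + c)"
    "wcomm_rs r c (cf P) F = lead r c (cf P)" "snd (en r c F) = degree f"
    using ode_realize[OF K h(3,2,5,6) f] unfolding r_def c_def by blast
  \<comment> \<open>Here \<open>degree f = 1\<close>, so \<open>\<alpha>\<close> is the only root of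
    \<open>p\<close> and the shifted polynomial has just its top term.\<close>
  have "st r c (cf P') = en r c (cf P)" if "en r c F = (1, 1)"
    unfolding stP' en_top[OF r h(3,2)] using f1 F(7) that by simp
  then show "\<exists>F. F \<in> Wl l \<and> F \<noteq> wzero \<and> homogeneous r c F \<and> card (wsupp F) \<noteq> 1 \<and> vdeg r c F = of_int (r + c)
       \<and> wcomm_rs r c (cf P) F = lead r c (cf P)
       \<and> (en r c F = (1, 1) \<longrightarrow> st r c (cf P') = en r c (cf P))"
    using F by blast
  show "wcomm_rs r c (cf Q) (cf P) = wzero"
    unfolding r_def c_def by (rule edge_comm_zero(1)[OF E lt])
qed

section \<open>The starting edge\<close>

lemma Nats_El1: "a \<in> \<nat> \<Longrightarrow> a \<in> El 1"
  by (auto simp: El_def Nats_altdef2)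

lemma xspan_Nats_El1: "P \<in> xspan \<nat> \<Longrightarrow> P \<in> xspan (El 1)"
  using xspan_mono[of \<nat> "El 1" P] Nats_El1 by blast

lemma Nats_nonneg: "a \<in> \<nat> \<Longrightarrow> (0 :: rat) \<le> a"
  by (auto elim: Nats_cases)

lemma top_point_Nats:
  assumes "P \<in> xspan \<nat>" "top_at s P d p" "coeff p j \<noteq> 0"
  shows "d - s * of_nat j \<in> \<nat>"
proof -
  have "(d - s * of_nat j, j) \<in> supp P" using cp_nonzero_point top_atD(2)[OF assms(2)] assms(3) by metis
  then show ?thesis using assms(1) by (auto simp: xspan_def)
qed

text \<open>For \<open>t > 1\<close> a point of \<open>t\<close>-weight at most \<open>M\<close> has
  total degree below \<open>M\<close>, except \<open>(M, 0)\<close>; the shift by a root of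
  \<open>p\<close> removes the coefficient at that point.\<close>

lemma tr_drops_degree:
  fixes P :: "'k::field_char_0 wa"
  assumes t: "t > 1" and tP: "top_at t P M p" and o: "order \<alpha> p > 0"
  obtains M' p' where "M' < M" "top_at 1 (tr t \<alpha> P) M' p'"
proof -
  let ?P = "tr t \<alpha> P"
  have p: "p \<noteq> 0" using tP by (auto simp: top_at_def)
  have tP': "top_at t ?P M (pcompose p [:\<alpha>, 1:])" by (rule top_at_tr[OF _ tP]) (use t in simp)
  have "order 0 (pcompose p [:\<alpha>, 1:]) > 0" using o p by (simp add: order_pcompose_shift)
  then have "coeff (cp t M ?P) 0 = 0"
    using order_0_coeff(2)[OF top_atD(3)[OF tP'], of 0] top_atD(2)[OF tP'] by simp
  then have z: "(M, 0) \<notin> supp ?P" by (simp add: in_supp)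
  have lt: "fst x + of_nat (snd x) < M" if x: "x \<in> supp ?P" for x
  proof -
    have le: "fst x + t * of_nat (snd x) \<le> M" using tP' x by (auto simp: top_at_def fil_def)
    show ?thesis
    proof (cases "snd x = 0")
      case True
      then have "fst x \<noteq> M" using z x by (metis prod.collapse)
      then show ?thesis using le True by simp
    next
      case False
      then have "1 * of_nat (snd x) < t * of_nat (snd x)" using t by (intro mult_strict_right_mono) auto
      then show ?thesis using le by linarith
    qed
  qed
  have "?P \<noteq> 0" using tP' by (auto simp: top_at_def)
  moreover have "fil 1 1 M ?P" using lt by (force simp: fil_def)
  moreover have "cp 1 M ?P = 0"
  proof (rule poly_eqI, rule ccontr)
    fix j assume "coeff (cp 1 M ?P) j \<noteq> coeff 0 j"
    then have "(M - 1 * of_nat j, j) \<in> supp ?P" by (intro cp_nonzero_point) simp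
    from lt[OF this] show False by simp
  qed
  ultimately show ?thesis using top_at_lower that by metis
qed

text \<open>The leading form is the single term at \<open>(M, 0)\<close>. The line through this
  point is tilted by raising the slope from 1; \<open>C\<close> collects the slopes at which it
  meets another support point.\<close>

lemma vertical_edge:
  fixes P :: "'k::field_char_0 wa"
  assumes tP: "top_at 1 P M p" and p0: "degree p = 0"
  defines "C \<equiv> (\<lambda>x. (M - fst x) / of_nat (snd x)) ` {x \<in> supp P. snd x > 0}"
  shows "finite C" and "\<And>t. t \<in> C \<Longrightarrow> t > 1"
    and "\<And>t. (\<And>c. c \<in> C \<Longrightarrow> t \<le> c) \<Longrightarrow> top_at t P M (cp t M P) \<and> coeff (cp t M P) 0 \<noteq> 0
           \<and> (t \<in> C \<longrightarrow> degree (cp t M P) > 0)"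
proof -
  show "finite C" by (simp add: C_def)
  have p: "p \<noteq> 0" using tP by (auto simp: top_at_def)
  show "t > 1" if tC: "t \<in> C" for t
  proof -
    obtain x where x: "x \<in> supp P" "snd x > 0" "t = (M - fst x) / of_nat (snd x)" using tC unfolding C_def by blast
    have "fst x + 1 * of_nat (snd x) \<le> M" using tP x(1) by (auto simp: top_at_def fil_def)
    moreover have "fst x + 1 * of_nat (snd x) \<noteq> M"
    proof
      assume "fst x + 1 * of_nat (snd x) = M"
      then have "coeff p (snd x) = cf P x" using top_atD(2)[OF tP] by (metis add_diff_cancel_right' coeff_cp prod.collapse)
      then show False using x p0 coeff_eq_0[of p "snd x"] by (simp add: in_supp)
    qed
    ultimately show ?thesis using x by (simp add: pos_less_divide_eq)
  qed
  show "top_at t P M (cp t M P) \<and> coeff (cp t M P) 0 \<noteq> 0 \<and> (t \<in> C \<longrightarrow> degree (cp t M P) > 0)"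
    if tmin: "\<And>c. c \<in> C \<Longrightarrow> t \<le> c" for t
  proof -
    have "fst x + t * of_nat (snd x) \<le> M" if x: "x \<in> supp P" for x
    proof (cases "snd x = 0")
      case True
      then show ?thesis using tP x by (auto simp: top_at_def fil_def)
    next
      case False
      then have "t \<le> (M - fst x) / of_nat (snd x)" using x by (intro tmin) (auto simp: C_def)
      then have "t * of_nat (snd x) \<le> M - fst x" using False by (simp add: pos_le_divide_eq)
      then show ?thesis by linarith
    qed
    then have f: "fil 1 t M P" by (simp add: fil_def)
    have "coeff (cp t M P) 0 = coeff p 0" using top_atD(2)[OF tP] by (metis coeff_cp mult_zero_right of_nat_0)
    then have c0: "coeff (cp t M P) 0 \<noteq> 0" using p p0 by (metis leading_coeff_neq_0)
    then have "cp t M P \<noteq> 0" by (metis coeff_0)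
    moreover have "degree (cp t M P) > 0" if tC: "t \<in> C"
    proof -
      obtain x where x: "x \<in> supp P" "snd x > 0" "t = (M - fst x) / of_nat (snd x)" using tC unfolding C_def by blast
      then have "t * of_nat (snd x) = M - fst x" by simp
      then have "fst x = M - t * of_nat (snd x)" by simp
      then have "coeff (cp t M P) (snd x) = cf P x" by (metis coeff_cp prod.collapse)
      then have "snd x \<le> degree (cp t M P)" using x(1) by (intro le_degree) (simp add: in_supp)
      then show ?thesis using x(2) by simp
    qed
    ultimately show ?thesis using f c0 by (simp add: top_at_def)
  qed
qed

lemma top_at_sw:
  fixes P :: "'k::field_char_0 wa"
  assumes P: "P \<in> xspan \<nat>" and tP: "top_at 1 P (of_nat M) p"
  obtains p' where "top_at 1 (sw 1 P) (of_nat M) p'" "\<And>k. coeff p' k \<noteq> 0 \<longleftrightarrow> k \<le> M \<and> coeff p (M - k) \<noteq> 0"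
proof -
  define p' where "p' = cp 1 (of_nat M) (sw 1 P)"
  have t: "fil 1 1 (of_nat M) (sw 1 P)"
    "\<And>k. k \<le> M \<Longrightarrow> coeff p' k = 1 ^ k * (- 1) ^ (M - k) * coeff p (M - k)"
    using sw_top[OF P top_atD(1)[OF tP], of 1] top_atD(2)[OF tP] unfolding p'_def by blast+
  have big: "coeff p' k = 0" if "k > M" for k
  proof (rule ccontr)
    assume "coeff p' k \<noteq> 0"
    then have "(of_nat M - 1 * of_nat k, k) \<in> supp (sw 1 P)" unfolding p'_def by (rule cp_nonzero_point)
    then have "of_nat M - 1 * of_nat k \<in> (\<nat> :: rat set)" using sw_xspan[OF P, of 1] by (auto simp: xspan_def)
    then have "(of_nat M - 1 * of_nat k :: rat) \<ge> 0" by (rule Nats_nonneg)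
    then show False using that by simp
  qed
  have iff: "coeff p' k \<noteq> 0 \<longleftrightarrow> k \<le> M \<and> coeff p (M - k) \<noteq> 0" for k
    using t(2)[of k] big[of k] by (cases "k \<le> M") auto
  obtain j where j: "coeff p j \<noteq> 0" using top_atD(3)[OF tP] by (metis leading_coeff_neq_0)
  have "of_nat M - 1 * of_nat j \<in> (\<nat> :: rat set)" by (rule top_point_Nats[OF P tP j])
  then have "(of_nat M - 1 * of_nat j :: rat) \<ge> 0" by (rule Nats_nonneg)
  then have "j \<le> M" by simp
  then have "coeff p' (M - j) \<noteq> 0" using iff[of "M - j"] j by simp
  then have "p' \<noteq> 0" by (metis coeff_0)
  then have "top_at 1 (sw 1 P) (of_nat M) p'" using t(1) by (simp add: top_at_def p'_def)
  then show ?thesis using that iff by blast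
qed

text \<open>A bracket equal to 1 has a constant term, so \<open>p\<close> or \<open>q\<close> has a
  nonzero constant coefficient and \<open>d\<close> or \<open>e\<close> is the exponent of a power
  of \<open>X\<close>, hence at least 1. As both are positive,
  \<open>d + e > 1 \<ge> 1 + s\<close>.\<close>

lemma edge_Weyl_comm:
  fixes P Q :: "'k::field_char_0 wa"
  assumes E: "edge m n l P Q s d e p q" and PQ: "P \<in> xspan \<nat>" "Q \<in> xspan \<nat>" and s: "s \<le> 0" and m: "m > 1" "n > 1"
  shows "1 + s < d + e"
proof (rule ccontr)
  assume no: "\<not> 1 + s < d + e"
  have h: "cm Q P = 1" "1 + s > 0" "top_at s P d p" "top_at s Q e q" "d > 0" "of_nat m * e = of_nat n * d"
    using E by (auto simp: edge_def)
  have "of_nat m * e > 0" unfolding h(6) using h(5) m by simp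
  then have e: "e > 0" by (simp add: zero_less_mult_iff)
  have b: "br d e q p = 1" "d + e = 1 + s" using bracket_cases[OF h(1-4)] no by auto
  have ge1: "x \<ge> 1" if "x \<in> \<nat>" "x > 0" for x :: rat using that by (auto elim!: Nats_cases)
  have "coeff (br d e q p) 0 \<noteq> 0" unfolding b(1) by simp
  then have "coeff q 0 \<noteq> 0 \<or> coeff p 0 \<noteq> 0" unfolding coeff_br by auto
  then show False
  proof
    assume "coeff q 0 \<noteq> 0"
    then have "e \<in> \<nat>" using top_point_Nats[OF PQ(2) h(4), of 0] by simp
    then show False using ge1[of e] e h(5) b(2) s by simp
  next
    assume "coeff p 0 \<noteq> 0"
    then have "d \<in> \<nat>" using top_point_Nats[OF PQ(1) h(3), of 0] by simp
    then show False using ge1[of d] e h(5) b(2) s by simp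
  qed
qed

text \<open>\<open>Cj\<close> is a class of pairs closed under automorphisms, on which the total degree is at least \<open>M + N\<close>.\<close>

locale irreducible_class =
  fixes Cj :: "'k::field_char_0 wa \<Rightarrow> 'k wa \<Rightarrow> bool" and M N m n :: nat
  assumes K: "alg_closed TYPE('k)" and mn: "m > 1" "n > 1" "coprime m n" and MN: "M \<ge> 2" "N \<ge> 2" "m * N = n * M"
    and Cj_tr: "\<And>P Q k \<alpha>. Cj P Q \<Longrightarrow> k \<in> \<nat> \<Longrightarrow> Cj (tr k \<alpha> P) (tr k \<alpha> Q)"
    and Cj_sw: "\<And>P Q. Cj P Q \<Longrightarrow> Cj (sw 1 P) (sw 1 Q)"
    and Cj_Weyl: "\<And>P Q. Cj P Q \<Longrightarrow> P \<in> xspan \<nat> \<and> Q \<in> xspan \<nat> \<and> cm Q P = 1"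
    and Cj_irr: "\<And>P Q M' N' p q. Cj P Q \<Longrightarrow> top_at 1 P M' p \<Longrightarrow> top_at 1 Q N' q \<Longrightarrow> of_nat M + of_nat N \<le> M' + N'"
begin

text \<open>Let \<open>t > 1\<close> be the first slope with a second point. Exponents in
  \<open>\<nat>\<close> give \<open>t * degree p' \<le> M\<close>, so
  \<open>degree f \<ge> 2\<close> would yield \<open>1 + t \<ge> 2 t\<close>. Hence
  \<open>p'\<close> has a single root, which is nonzero and makes \<open>t\<close> an integer, so
  the degree-lowering substitution stays inside the Weyl algebra.\<close>

lemma no_pure_power:
  assumes C: "Cj P Q" and tP: "top_at 1 P (of_nat M) p" and tQ: "top_at 1 Q (of_nat N) q" and p0: "degree p = 0"
  shows False
proof -
  have W: "P \<in> xspan \<nat>" "Q \<in> xspan \<nat>" "cm Q P = 1" using Cj_Weyl[OF C] by auto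
  have nz: "p \<noteq> 0" "q \<noteq> 0" using tP tQ by (auto simp: top_at_def)
  have pos: "(of_nat M :: rat) > 0" "(of_nat N :: rat) > 0" using MN by simp_all
  have "br (of_nat M) (of_nat N) q p = 0"
  proof -
    have "(of_nat (M + N) :: rat) \<noteq> of_nat 2" using MN by (subst of_nat_eq_iff) simp
    then have "(of_nat M + of_nat N :: rat) \<noteq> 1 + 1" by simp
    then show ?thesis using bracket_cases[OF W(3) _ tP tQ] by auto
  qed
  from br_zero_degree[OF nz(2,1) this] have q0: "degree q = 0" using p0 pos by simp
  let ?CP = "(\<lambda>x. (of_nat M - fst x) / of_nat (snd x)) ` {x \<in> supp P. snd x > 0}"
  let ?CQ = "(\<lambda>x. (of_nat N - fst x) / of_nat (snd x)) ` {x \<in> supp Q. snd x > 0}"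
  note vP = vertical_edge[OF tP p0] and vQ = vertical_edge[OF tQ q0]
  have ne: "?CP \<union> ?CQ \<noteq> {}"
  proof
    assume e: "?CP \<union> ?CQ = {}"
    \<comment> \<open>Without other support points any slope is admissible; this one makes the
      weight sum \<open>M + N\<close> smaller than \<open>1 + ?t\<close>.\<close>
    let ?t = "of_nat M + of_nat N :: rat"
    have no: "?t \<le> c" if "c \<in> ?CP" for c using that e by blast
    have no': "?t \<le> c" if "c \<in> ?CQ" for c using that e by blast
    have "fil 1 ?t (of_nat M) P" "fil 1 ?t (of_nat N) Q"
      using vP(3)[OF no] vQ(3)[OF no'] top_atD(1) by blast+
    from weight_sum_ge[OF W(3) _ this] show False using pos by simp
  qed
  define t where "t = Min (?CP \<union> ?CQ)"
  have fin: "finite (?CP \<union> ?CQ)" by simp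
  have tin: "t \<in> ?CP \<union> ?CQ" unfolding t_def by (rule Min_in[OF fin ne])
  have tle: "t \<le> c" if "c \<in> ?CP \<union> ?CQ" for c unfolding t_def by (rule Min_le[OF fin that])
  have t1: "t > 1" using tin vP(2) vQ(2) by blast
  define p' q' where "p' = cp t (of_nat M) P" and "q' = cp t (of_nat N) Q"
  have eP: "top_at t P (of_nat M) p'" "coeff p' 0 \<noteq> 0" "t \<in> ?CP \<Longrightarrow> degree p' > 0"
    using vP(3)[of t] tle unfolding p'_def by blast+
  have eQ: "top_at t Q (of_nat N) q'" "coeff q' 0 \<noteq> 0" "t \<in> ?CQ \<Longrightarrow> degree q' > 0"
    using vQ(3)[of t] tle unfolding q'_def by blast+
  have nz': "p' \<noteq> 0" "q' \<noteq> 0" using eP eQ by auto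
  from tin have some: "degree p' > 0 \<or> degree q' > 0"
  proof (rule UnE)
    assume "t \<in> ?CP"
    from eP(3)[OF this] show ?thesis by simp
  next
    assume "t \<in> ?CQ"
    from eQ(3)[OF this] show ?thesis by simp
  qed
  have bnd: "t * of_nat (degree p') \<le> of_nat M" "t * of_nat (degree q') \<le> of_nat N"
    using Nats_nonneg[OF top_point_Nats[OF W(1) eP(1), of "degree p'"]]
      Nats_nonneg[OF top_point_Nats[OF W(2) eQ(1), of "degree q'"]] nz' by simp_all
  have tpos: "1 + t > 0" using t1 by simp
  have ge: "x \<ge> t" if "t * of_nat k \<le> x" "k > 0" for k and x :: rat
  proof -
    have "t * 1 \<le> t * of_nat k" using that(2) t1 by (intro mult_left_mono) auto
    then show ?thesis using that(1) by simp
  qed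
  \<comment> \<open>Equality would make \<open>t\<close> larger than \<open>M\<close> and
    \<open>N\<close>, as both are at least 2, but a second point on either edge forces
    \<open>t \<le> M\<close> or \<open>t \<le> N\<close>.\<close>
  have "of_nat M + of_nat N \<noteq> 1 + t"
  proof
    assume e: "of_nat M + of_nat N = 1 + t"
    have "(of_nat M :: rat) \<ge> of_nat 2" "(of_nat N :: rat) \<ge> of_nat 2" using MN by (simp_all only: of_nat_le_iff)
    then have "of_nat M < t" "of_nat N < t" using e by simp_all
    then show False using some ge[OF bnd(1)] ge[OF bnd(2)] by auto
  qed
  then have b0: "br (of_nat M) (of_nat N) q' p' = 0" using bracket_cases[OF W(3) tpos eP(1) eQ(1)] by auto
  have "(of_nat M :: rat) * of_nat (degree q') = of_nat N * of_nat (degree p')" by (rule br_zero_degree[OF nz'(2,1) b0])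
  then have dp: "degree p' > 0" using some pos by (intro gr0I) auto
  obtain f where f: "br (1 + t) (of_nat M) p' f = p'"
    using ode_exists[OF K tpos xspan_Nats_El1[OF W(1)] xspan_Nats_El1[OF W(2)] eP(1) pos(1) dp _ W(3)] by auto
  have "degree f = 1"
  proof (rule ccontr)
    assume "degree f \<noteq> 1"
    then have f2: "degree f \<ge> 2" using ode_degree_ge[OF f nz'(1) tpos pos(1)] by simp
    have "(1 + t) * of_nat (degree p') = of_nat M * of_nat (degree f)"
      by (rule ode_degree[OF f nz'(1) tpos pos(1) f2])
    also have "\<dots> \<ge> of_nat M * 2" using f2 by (intro mult_left_mono) auto
    finally have "(1 + t) * of_nat (degree p') \<ge> 2 * (t * of_nat (degree p'))" using bnd(1) by linarith
    then have "(1 + t) * of_nat (degree p') \<ge> (2 * t) * of_nat (degree p')" by (simp add: mult.assoc)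
    then have "1 + t \<ge> 2 * t" using dp by (simp only: mult_le_cancel_right_pos of_nat_0_less_iff)
    then show False using t1 by simp
  qed
  then obtain \<alpha> where \<alpha>: "order \<alpha> p' = degree p'" using ode_single[OF f nz'(1) tpos pos(1) K] by metis
  have "\<alpha> \<noteq> 0"
  proof
    assume "\<alpha> = 0"
    then have "order 0 p' > 0" using \<alpha> dp by simp
    then show False using order_0_coeff(2)[OF nz'(1)] eP(2) by blast
  qed
  then have "t \<in> El 1" using single_root_slope[OF eP(1) xspan_Nats_El1[OF W(1)] \<alpha>] dp by blast
  then have tN: "t \<in> \<nat>" using t1 by (simp add: El_def Nats_altdef2)
  have "(of_nat M :: rat) * of_nat (order \<alpha> q') = of_nat N * of_nat (order \<alpha> p')" by (rule br_zero_order[OF nz'(2,1) b0])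
  then have oq: "order \<alpha> q' > 0" using pos dp \<alpha> by (intro gr0I) auto
  obtain M' r where 1: "M' < of_nat M" "top_at 1 (tr t \<alpha> P) M' r"
    using tr_drops_degree[OF t1 eP(1)] \<alpha> dp by metis
  obtain N' r' where 2: "N' < of_nat N" "top_at 1 (tr t \<alpha> Q) N' r'"
    using tr_drops_degree[OF t1 eQ(1) oq] by metis
  show False using Cj_irr[OF Cj_tr[OF C tN] 1(2) 2(2)] 1(1) 2(1) by simp
qed

text \<open>If no root of \<open>p\<close> has multiplicity above \<open>M / 2\<close>, then
  \<open>degree f = 1\<close> and \<open>p\<close> has a single root, of multiplicity below
  \<open>M / 2\<close> since \<open>ode_root\<close> excludes equality. Translating it to 0 leaves
  one monomial below the diagonal, and exchanging the variables moves it above.\<close>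

lemma good_corner:
  assumes C: "Cj P Q" and tP: "top_at 1 P (of_nat M) p" and tQ: "top_at 1 Q (of_nat N) q"
  obtains P' Q' p' q' where "Cj P' Q'" "top_at 1 P' (of_nat M) p'" "top_at 1 Q' (of_nat N) q'"
    "2 * order 0 p' > M"
proof -
  have W: "P \<in> xspan \<nat>" "Q \<in> xspan \<nat>" "cm Q P = 1" using Cj_Weyl[OF C] by auto
  have p: "p \<noteq> 0" using tP by (auto simp: top_at_def)
  have dp: "degree p > 0" using no_pure_power[OF C tP tQ] by blast
  have pos: "(of_nat M :: rat) > 0" using MN by simp
  have two: "(1 + 1 :: rat) > 0" by simp
  obtain f where f: "br (1 + 1) (of_nat M) p f = p"
    using ode_exists[OF K two xspan_Nats_El1[OF W(1)] xspan_Nats_El1[OF W(2)] tP pos dp _ W(3)] by auto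
  have tr1: "\<exists>P' Q' q'. Cj P' Q' \<and> P' \<in> xspan \<nat> \<and> Q' \<in> xspan \<nat> \<and> top_at 1 P' (of_nat M) (pcompose p [:\<alpha>, 1:]) \<and> top_at 1 Q' (of_nat N) q'" for \<alpha>
    using Cj_tr[OF C Nats_1, of \<alpha>] Cj_Weyl[OF Cj_tr[OF C Nats_1, of \<alpha>]] top_at_tr[OF two tP, of \<alpha>] top_at_tr[OF two tQ, of \<alpha>] by blast
  show ?thesis
  proof (cases "\<exists>\<alpha>. 2 * order \<alpha> p > M")
    case True
    then obtain \<alpha> where "2 * order \<alpha> p > M" by blast
    then show ?thesis using tr1[of \<alpha>] that p by (metis order_pcompose_shift)
  next
    case False
    have "degree f = 1"
    proof (rule ccontr)
      assume "degree f \<noteq> 1"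
      then have "degree f \<ge> 2" using ode_degree_ge[OF f p two pos] by simp
      then obtain \<alpha> where "(1 + 1) * of_nat (order \<alpha> p) > (of_nat M :: rat)"
        using ode_big_root[OF f p two pos K] by blast
      then have "(of_nat (2 * order \<alpha> p) :: rat) > of_nat M" by simp
      then have "2 * order \<alpha> p > M" by (simp only: of_nat_less_iff)
      then show False using False by blast
    qed
    then obtain \<alpha> where \<alpha>: "order \<alpha> p = degree p" using ode_single[OF f p two pos K] by metis
    have "poly p \<alpha> = 0" using \<alpha> dp p by (simp add: order_root)
    from ode_root(2)[OF f p two pos this] have "(of_nat (2 * degree p) :: rat) \<noteq> of_nat M" using \<alpha> by simp
    then have "2 * degree p \<noteq> M" by metis
    then have lt: "2 * degree p < M" using False \<alpha> by (metis nat_neq_iff)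
    define p1 where "p1 = pcompose p [:\<alpha>, 1:]"
    obtain P1 Q1 q1 where 1: "Cj P1 Q1" "P1 \<in> xspan \<nat>" "Q1 \<in> xspan \<nat>" "top_at 1 P1 (of_nat M) p1" "top_at 1 Q1 (of_nat N) q1"
      using tr1[of \<alpha>] unfolding p1_def by blast
    have p1: "p1 \<noteq> 0" using 1(4) by (auto simp: top_at_def)
    have o1: "order 0 p1 = degree p" using \<alpha> p by (simp add: p1_def order_pcompose_shift)
    have d1: "degree p1 = degree p" by (simp add: p1_def degree_pcompose_shift)
    obtain p2 where p2: "top_at 1 (sw 1 P1) (of_nat M) p2" "\<And>k. coeff p2 k \<noteq> 0 \<longleftrightarrow> k \<le> M \<and> coeff p1 (M - k) \<noteq> 0"
      using top_at_sw[OF 1(2,4)] by blast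
    obtain q2 where q2: "top_at 1 (sw 1 Q1) (of_nat N) q2"
      using top_at_sw[OF 1(3,5)] by blast
    have p2nz: "p2 \<noteq> 0" using p2(1) by (auto simp: top_at_def)
    from order_0_coeff(1)[OF p2nz] have "order 0 p2 \<le> M" "coeff p1 (M - order 0 p2) \<noteq> 0" using p2(2) by blast+
    then have "M - order 0 p2 \<le> degree p" using le_degree[of p1] d1 by metis
    then have "2 * order 0 p2 > M" using lt by linarith
    then show ?thesis using that[OF Cj_sw[OF 1(1)] p2(1) q2] by blast
  qed
qed

lemma start_edge:
  assumes C: "Cj P Q" and tP: "top_at 1 P (of_nat M) p" and tQ: "top_at 1 Q (of_nat N) q"
  obtains P0 Q0 s d e p0 q0 where "Cj P0 Q0" "edge m n 1 P0 Q0 s d e p0 q0" "s < 0"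
    "vdeg 1 1 (cf P0) = of_nat M" "vdeg 1 1 (cf Q0) = of_nat N"
proof -
  obtain P1 Q1 p1 q1 where 1: "Cj P1 Q1" "top_at 1 P1 (of_nat M) p1" "top_at 1 Q1 (of_nat N) q1"
    "2 * order 0 p1 > M" using good_corner[OF assms] by metis
  have W: "P1 \<in> xspan \<nat>" "Q1 \<in> xspan \<nat>" "cm Q1 P1 = 1" using Cj_Weyl[OF 1(1)] by auto
  have nz: "p1 \<noteq> 0" "q1 \<noteq> 0" using 1 by (auto simp: top_at_def)
  have pos: "(of_nat M :: rat) > 0" "(of_nat N :: rat) > 0" using MN by simp_all
  have two: "(1 + 1 :: rat) > 0" by simp
  define b where "b = order 0 p1"
  have degM: "j \<le> M" if "coeff p1 j \<noteq> 0" for j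
    using Nats_nonneg[OF top_point_Nats[OF W(1) 1(2) that]] by simp
  have bM: "b \<le> M" unfolding b_def by (rule degM[OF order_0_coeff(1)[OF nz(1)]])
  \<comment> \<open>Otherwise the leading form is a power of \<open>Y\<close>, which the exchange of
    variables turns into a pure power of \<open>X\<close>.\<close>
  have "b \<noteq> M"
  proof
    assume bM: "b = M"
    obtain p2 where p2: "top_at 1 (sw 1 P1) (of_nat M) p2" "\<And>k. coeff p2 k \<noteq> 0 \<longleftrightarrow> k \<le> M \<and> coeff p1 (M - k) \<noteq> 0"
      using top_at_sw[OF W(1) 1(2)] by blast
    obtain q2 where q2: "top_at 1 (sw 1 Q1) (of_nat N) q2" using top_at_sw[OF W(2) 1(3)] by blast
    have "coeff p2 k = 0" if "k > 0" for k
    proof (rule ccontr)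
      assume "coeff p2 k \<noteq> 0"
      then have "k \<le> M" "coeff p1 (M - k) \<noteq> 0" using p2(2) by blast+
      moreover have "M - k < b" using bM that \<open>k \<le> M\<close> by simp
      ultimately show False using order_0_coeff(2)[OF nz(1)] b_def by blast
    qed
    then have "degree p2 \<le> 0" by (intro degree_le) auto
    then have "degree p2 = 0" by simp
    then show False using no_pure_power[OF Cj_sw[OF 1(1)] p2(1) q2] by blast
  qed
  then have bM: "b < M" using bM by simp
  have de: "of_nat m * of_nat N = (of_nat n * of_nat M :: rat)" using MN(3) by (metis of_nat_mult)
  have "br (of_nat M) (of_nat N) q1 p1 = 0"
  proof -
    have "(of_nat (M + N) :: rat) \<noteq> of_nat 2" using MN by (subst of_nat_eq_iff) simp
    then have "(of_nat M + of_nat N :: rat) \<noteq> 1 + 1" by simp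
    then show ?thesis using bracket_cases[OF W(3) _ 1(2,3)] by auto
  qed
  then have ord: "m * order 0 q1 = n * order 0 p1"
    using ratio_nat[OF de pos(1)] br_zero_order[OF nz(2,1)] by blast
  have big: "(1 + 1) * of_nat (order 0 p1) > (of_nat M :: rat)"
  proof -
    have "(of_nat (2 * order 0 p1) :: rat) > of_nat M" using 1(4) by (simp only: of_nat_less_iff)
    then show ?thesis by simp
  qed
  obtain s d e p2 q2 where ne: "s < 1" "1 + s > 0" "top_at s P1 d p2" "top_at s Q1 e q2" "d > 0"
    "of_nat m * e = of_nat n * d" "degree p2 = b" "degree q2 = order 0 q1"
    "d - s * of_nat b = of_nat M - 1 * of_nat b" "order 0 p2 < degree p2" "order 0 q2 < degree q2"
    "(1 + s) * of_nat (degree p2) > d"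
    using next_edge[OF mn W(3) two 1(2,3) pos(1) de ord big] unfolding b_def by metis
  have E: "edge m n 1 P1 Q1 s d e p2 q2"
    unfolding edge_def using ne ord W xspan_Nats_El1[OF W(1)] xspan_Nats_El1[OF W(2)] by (simp add: b_def)
  have one: "(1 :: int) > 0" "of_int 1 = (1 :: rat) * of_int 1" by simp_all
  have v1: "vdeg 1 1 (cf P1) = of_nat M" "vdeg 1 1 (cf Q1) = of_nat N"
    using vdeg_top[OF one 1(2)] vdeg_top[OF one 1(3)] by simp_all
  consider "s < 0" | "s = 0" | "s > 0" by linarith
  then show ?thesis
  proof cases
    case 1
    then show ?thesis using that[OF \<open>Cj P1 Q1\<close> E] v1 by blast
  next
    \<comment> \<open>Here \<open>Y \<mapsto> Y + \<alpha>\<close> is still an automorphism of the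
      Weyl algebra; one more step leads to a negative slope without changing the total
      degrees.\<close>
    case 2
    obtain f \<alpha> where \<alpha>: "(1 + s) * of_nat (order \<alpha> p2) > d" using root_choice[OF K E] by metis
    have lt: "1 + s < d + e" using edge_Weyl_comm[OF E W(1,2) _ mn(1,2)] 2 by simp
    have C2: "Cj (tr s \<alpha> P1) (tr s \<alpha> Q1)" using Cj_tr[OF \<open>Cj P1 Q1\<close>] 2 by simp
    then have W2: "tr s \<alpha> P1 \<in> xspan (El 1)" "tr s \<alpha> Q1 \<in> xspan (El 1)" using Cj_Weyl xspan_Nats_El1 by blast+
    obtain s' d' e' p' q' where "s' < s" "edge m n 1 (tr s \<alpha> P1) (tr s \<alpha> Q1) s' d' e' p' q'"
      using edge_translate[OF mn E lt \<alpha> zero_less_one W2] by metis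
    moreover have "P1 \<noteq> 0" "Q1 \<noteq> 0" using W(3) by auto
    then have "vdeg 1 1 (cf (tr s \<alpha> P1)) = of_nat M" "vdeg 1 1 (cf (tr s \<alpha> Q1)) = of_nat N"
      using lead_tr(1)[of 1 1 s P1 \<alpha>] lead_tr(1)[of 1 1 s Q1 \<alpha>] v1 2 by simp_all
    ultimately show ?thesis using that[OF C2] 2 by blast
  next
    \<comment> \<open>This case is impossible. A slope strictly between 0 and 1 is not an integer,
      which excludes a single nonzero root and with it \<open>degree f = 1\<close>.\<close>
    case 3
    have p2: "p2 \<noteq> 0" using ne(3) by (auto simp: top_at_def)
    have sI: "s \<notin> El 1"
    proof
      assume "s \<in> El 1"
      then obtain i where "s = of_int i" by (auto simp: El_def elim: Ints_cases)
      then show False using 3 ne(1) by simp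
    qed
    obtain f \<alpha> where f: "br (1 + s) d p2 f = p2" "\<And>j. coeff f j \<noteq> 0 \<Longrightarrow> 1 + s - s * of_nat j \<in> El 1"
      and f1: "degree f = 1 \<Longrightarrow> order \<alpha> p2 = degree p2"
      using root_choice[OF K E] by metis
    have "degree f \<noteq> 1"
    proof
      assume "degree f = 1"
      then have o: "order \<alpha> p2 = degree p2" by (rule f1)
      then have "\<alpha> \<noteq> 0" using ne(10) by auto
      then show False using single_root_slope[OF ne(3) xspan_Nats_El1[OF W(1)] o] ne(10) sI by simp
    qed
    then have k: "degree f \<ge> 2" using ode_degree_ge[OF f(1) p2 ne(2,5)] by simp
    \<comment> \<open>\<open>E\<close> is the \<open>X\<close>-exponent of the top term of
      \<open>f\<close>, an integer, and \<open>E d = (1 + s) (M - b) > 0\<close>. So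
      \<open>E \<ge> 1\<close>, that is \<open>degree f \<le> 1\<close>.\<close>
    define E where "E = 1 + s - s * of_nat (degree f)"
    have "coeff f (degree f) \<noteq> 0" using ode_nz[OF f(1) p2 ne(2,5)] by simp
    then have "E \<in> \<int>" using f(2) unfolding E_def by (force simp: El_def)
    have "E * d = (1 + s) * d - s * (d * of_nat (degree f))" by (simp add: E_def algebra_simps)
    also have "d * of_nat (degree f) = (1 + s) * of_nat b" using ode_degree[OF f(1) p2 ne(2,5) k] ne(7) by simp
    also have "(1 + s) * d - s * ((1 + s) * of_nat b) = (1 + s) * (d - s * of_nat b)" by (simp add: algebra_simps)
    also have "\<dots> > 0" using ne(2) bM unfolding ne(9) by simp
    finally have "E > 0" using ne(5) by (simp add: zero_less_mult_iff)
    then have "0 \<le> E - 1" using Ints_less_imp_le[of 0 E] \<open>E \<in> \<int>\<close> by simp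
    then have "s * of_nat (degree f) \<le> s * 1" by (simp add: E_def)
    then have "of_nat (degree f) \<le> (1 :: rat)" using 3 by (simp only: mult_le_cancel_left_pos)
    then show ?thesis using k by simp
  qed
qed

end

section \<open>From the chain of edges to the stated sequences\<close>

lemma endo_comm:
  assumes "alg_endo Weyl \<phi>" "A \<in> Weyl" "B \<in> Weyl"
  shows "\<phi> (wcomm A B) = wcomm (\<phi> A) (\<phi> B)"
proof -
  obtain A' B' where AB: "A = cf A'" "B = cf B'" "A' \<in> xspan \<nat>" "B' \<in> xspan \<nat>"
    using assms(2,3) by (auto simp: Weyl_eq)
  have W: "wmul A B \<in> Weyl" "wmul B A \<in> Weyl" "wsmul (- 1) (wmul B A) \<in> Weyl"
    unfolding AB cf_mult[symmetric] wsmul_cf Weyl_eq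
    by (auto intro!: imageI xspan_mult xspan_smul exps_Nats AB)
  have sub: "wsub X Y = wadd X (wsmul (- 1) Y)" for X Y :: "'a wel"
    by (simp add: fun_eq_iff wsub_def wadd_def wsmul_def)
  show ?thesis
    using assms W unfolding wcomm_def sub alg_endo_def by auto
qed

theorem theorem6p1:
  fixes P Q :: "'k::field_char_0 wel" and m n :: nat
  assumes K: "alg_closed TYPE('k)"
    and irr: "irreducible_pair P Q"
    and m: "m > 1" and n: "n > 1" and mn: "coprime m n"
    and ratio: "vdeg 1 1 P / vdeg 1 1 Q = of_nat m / of_nat n"
  shows "\<exists>(\<nu>::nat) (\<psi>::'k wel \<Rightarrow> 'k wel) (l::nat \<Rightarrow> nat) (PP::nat \<Rightarrow> 'k wel) (QQ::nat \<Rightarrow> 'k wel)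
           (\<rho>::nat \<Rightarrow> int) (\<sigma>::nat \<Rightarrow> int) (\<phi>::nat \<Rightarrow> 'k wel \<Rightarrow> 'k wel).
    \<nu> \<ge> 1 \<and> alg_auto Weyl \<psi>
    \<and> (\<forall>j\<le>\<nu>. l j \<ge> 1 \<and> PP j \<in> Wl (l j) \<and> QQ j \<in> Wl (l j) \<and> (\<rho> j, \<sigma> j) \<in> Vset)
    \<and> (\<forall>j\<in>{1..\<nu>}. alg_auto (Wl (l j)) (\<phi> j))
    \<and> PP 0 = \<psi> P \<and> QQ 0 = \<psi> Q \<and> l 0 = 1 \<and> vlt (\<rho> 0, \<sigma> 0) (1, 0)
    \<and> vdeg 1 1 (PP 0) = vdeg 1 1 P \<and> vdeg 1 1 (QQ 0) = vdeg 1 1 Q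
    \<and> (\<forall>j\<in>{1..\<nu>}. int (l j) = lcm (int (l (j - 1))) (\<rho> (j - 1))
         \<and> PP j = \<phi> j (PP (j - 1)) \<and> QQ j = \<phi> j (QQ (j - 1)))
    \<comment> \<open>(1)--(6), for 0 \<le> j \<le> \<nu>\<close>
    \<and> (\<forall>j\<le>\<nu>.
          wcomm (QQ j) (PP j) = wone
        \<and> vpt 1 (-1) (en (\<rho> j) (\<sigma> j) (PP j)) < 0 \<and> vpt 1 (-1) (en (\<rho> j) (\<sigma> j) (QQ j)) < 0
        \<and> (\<rho> j, \<sigma> j) \<in> Val (PP j) \<inter> Val (QQ j)
        \<and> vdeg (\<rho> j) (\<sigma> j) (PP j) > 0 \<and> vdeg (\<rho> j) (\<sigma> j) (QQ j) > 0
        \<and> vdeg (\<rho> j) (\<sigma> j) (PP j) / vdeg (\<rho> j) (\<sigma> j) (QQ j) = of_nat m / of_nat n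
        \<and> fst (en (\<rho> j) (\<sigma> j) (PP j)) = of_nat m / of_nat n * fst (en (\<rho> j) (\<sigma> j) (QQ j))
        \<and> of_nat (snd (en (\<rho> j) (\<sigma> j) (PP j)))
            = (of_nat m / of_nat n :: rat) * of_nat (snd (en (\<rho> j) (\<sigma> j) (QQ j))))
    \<comment> \<open>(7)--(11), for 1 \<le> j \<le> \<nu>\<close>
    \<and> (\<forall>j\<in>{1..\<nu>}.
          vlt (\<rho> j, \<sigma> j) (\<rho> (j - 1), \<sigma> (j - 1))
        \<and> vdeg (\<rho> (j - 1)) (\<sigma> (j - 1)) (PP j) = vdeg (\<rho> (j - 1)) (\<sigma> (j - 1)) (PP (j - 1))
        \<and> vdeg (\<rho> (j - 1)) (\<sigma> (j - 1)) (QQ j) = vdeg (\<rho> (j - 1)) (\<sigma> (j - 1)) (QQ (j - 1))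
        \<and> (\<forall>r s. (r, s) \<in> Vset \<and> vlt (\<rho> (j - 1), \<sigma> (j - 1)) (r, s) \<and> vlt (r, s) (-1, 1) \<longrightarrow>
              lead r s (PP j) = lead r s (PP (j - 1)) \<and> lead r s (QQ j) = lead r s (QQ (j - 1)))
        \<and> en (\<rho> j) (\<sigma> j) (PP j) = st (\<rho> (j - 1)) (\<sigma> (j - 1)) (PP j)
        \<and> (\<exists>F. F \<in> Wl (l (j - 1)) \<and> F \<noteq> wzero
              \<and> homogeneous (\<rho> (j - 1)) (\<sigma> (j - 1)) F \<and> card (wsupp F) \<noteq> 1
              \<and> vdeg (\<rho> (j - 1)) (\<sigma> (j - 1)) F = of_int (\<rho> (j - 1) + \<sigma> (j - 1))
              \<and> wcomm_rs (\<rho> (j - 1)) (\<sigma> (j - 1)) (PP (j - 1)) F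
                  = lead (\<rho> (j - 1)) (\<sigma> (j - 1)) (PP (j - 1))
              \<and> (en (\<rho> (j - 1)) (\<sigma> (j - 1)) F = (1, 1) \<longrightarrow>
                   st (\<rho> (j - 1)) (\<sigma> (j - 1)) (PP j) = en (\<rho> (j - 1)) (\<sigma> (j - 1)) (PP (j - 1)))))
    \<comment> \<open>(12), (13)\<close>
    \<and> (\<forall>j<\<nu>. wcomm_rs (\<rho> j) (\<sigma> j) (QQ j) (PP j) = wzero)
    \<and> wcomm_rs (\<rho> \<nu>) (\<sigma> \<nu>) (QQ \<nu>) (PP \<nu>) = wone"
proof -
  obtain \<psi>0 where \<psi>0: "alg_endo Weyl \<psi>0" "P = \<psi>0 wX" "Q = \<psi>0 wY" and deg2: "vdeg 1 1 P \<ge> 2" "vdeg 1 1 Q \<ge> 2"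
    and min: "\<And>\<phi>1 \<phi>2. alg_auto Weyl \<phi>1 \<Longrightarrow> alg_auto Weyl \<phi>2 \<Longrightarrow>
        \<not> vdeg 1 1 (\<phi>1 (\<psi>0 (\<phi>2 wX))) + vdeg 1 1 (\<phi>1 (\<psi>0 (\<phi>2 wY))) < vdeg 1 1 (\<psi>0 wX) + vdeg 1 1 (\<psi>0 wY)"
    using irr unfolding irreducible_pair_def by blast
  have XY: "wX = cf (mon 1 0 :: 'k wa)" "wY = cf (mon 0 1 :: 'k wa)"
    by (auto simp: wX_def wY_def cf_mon fun_eq_iff)
  have XYW: "wX \<in> (Weyl :: 'k wel set)" "wY \<in> (Weyl :: 'k wel set)" unfolding XY Weyl_eq by auto
  have PQW: "P \<in> Weyl" "Q \<in> Weyl" using \<psi>0 XYW by (auto simp: alg_endo_def)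
  have "cm (mon 0 1) (mon 1 0) = (1 :: 'k wa)"
    by (simp add: mon_mult_eq lx_0 ly_mon lx_mon smul_simps one_wa_def)
  then have "wcomm wY wX = (wone :: 'k wel)" unfolding XY wcomm_cf wone_cf by simp
  then have QP: "wcomm Q P = wone"
    using endo_comm[OF \<psi>0(1) XYW(2,1)] \<psi>0 by (simp add: alg_endo_def)
  \<comment> \<open>The orbit of the pair under automorphisms of the Weyl algebra; minimality of the
    pair enters with \<open>\<phi>2 = id\<close>.\<close>
  define Cj where "Cj P0 Q0 \<longleftrightarrow> (\<exists>\<psi>. alg_auto Weyl \<psi> \<and> \<psi> P = cf P0 \<and> \<psi> Q = cf Q0)" for P0 Q0 :: "'k wa"
  have Cj_Weyl: "P0 \<in> xspan \<nat> \<and> Q0 \<in> xspan \<nat> \<and> cm Q0 P0 = 1" if C: "Cj P0 Q0" for P0 Q0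
  proof -
    obtain \<psi> where \<psi>: "alg_auto Weyl \<psi>" "\<psi> P = cf P0" "\<psi> Q = cf Q0" using C by (auto simp: Cj_def)
    then have e: "alg_endo Weyl \<psi>" by (simp add: alg_auto_def)
    then have "\<psi> P \<in> Weyl" "\<psi> Q \<in> Weyl" using PQW by (simp_all add: alg_endo_def)
    then have "cf P0 \<in> cf ` xspan \<nat>" "cf Q0 \<in> cf ` xspan \<nat>" unfolding \<psi> Weyl_eq by simp_all
    moreover have "cf (cm Q0 P0) = cf 1"
      using endo_comm[OF e PQW(2,1)] QP \<psi> e by (simp add: wcomm_cf wone_cf alg_endo_def)
    ultimately show ?thesis by (auto simp: cf_inject)
  qed
  have Cj_tr: "Cj (tr k \<alpha> P0) (tr k \<alpha> Q0)" if C: "Cj P0 Q0" and k: "k \<in> \<nat>" for P0 Q0 k \<alpha>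
  proof -
    obtain \<psi> where \<psi>: "alg_auto Weyl \<psi>" "\<psi> P = cf P0" "\<psi> Q = cf Q0" using C by (auto simp: Cj_def)
    have "alg_auto Weyl (lft (tr k \<alpha>))" unfolding Weyl_eq by (rule tr_auto[OF exps_Nats k])
    then have "alg_auto Weyl (lft (tr k \<alpha>) \<circ> \<psi>)" using \<psi>(1) by (rule alg_auto_comp)
    then show ?thesis unfolding Cj_def using \<psi> by (intro exI[of _ "lft (tr k \<alpha>) \<circ> \<psi>"]) simp
  qed
  have Cj_sw: "Cj (sw 1 P0) (sw 1 Q0)" if C: "Cj P0 Q0" for P0 Q0
  proof -
    obtain \<psi> where \<psi>: "alg_auto Weyl \<psi>" "\<psi> P = cf P0" "\<psi> Q = cf Q0" using C by (auto simp: Cj_def)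
    have "alg_auto Weyl (lft (sw (1 :: 'k)))" by (rule sw_auto) simp
    then have "alg_auto Weyl (lft (sw 1) \<circ> \<psi>)" using \<psi>(1) by (rule alg_auto_comp)
    then show ?thesis unfolding Cj_def using \<psi> by (intro exI[of _ "lft (sw 1) \<circ> \<psi>"]) simp
  qed
  have one: "(1 :: int) > 0" "of_int 1 = (1 :: rat) * of_int 1" by simp_all
  obtain P1 Q1 where PQ1: "P = cf P1" "Q = cf Q1" "P1 \<in> xspan \<nat>" "Q1 \<in> xspan \<nat>"
    using PQW by (auto simp: Weyl_eq)
  have C1: "Cj P1 Q1" unfolding Cj_def using alg_auto_id PQ1 by (intro exI[of _ id]) simp
  have "cm Q1 P1 = 1" using Cj_Weyl[OF C1] by blast
  then have nz: "P1 \<noteq> 0" "Q1 \<noteq> 0" by auto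
  obtain M' p where tP': "top_at 1 P1 M' p" using top_at_exists[OF nz(1)] by metis
  obtain N' q where tQ': "top_at 1 Q1 N' q" using top_at_exists[OF nz(2)] by metis
  have nat_deg: "\<exists>k::nat. d = of_nat k" if "R \<in> xspan \<nat>" "top_at 1 R d r" for R :: "'k wa" and d r
  proof -
    have "d - 1 * of_nat (degree r) \<in> \<nat>" using top_point_Nats[OF that] top_atD(3)[OF that(2)] by simp
    then have "d - of_nat (degree r) + of_nat (degree r) \<in> \<nat>" using Nats_add of_nat_in_Nats by (metis mult_1)
    then show ?thesis by (auto elim: Nats_cases)
  qed
  obtain M where M': "M' = of_nat M" using nat_deg[OF PQ1(3) tP'] by blast
  obtain N where N': "N' = of_nat N" using nat_deg[OF PQ1(4) tQ'] by blast
  note tP = tP'[unfolded M'] and tQ = tQ'[unfolded N']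
  have vPQ: "vdeg 1 1 P = of_nat M" "vdeg 1 1 Q = of_nat N"
    using vdeg_top[OF one tP] vdeg_top[OF one tQ] by (simp_all add: PQ1)
  have "(of_nat 2 :: rat) \<le> of_nat M" "(of_nat 2 :: rat) \<le> of_nat N" using deg2 vPQ by simp_all
  then have MN2: "M \<ge> 2" "N \<ge> 2" by (simp_all only: of_nat_le_iff)
  have MN: "m * N = n * M"
  proof -
    have "(of_nat M :: rat) * of_nat n = of_nat m * of_nat N"
      using ratio MN2 n unfolding vPQ by (simp add: frac_eq_eq)
    then have "(of_nat (M * n) :: rat) = of_nat (m * N)" by simp
    then have "M * n = m * N" by (simp only: of_nat_eq_iff)
    then show ?thesis by (simp add: mult.commute)
  qed
  have Cj_irr: "of_nat M + of_nat N \<le> M0 + N0"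
    if C: "Cj P0 Q0" and t: "top_at 1 P0 M0 p0" "top_at 1 Q0 N0 q0" for P0 Q0 M0 N0 p0 q0
  proof -
    obtain \<psi> where \<psi>: "alg_auto Weyl \<psi>" "\<psi> P = cf P0" "\<psi> Q = cf Q0" using C by (auto simp: Cj_def)
    from min[OF \<psi>(1) alg_auto_id] have "\<not> vdeg 1 1 (\<psi> P) + vdeg 1 1 (\<psi> Q) < vdeg 1 1 P + vdeg 1 1 Q"
      by (simp flip: \<psi>0(2,3))
    then show ?thesis unfolding vPQ \<psi>(2,3) vdeg_top[OF one t(1)] vdeg_top[OF one t(2)] by simp
  qed
  interpret C: irreducible_class Cj M N m n
    by unfold_locales (fact K m n mn MN2 MN Cj_tr Cj_sw Cj_Weyl Cj_irr)+
  obtain P0 Q0 s d e p0 q0 where C0: "Cj P0 Q0" and E0: "edge m n 1 P0 Q0 s d e p0 q0" and s0: "s < 0"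
    and v0: "vdeg 1 1 (cf P0) = of_nat M" "vdeg 1 1 (cf Q0) = of_nat N"
    using C.start_edge[OF C1 tP tQ] by metis
  obtain \<psi> where \<psi>: "alg_auto Weyl \<psi>" "\<psi> P = cf P0" "\<psi> Q = cf Q0" using C0 by (auto simp: Cj_def)
  obtain \<nu> L PP QQ S A where c0: "L 0 = 1" "PP 0 = P0" "QQ 0 = Q0" "S 0 = s"
    and ch: "chain m n \<nu> L PP QQ S (A :: nat \<Rightarrow> 'k)"
    using chain_exists[OF K m n mn E0] by metis
  have stp: "stp m n (L i) (PP i) (QQ i) (S i) (A i) (L (Suc i)) (PP (Suc i)) (QQ (Suc i)) (S (Suc i))" if "i < \<nu>" for i
    using ch that by (simp add: chain_def)
  obtain d1 e1 p1 q1 where last: "edge m n (L \<nu>) (PP \<nu>) (QQ \<nu>) (S \<nu>) d1 e1 p1 q1" "d1 + e1 = 1 + S \<nu>"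
    using ch by (auto simp: chain_def)
  have ex_edge: "\<exists>d e p q. edge m n (L j) (PP j) (QQ j) (S j) d e p q" if "j \<le> \<nu>" for j
  proof (cases "j = \<nu>")
    case False
    then have "j < \<nu>" using that by simp
    from stp[OF this] show ?thesis unfolding stp_def by blast
  qed (use last in blast)
  \<comment> \<open>A chain of length 0 would end with bracket 1 at a negative slope, which
    \<open>edge_Weyl_comm\<close> excludes inside the Weyl algebra.\<close>
  have \<nu>: "\<nu> \<ge> 1"
  proof (rule ccontr)
    assume "\<not> \<nu> \<ge> 1"
    then have "\<nu> = 0" by simp
    then have "edge m n 1 P0 Q0 s d1 e1 p1 q1" "d1 + e1 = 1 + s" using last c0 by simp_all
    then show False using edge_Weyl_comm[of m n 1 P0 Q0 s d1 e1 p1 q1] Cj_Weyl[OF C0] s0 m n by simp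
  qed
  let ?r = "\<lambda>j. den (S j)" and ?c = "\<lambda>j. num (S j)"
  let ?\<phi> = "\<lambda>j. lft (tr (S (j - 1)) (A (j - 1)))"
  have dn: "(den 0, num 0) = (1, 0)" by simp
  have s1: "1 + s > 0" using E0 by (simp add: edge_def)
  have vlt0: "vlt (?r 0, ?c 0) (1, 0)"
    using slope_vlt[of 0 s] s0 s1 c0(4) by (simp add: dn)
  have step_at: "stp m n (L (j - 1)) (PP (j - 1)) (QQ (j - 1)) (S (j - 1)) (A (j - 1)) (L j) (PP j) (QQ j) (S j)"
    if "j \<in> {1..\<nu>}" for j
    using that stp[of "j - 1"] by (cases j) auto
  note edge_at = edge_facts[OF _ m n] and facts_at = stp_facts[OF K step_at]
  show ?thesis
    apply (rule exI[of _ \<nu>], rule exI[of _ \<psi>], rule exI[of _ L], rule exI[of _ "\<lambda>j. cf (PP j)"],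
        rule exI[of _ "\<lambda>j. cf (QQ j)"], rule exI[of _ ?r], rule exI[of _ ?c], rule exI[of _ ?\<phi>])
    apply (intro conjI)
    subgoal by (rule \<nu>)
    subgoal by (rule \<psi>(1))
    subgoal by (intro allI impI, drule ex_edge, elim exE, intro conjI edge_at(1-4))
    subgoal by (intro ballI facts_at(1))
    subgoal by (simp add: c0 \<psi>)
    subgoal by (simp add: c0 \<psi>)
    subgoal by (rule c0(1))
    subgoal by (rule vlt0)
    subgoal by (simp add: c0 v0 vPQ)
    subgoal by (simp add: c0 v0 vPQ)
    subgoal by (intro ballI conjI facts_at(2-4))
    subgoal by (intro allI impI, drule ex_edge, elim exE, intro conjI edge_at(5-13))
    subgoal by (intro ballI conjI facts_at(5-7,9,10);
        (assumption | (intro allI impI, elim conjE, rule facts_at(8), assumption+)))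
    subgoal by (intro allI impI, rule stp_facts(11)[OF K stp])
    subgoal by (rule edge_comm_zero(2)[OF last])
    done
qed

end
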